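(* Let $\Omega$ be the unit square in $\mathbb{R}^2$ and $\omega\subset\subset\Omega$ a smooth subdomain with boundary $\gamma$. Let $(T_h)_h$ be a regular family of triangulations of $\Omega$ and $V_h$ the associated $P^1$ finite element space. Let $0<s\le 1/2$ and $\varphi\in H^{-1/2+s}(\gamma)$. Let $(S_{\tilde h})_{\tilde h}$ be a family of quasi-uniform triangulations of $\gamma$, where $S_{\tilde h}$ is represented by its subintervals (arcs) $\gamma_1,\dots,\gamma_{N_{\tilde h}}$. Consider points $x_1,\dots,x_{N_{\tilde h}}$ with $x_i\in\gamma_i$, and the approximation of $\varphi$ given by $$\varphi_h^{\tilde h}=\sum_{i=1}^{N_{\tilde h}}\lambda_i\,\delta_{x_i},\qquad \lambda_i=\langle\varphi,\mathbf{1}_{\gamma_i}\rangle .$$ Then there exists a constant $C>0$, independent of $h$, $\tilde h$, $\varphi$ and $v_h$, such that $$\left|\langle\varphi,v_h\rangle-\langle\varphi_h^{\tilde h},v_h\rangle\right|\le C\,\sqrt{\frac{\tilde h}{h}}\;\tilde h^{\,s}\,\|\varphi\|_{-1/2+s,\gamma}\,|v_h|_{1,\Omega}$$ for all functions $v_h$ in $V_h$.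
   Context: The triangulations $T_h$ are conforming, and "regular family" is the usual finite element term (shape-regular: the ratio of the diameter of each triangle to the radius of its inscribed disc is bounded uniformly over all triangles and all $h$), $h$ being the mesh size of $T_h$. The $P^1$ space is $V_h=\{v_h\in C^0(\overline\Omega): v_h|_K \text{ is affine for every } K\in T_h\}$. A triangulation $S_{\tilde h}$ of $\gamma$ is a partition of $\gamma$ (up to endpoints) into arcs $\gamma_1,\dots,\gamma_{N_{\tilde h}}$; the family is quasi-uniform if there are constants $0<c<C'$ independent of $\tilde h$ with $c\tilde h\le|\gamma_i|\le C'\tilde h$ for all $i$, where $|\gamma_i|$ is arc length. $\mathbf 1_{\gamma_i}$ is the characteristic function of $\gamma_i$, and $\delta_{x_i}$ is the Dirac mass at $x_i$. $\langle\cdot,\cdot\rangle$ denotes the duality pairing between $H^{-1/2+s}(\gamma)$ (the dual of $H^{1/2-s}(\gamma)$, with norm $\|\cdot\|_{-1/2+s,\gamma}$) and $H^{1/2-s}(\gamma)$, applied to the trace of $v_h$ on $\gamma$; the combination of Dirac masses acts by $\langle\varphi_h^{\tilde h},v_h\rangle=\sum_{i}\lambda_i v_h(x_i)$. For $0<r<1/2$, the norm on $H^r(\gamma)$ is $\left(\int_\gamma|w|^2\right)^{1/2}+\left(\int_\gamma\int_\gamma\frac{|w(y)-w(x)|^2}{|y-x|^{1+2r}}\right)^{1/2}$, and for $r=0$ it is the $L^2(\gamma)$ norm. Finally $|v_h|_{1,\Omega}=\left(\int_\Omega|\nabla v_h|^2\right)^{1/2}$.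
   Formalization: The mesh size h is assumed to satisfy θh ≤ diam K for all triangles K of T_h, with θ > 0 independent of h (quasi-uniformity if h is the largest diameter); for merely shape-regular graded meshes with h the largest diameter the estimate fails. *)

theory Defs
  imports "HOL-Analysis.Analysis"
begin

section \<open>Smooth planar domains and arc length on their boundary\<close>

text \<open>
  A \<open>C\<^sup>\<infinity>\<close> regular simple closed curve, given by a 1-periodic parametrisation; the function
  \<open>D k\<close> is the \<open>k\<close>-th derivative of \<open>c\<close>.
\<close>

definition smooth_closed_curve :: "(real \<Rightarrow> real^2) \<Rightarrow> bool" where
  "smooth_closed_curve c \<longleftrightarrow>
     (\<exists>D. D (0::nat) = c \<and> (\<forall>k t. (D k has_vector_derivative D (Suc k) t) (at t))) \<and>
     (\<forall>t. c (t + 1) = c t) \<and> inj_on c {0..<1} \<and>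
     (\<forall>t. vector_derivative c (at t) \<noteq> 0)"

definition curve_system :: "nat \<Rightarrow> (nat \<Rightarrow> real \<Rightarrow> real^2) \<Rightarrow> (real^2) set" where
  "curve_system m c = (\<Union>j<m. range (c j))"

text \<open>
  A bounded planar domain is smooth if its boundary consists of finitely many disjoint smooth
  closed curves (several of them if the domain has holes). Since \<open>\<omega>\<close> is connected and open, it
  then lies locally on one side of each of these curves.
\<close>

definition smooth_domain :: "(real^2) set \<Rightarrow> nat \<Rightarrow> (nat \<Rightarrow> real \<Rightarrow> real^2) \<Rightarrow> bool" where
  "smooth_domain \<omega> m c \<longleftrightarrow>
     open \<omega> \<and> connected \<omega> \<and> \<omega> \<noteq> {} \<and>
     (\<forall>j<m. smooth_closed_curve (c j)) \<and>
     disjoint_family_on (\<lambda>j. range (c j)) {..<m} \<and>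
     frontier \<omega> = curve_system m c"

text \<open>
  The arc length measure, on the Borel sets of the curve system: the push-forward of
  \<open>|c\<^sub>j'(t)| dt\<close> on \<open>[0,1)\<close>, summed over \<open>j < m\<close>.
\<close>

definition arclength :: "nat \<Rightarrow> (nat \<Rightarrow> real \<Rightarrow> real^2) \<Rightarrow> (real^2) measure" where
  "arclength m c =
     distr (density (count_space {..<m} \<Otimes>\<^sub>M restrict_space lborel {0..<1})
              (\<lambda>(j, t). ennreal (norm (vector_derivative (c j) (at t)))))
           (restrict_space borel (curve_system m c))
           (\<lambda>(j, t). c j t)"


section \<open>Fractional Sobolev spaces on the boundary\<close>

text \<open>
  Elements of \<open>H\<^sup>r(\<gamma>)\<close>, \<open>0 \<le> r < 1/2\<close>, are represented by functions on the plane of which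
  only the values on \<open>\<gamma> = space \<sigma>\<close> matter. In particular the trace of a continuous function is
  represented by the function itself.
\<close>

definition gagliardo :: "real \<Rightarrow> (real^2 \<Rightarrow> real) \<Rightarrow> (real^2) \<times> (real^2) \<Rightarrow> real" where
  "gagliardo r w = (\<lambda>(x, y). \<bar>w y - w x\<bar>\<^sup>2 / norm (y - x) powr (1 + 2 * r))"

definition sobolev_space :: "(real^2) measure \<Rightarrow> real \<Rightarrow> (real^2 \<Rightarrow> real) set" where
  "sobolev_space \<sigma> r =
     {w \<in> borel_measurable \<sigma>. integrable \<sigma> (\<lambda>x. \<bar>w x\<bar>\<^sup>2) \<and>
        (0 < r \<longrightarrow> integrable (\<sigma> \<Otimes>\<^sub>M \<sigma>) (gagliardo r w))}"

definition sobolev_norm :: "(real^2) measure \<Rightarrow> real \<Rightarrow> (real^2 \<Rightarrow> real) \<Rightarrow> real" where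
  "sobolev_norm \<sigma> r w =
     sqrt (LINT x|\<sigma>. \<bar>w x\<bar>\<^sup>2) +
     (if r = 0 then 0 else sqrt (LINT z|(\<sigma> \<Otimes>\<^sub>M \<sigma>). gagliardo r w z))"

text \<open>
  The dual space \<open>H\<^sup>-\<^sup>r(\<gamma>)\<close>; the duality pairing is function application. Boundedness makes the
  functionals independent of the representative, i.e. of values off \<open>\<gamma>\<close> and on null sets.
\<close>

definition sobolev_dual :: "(real^2) measure \<Rightarrow> real \<Rightarrow> ((real^2 \<Rightarrow> real) \<Rightarrow> real) set" where
  "sobolev_dual \<sigma> r =
     {\<phi>. (\<forall>u\<in>sobolev_space \<sigma> r. \<forall>w\<in>sobolev_space \<sigma> r. \<phi> (\<lambda>x. u x + w x) = \<phi> u + \<phi> w) \<and>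
         (\<forall>a. \<forall>w\<in>sobolev_space \<sigma> r. \<phi> (\<lambda>x. a * w x) = a * \<phi> w) \<and>
         (\<exists>B. \<forall>w\<in>sobolev_space \<sigma> r. \<bar>\<phi> w\<bar> \<le> B * sobolev_norm \<sigma> r w)}"

definition dual_norm :: "(real^2) measure \<Rightarrow> real \<Rightarrow> ((real^2 \<Rightarrow> real) \<Rightarrow> real) \<Rightarrow> real" where
  "dual_norm \<sigma> r \<phi> = (SUP w\<in>{w \<in> sobolev_space \<sigma> r. sobolev_norm \<sigma> r w \<le> 1}. \<bar>\<phi> w\<bar>)"


section \<open>Triangulations of the unit square and P1 finite elements\<close>

definition unit_square :: "(real^2) set" where
  "unit_square = {x. \<forall>i. 0 < x $ i \<and> x $ i < 1}"

text \<open>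
  Conformity is part of \<^const>\<open>triangulation\<close>: two triangles intersect in a common face.
\<close>

definition triangulates :: "(real^2) set set \<Rightarrow> (real^2) set \<Rightarrow> bool" where
  "triangulates \<T> \<Omega> \<longleftrightarrow>
     triangulation \<T> \<and> (\<forall>K\<in>\<T>. 2 simplex K) \<and> \<Union>\<T> = closure \<Omega>"

definition inradius :: "(real^2) set \<Rightarrow> real" where
  "inradius K = Sup {r. 0 \<le> r \<and> (\<exists>x. cball x r \<subseteq> K)}"

definition regular_family ::
    "real set \<Rightarrow> (real \<Rightarrow> (real^2) set set) \<Rightarrow> (real^2) set \<Rightarrow> bool" where
  "regular_family H T \<Omega> \<longleftrightarrow>
     (\<forall>h\<in>H. triangulates (T h) \<Omega>) \<and>
     (\<exists>\<kappa>. \<forall>h\<in>H. \<forall>K\<in>T h. diameter K / inradius K \<le> \<kappa>)"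

text \<open>
  Convention for ``\<open>h\<close> is the mesh size of \<open>T h\<close>'': up to a constant factor independent of \<open>h\<close>,
  no triangle of \<open>T h\<close> is smaller than \<open>h\<close>. Every family of triangulations satisfies this when
  \<open>h\<close> is the smallest diameter of a triangle of \<open>T h\<close>; when \<open>h\<close> is the largest
  diameter, the condition says that the family is quasi-uniform. With the largest diameter on
  arbitrarily graded shape-regular families, the inverse inequality behind the factor
  \<open>1 / sqrt h\<close> is not available: P1 functions may have arbitrarily large point values while
  \<open>|v|\<^sub>1\<close> and \<open>h\<close> stay fixed.
\<close>

definition mesh_size :: "real set \<Rightarrow> (real \<Rightarrow> (real^2) set set) \<Rightarrow> bool" where
  "mesh_size H T \<longleftrightarrow>
     (\<forall>h\<in>H. 0 < h) \<and> (\<exists>\<theta>>0. \<forall>h\<in>H. \<forall>K\<in>T h. \<theta> * h \<le> diameter K)"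

definition P1_space :: "(real^2) set \<Rightarrow> (real^2) set set \<Rightarrow> (real^2 \<Rightarrow> real) set" where
  "P1_space \<Omega> \<T> =
     {v. continuous_on (closure \<Omega>) v \<and> (\<forall>K\<in>\<T>. \<exists>a b. \<forall>x\<in>K. v x = a \<bullet> x + b)}"

text \<open>
  The classical gradient, which for a P1 function exists off the edges of the triangulation, hence
  almost everywhere, and is then its weak gradient. The integral is over \<^const>\<open>lebesgue\<close> so that
  the unspecified values on the edges do not affect measurability.
\<close>

definition grad :: "(real^2 \<Rightarrow> real) \<Rightarrow> real^2 \<Rightarrow> real^2" where
  "grad v x = (THE D. GDERIV v x :> D)"

definition H1_seminorm :: "(real^2) set \<Rightarrow> (real^2 \<Rightarrow> real) \<Rightarrow> real" where
  "H1_seminorm \<Omega> v = sqrt (LINT x:\<Omega>|lebesgue. (norm (grad v x))\<^sup>2)"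


section \<open>Partitions of the boundary into arcs\<close>

text \<open>
  The arcs \<open>\<gamma>\<^sub>0, \<dots>, \<gamma>\<^bsub>n-1\<^esub>\<close> are the images of injective paths \<open>g i\<close>; they are closed, so that
  they cover \<open>\<gamma>\<close>, and two of them meet at most in common endpoints.
\<close>

definition arc_partition :: "(real^2) set \<Rightarrow> nat \<Rightarrow> (nat \<Rightarrow> real \<Rightarrow> real^2) \<Rightarrow> bool" where
  "arc_partition \<gamma> n g \<longleftrightarrow>
     (\<forall>i<n. arc (g i)) \<and>
     (\<Union>i<n. path_image (g i)) = \<gamma> \<and>
     (\<forall>i<n. \<forall>j<n. i \<noteq> j \<longrightarrow>
        path_image (g i) \<inter> path_image (g j) \<subseteq> {pathstart (g i), pathfinish (g i)})"

definition quasi_uniform_family ::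
    "(real^2) measure \<Rightarrow> real set \<Rightarrow> (real \<Rightarrow> nat) \<Rightarrow> (real \<Rightarrow> nat \<Rightarrow> real \<Rightarrow> real^2) \<Rightarrow> bool" where
  "quasi_uniform_family \<sigma> H' N g \<longleftrightarrow>
     (\<forall>h'\<in>H'. 0 < h' \<and> arc_partition (space \<sigma>) (N h') (g h')) \<and>
     (\<exists>a b. 0 < a \<and> a < b \<and>
        (\<forall>h'\<in>H'. \<forall>i<N h'. a * h' \<le> measure \<sigma> (path_image (g h' i)) \<and>
                          measure \<sigma> (path_image (g h' i)) \<le> b * h'))"

text \<open>
  The action on \<open>v\<close> of the combination of Dirac masses at the points \<open>x i\<close> with weights
  \<open>\<lambda>\<^sub>i = \<langle>\<phi>, 1\<^bsub>\<gamma>\<^sub>i\<^esub>\<rangle>\<close>.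
\<close>

definition dirac_approx ::
    "nat \<Rightarrow> (nat \<Rightarrow> real \<Rightarrow> real^2) \<Rightarrow> (nat \<Rightarrow> real^2) \<Rightarrow> ((real^2 \<Rightarrow> real) \<Rightarrow> real) \<Rightarrow>
     (real^2 \<Rightarrow> real) \<Rightarrow> real" where
  "dirac_approx n g x \<phi> v = (\<Sum>i<n. \<phi> (indicat_real (path_image (g i))) * v (x i))"

end

theory Submission
  imports Defs
begin

text \<open>
  Put \<open>r = 1/2 - s\<close> and \<open>w = v - \<Sum>\<^sub>i v(x\<^sub>i) 1\<^bsub>\<gamma>\<^sub>i\<^esub>\<close>. The error is \<open>\<langle>\<phi>, w\<rangle>\<close>, so it suffices to
  bound the \<open>H\<^sup>r\<close> norm of \<open>w\<close> on the boundary by \<open>h'\<^bsup>1-r\<^esup> h\<^bsup>-1/2\<^esup> |v|\<^sub>1\<close>. The function \<open>v\<close> is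
  \<open>1/2\<close>-Hoelder along each arc, with the squared constant \<open>e\<^sub>i\<close> comparable to the integral of
  \<open>|\<nabla>v|\<^sup>2\<close> over the arc. In the Gagliardo double integral, pairs \<open>(x, y)\<close> that are closer to each
  other than to the endpoints of the arc of \<open>x\<close> lie on that arc, where the jump-free bound
  \<open>|w y - w x|\<^sup>2 \<le> e\<^sub>i |x - y|\<close> applies; for all other pairs \<open>|w|\<^sup>2 \<le> h' e\<^sub>i\<close> is enough, as \<open>2 r < 1\<close>
  makes the distance to the endpoints to the power \<open>-2 r\<close> integrable. Both parts only use that
  arc length satisfies \<open>\<sigma>(B(x, \<rho>)) \<le> A \<rho>\<close>. The same property gives \<open>\<sigma>(\<gamma> \<inter> K) \<le> A diam K\<close> for every
  triangle, which by shape regularity is at most a constant times \<open>|K| / h\<close>; hence the sum of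
  the \<open>e\<^sub>i\<close> is at most a constant times \<open>|v|\<^sub>1\<^sup>2 / h\<close>.
\<close>

section \<open>Piecewise smooth functions of one variable\<close>

text \<open>The jumps of \<open>w\<close> at the arc endpoints in general keep it out of H^(1/2), so
  its norm cannot be obtained by interpolating between L2 and H^(1/2). It is estimated directly at
  the order \<open>r\<close>, with constants that blow up as \<open>r\<close> tends to 1/2; this is
  where \<open>0 < s\<close> enters.

  Distances in the plane and on the curve have to be compared: with the chord-arc constant
  \<open>\<kappa>\<close> and the speed bound \<open>L\<close>, being closer to each other than to
  the endpoints means closer by the factor \<open>\<kappa> / L\<close>. A smaller factor only
  enlarges the constants.

  The arcs are closed and their indicators overlap at endpoints, so \<open>w = v - v (x i)\<close>
  holds on an arc only off these finitely many points. Linear growth of arc length makes them a null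
  set.

  The loss \<open>1 / sqrt h\<close> has a geometric origin: a triangle carries boundary length of
  the order of its diameter, but area of the order of its squared diameter. The remaining rate comes
  from \<open>1 - r = 1/2 + s\<close>.\<close>

text \<open>The bound for differentiable images is taken in \<open>real^1\<close>, where the
  derivative is a 1x1 matrix with determinant \<open>g' t\<close>, and \<open>vec\<close> carries
  measurability and measure over to the line. \<open>S\<close> is a general measurable set because
  the pieces to which this is applied need not be intervals.\<close>

lemma real_image_bounded_derivative:
  fixes g g' :: "real \<Rightarrow> real"
  assumes S: "S \<in> lmeasurable"
    and der: "\<And>t. (g has_real_derivative g' t) (at t)"
    and cont: "continuous_on UNIV g'"
    and bound: "\<And>t. t \<in> S \<Longrightarrow> \<bar>g' t\<bar> \<le> B"
  shows "g ` S \<in> lmeasurable" "measure lebesgue (g ` S) \<le> B * measure lebesgue S"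
proof -
  let ?lift = "vec :: real \<Rightarrow> real^1" and ?drop = "\<lambda>x::real^1. x $ 1"
  let ?G = "\<lambda>x. ?lift (g (?drop x))"
  have int_iff: "((\<lambda>x. f (?drop x)) has_integral y) (?lift ` X) \<longleftrightarrow> (f has_integral y) X"
    for f :: "real \<Rightarrow> real" and X y
  proof
    assume "((\<lambda>x. f (?drop x)) has_integral y) (?lift ` X)"
    from has_integral_vec1_I[OF this] show "(f has_integral y) X"
      by (simp add: o_def image_image)
  next
    assume "(f has_integral y) X"
    then show "((\<lambda>x. f (?drop x)) has_integral y) (?lift ` X)"
      by (intro has_integral_vec1_D) (simp add: o_def image_image)
  qed
  have lm: "?lift ` X \<in> lmeasurable \<longleftrightarrow> X \<in> lmeasurable" for X
    using int_iff[of "\<lambda>_. 1" _ X] unfolding lmeasurable_iff_integrable_on integrable_on_def by simp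
  have meas: "measure lebesgue (?lift ` X) = measure lebesgue X" if "X \<in> lmeasurable" for X
  proof -
    have "((\<lambda>_. 1) has_integral measure lebesgue X) X"
      using that lmeasure_integral[OF that] by (simp add: has_integral_iff lmeasurable_iff_integrable_on)
    then have "((\<lambda>_. 1) has_integral measure lebesgue X) (?lift ` X)"
      using int_iff[of "\<lambda>_. 1" _ X] by simp
    then show ?thesis using lmeasure_integral[of "?lift ` X"] lm that by (auto simp: has_integral_iff)
  qed
  have der_G: "(?G has_derivative (*\<^sub>R) (g' (?drop x))) (at x within ?lift ` S)" for x
  proof -
    have "(?G has_derivative (*\<^sub>R) (g' (?drop x))) (at (vec (x $ 1)) within vec ` S)"
      using der[of "?drop x"]
      by (intro has_derivative_vector_1)
         (simp add: has_field_derivative_def has_derivative_at_withinI mult_commute_abs)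
    then show ?thesis by simp
  qed
  have det_G: "det (matrix ((*\<^sub>R) c :: real^1 \<Rightarrow> _)) = c" for c
    by (simp add: det_1 matrix_def axis_def)
  have int: "(\<lambda>x. \<bar>det (matrix ((*\<^sub>R) (g' (?drop x)) :: real^1 \<Rightarrow> _))\<bar>) integrable_on ?lift ` S"
  proof -
    have "(\<lambda>t. \<bar>g' t\<bar>) integrable_on S"
    proof (rule measurable_bounded_by_integrable_imp_integrable[where g="\<lambda>_. B"])
      show "(\<lambda>t. \<bar>g' t\<bar>) \<in> borel_measurable (lebesgue_on S)"
        using cont S by (intro borel_measurable_abs continuous_imp_measurable_on_sets_lebesgue)
          (auto intro: continuous_on_subset)
    qed (use S bound in \<open>auto intro: integrable_on_const\<close>)
    then show ?thesis using int_iff[of "\<lambda>t. \<bar>g' t\<bar>" _ S] unfolding det_G integrable_on_def by simp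
  qed
  have b: "\<bar>det (matrix ((*\<^sub>R) (g' (?drop x)) :: real^1 \<Rightarrow> _))\<bar> \<le> B" if "x \<in> ?lift ` S" for x
    using that bound by (auto simp: det_G)
  have eq: "?G ` ?lift ` S = ?lift ` g ` S" by (auto simp: image_image)
  have S': "?lift ` S \<in> lmeasurable" using S lm by simp
  show *: "g ` S \<in> lmeasurable"
    using measurable_bounded_differentiable_image[OF S' der_G int b] lm[of "g ` S"] by (simp add: eq)
  show "measure lebesgue (g ` S) \<le> B * measure lebesgue S"
    using measure_bounded_differentiable_image[OF S' der_G int b] meas[OF *] meas[OF S] by (simp add: eq)
qed

text \<open>
  The curve may run along edges of triangles, so \<open>f\<close> (the restriction of a P1 function to the
  curve) is estimated without differentiating it: the interval between \<open>f t\<close> and \<open>f u\<close> is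
  covered by the images of the pieces.
\<close>

lemma abs_diff_le_sum_pieces:
  fixes f :: "real \<Rightarrow> real" and G G' :: "'k \<Rightarrow> real \<Rightarrow> real"
  assumes fin: "finite I" and f: "continuous_on {t..u} f" and tu: "t \<le> u"
    and cover: "{t..u} = (\<Union>k\<in>I. P k)" and P: "\<And>k. k \<in> I \<Longrightarrow> P k \<in> sets borel"
    and der: "\<And>k t. k \<in> I \<Longrightarrow> (G k has_real_derivative G' k t) (at t)"
    and cont: "\<And>k. k \<in> I \<Longrightarrow> continuous_on UNIV (G' k)"
    and bound: "\<And>k t. k \<in> I \<Longrightarrow> t \<in> P k \<Longrightarrow> \<bar>G' k t\<bar> \<le> B k"
    and eq: "\<And>k t. k \<in> I \<Longrightarrow> t \<in> P k \<Longrightarrow> f t = G k t"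
  shows "\<bar>f u - f t\<bar> \<le> (\<Sum>k\<in>I. B k * measure lborel (P k))"
proof -
  let ?J = "{min (f t) (f u)..max (f t) (f u)}"
  have P': "P k \<in> lmeasurable" if "k \<in> I" for k
  proof (rule fmeasurableI2[of "{t..u}"])
    show "P k \<in> sets lebesgue" using P[OF that] by auto
    show "P k \<subseteq> {t..u}" unfolding cover using that by blast
  qed simp
  have lm: "G k ` P k \<in> lmeasurable" "measure lebesgue (G k ` P k) \<le> B k * measure lborel (P k)"
    if "k \<in> I" for k
    using real_image_bounded_derivative[OF P'[OF that] der cont bound] that P[OF that] by auto
  have "?J \<subseteq> f ` {t..u}"
  proof
    fix y assume y: "y \<in> ?J"
    have "is_interval (f ` {t..u})"
      using connected_continuous_image[OF f] is_interval_connected_1 by auto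
    then show "y \<in> f ` {t..u}"
      using y tu unfolding is_interval_1 by (cases "f t \<le> f u") (force simp: min_def max_def)+
  qed
  also have "\<dots> \<subseteq> (\<Union>k\<in>I. G k ` P k)" using cover eq by auto
  finally have "measure lebesgue ?J \<le> measure lebesgue (\<Union>k\<in>I. G k ` P k)"
    using lm fin by (intro measure_mono_fmeasurable) (auto intro!: fmeasurable.finite_UN)
  also have "\<dots> \<le> (\<Sum>k\<in>I. measure lebesgue (G k ` P k))"
    using lm fin by (intro measure_UNION_le) (auto dest: fmeasurableD)
  also have "\<dots> \<le> (\<Sum>k\<in>I. B k * measure lborel (P k))"
    using lm by (intro sum_mono) auto
  finally show ?thesis by (simp add: abs_real_def min_def max_def split: if_splits)
qed

text \<open>Cauchy-Schwarz with the splitting \<open>B k * m = sqrt m * (B k * sqrt m)\<close> for a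
  piece of length \<open>m\<close>; disjointness makes the lengths add up to \<open>u - t\<close>.
  It replaces the L2 estimate of a derivative.\<close>

lemma square_diff_le_sum_pieces:
  fixes f :: "real \<Rightarrow> real" and G G' :: "'k \<Rightarrow> real \<Rightarrow> real"
  assumes fin: "finite I" and f: "continuous_on {t..u} f" and tu: "t \<le> u"
    and cover: "{t..u} = (\<Union>k\<in>I. P k)" and P: "\<And>k. k \<in> I \<Longrightarrow> P k \<in> sets borel"
    and disj: "disjoint_family_on P I"
    and der: "\<And>k t. k \<in> I \<Longrightarrow> (G k has_real_derivative G' k t) (at t)"
    and cont: "\<And>k. k \<in> I \<Longrightarrow> continuous_on UNIV (G' k)"
    and bound: "\<And>k t. k \<in> I \<Longrightarrow> t \<in> P k \<Longrightarrow> \<bar>G' k t\<bar> \<le> B k"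
    and eq: "\<And>k t. k \<in> I \<Longrightarrow> t \<in> P k \<Longrightarrow> f t = G k t"
  shows "(f u - f t)\<^sup>2 \<le> (u - t) * (\<Sum>k\<in>I. (B k)\<^sup>2 * measure lborel (P k))"
proof -
  let ?m = "\<lambda>k. measure lborel (P k)"
  have P': "P k \<in> fmeasurable lborel" if "k \<in> I" for k
  proof (rule fmeasurableI2[of "{t..u}"])
    show "P k \<subseteq> {t..u}" unfolding cover using that by blast
    show "{t..u} \<in> fmeasurable lborel" using tu by (intro fmeasurableI) auto
  qed (use P that in auto)
  have "(\<Sum>k\<in>I. ?m k) = measure lborel {t..u}"
    unfolding cover using fin disj P' by (intro measure_finite_Union[symmetric])
     (auto simp: fmeasurable_def top.not_eq_extremum)
  then have len: "(\<Sum>k\<in>I. ?m k) = u - t" using tu by simp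
  have "(f u - f t)\<^sup>2 = \<bar>f u - f t\<bar>\<^sup>2" by simp
  also have "\<dots> \<le> (\<Sum>k\<in>I. sqrt (?m k) * (B k * sqrt (?m k)))\<^sup>2"
    using abs_diff_le_sum_pieces[OF fin f tu cover P der cont bound eq]
    by (intro power_mono) (auto simp: mult_ac)
  also have "\<dots> \<le> (\<Sum>k\<in>I. (sqrt (?m k))\<^sup>2) * (\<Sum>k\<in>I. (B k * sqrt (?m k))\<^sup>2)"
    by (rule Cauchy_Schwarz_ineq_sum)
  also have "\<dots> = (u - t) * (\<Sum>k\<in>I. (B k)\<^sup>2 * ?m k)"
    by (simp add: len power_mult_distrib)
  finally show ?thesis .
qed

section \<open>Measures with linear growth\<close>

lemma le_suminf_ennreal: "f k \<le> (\<Sum>k. f k)" for f :: "nat \<Rightarrow> ennreal"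
  by (rule order_trans[OF _ sum_le_suminf[of f "{k}"]]) auto

text \<open>The upper half of Ahlfors regularity in dimension one, with centres in
  \<open>space M\<close>. By \<open>sets_eq\<close>, Borel functions on the ambient space are
  measurable.\<close>

locale ahlfors_upper = finite_measure M for M :: "'a::euclidean_space measure" +
  fixes A :: real
  assumes sets_eq: "sets M = sets (restrict_space borel (space M))"
    and A_pos: "0 < A"
    and emeasure_cball_le: "\<And>x \<rho>. x \<in> space M \<Longrightarrow> 0 < \<rho> \<Longrightarrow> emeasure M (space M \<inter> cball x \<rho>) \<le> ennreal (A * \<rho>)"
begin

lemma borel_measurableI [intro]:
  "f \<in> borel_measurable borel \<Longrightarrow> f \<in> borel_measurable M"
  using measurable_restrict_space1[of f borel borel "space M"] measurable_cong_sets[OF sets_eq refl]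
  by blast

lemma measurable_ident_borel [measurable]: "(\<lambda>x. x) \<in> borel_measurable M"
  by (rule borel_measurableI) simp

lemma sets_Int_borel [measurable]: "B \<in> sets borel \<Longrightarrow> space M \<inter> B \<in> sets M"
  by (subst sets_eq) (auto simp: sets_restrict_space)

section \<open>Powers of the distance, integrated over dyadic shells\<close>

text \<open>This constant and \<open>near_const\<close> are sums of geometric series over dyadic
  shells: ratio \<open>2 powr (1 - p)\<close> for growing shells, summable for \<open>1 < p\<close>,
  and ratio \<open>2 powr (q - 1)\<close> for shrinking ones, summable for
  \<open>q < 1\<close>.\<close>

definition tail_const :: "real \<Rightarrow> real" where
  "tail_const p = 2 * A / (1 - 2 powr (1 - p))"

definition near_const :: "real \<Rightarrow> real" where
  "near_const q = 2 powr q * A / (1 - 2 powr (q - 1))"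

lemma tail_const_nonneg: "1 < p \<Longrightarrow> 0 \<le> tail_const p"
  unfolding tail_const_def using A_pos
  by (intro divide_nonneg_nonneg) (use powr_mono[of "1-p" 0 2] in auto)

lemma near_const_nonneg: "q < 1 \<Longrightarrow> 0 \<le> near_const q"
  unfolding near_const_def using A_pos
  by (intro divide_nonneg_nonneg) (use powr_mono[of "q-1" 0 2] in auto)

text \<open>On the shell between the radii \<open>2 ^ k * \<rho>\<close> and
  \<open>2 ^ Suc k * \<rho>\<close> the integrand is largest at the inner radius, while linear
  growth bounds the measure by \<open>A\<close> times the outer one. The products form a convergent
  geometric series since \<open>1 < p\<close>.\<close>

lemma nn_integral_tail:
  assumes x: "x \<in> space M" and \<rho>: "0 < \<rho>" and p: "1 < p"
  shows "(\<integral>\<^sup>+y. indicator {y. \<rho> \<le> dist x y} y * ennreal (dist x y powr (- p)) \<partial>M)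
           \<le> ennreal (tail_const p * \<rho> powr (1 - p))"
proof -
  let ?q = "2 powr (1 - p)"
  have q: "0 < ?q" "?q < 1" using p by (auto simp: powr_less_one)
  let ?B = "\<lambda>k::nat. space M \<inter> cball x (2 ^ Suc k * \<rho>)"
  let ?b = "\<lambda>k::nat. (2 ^ k * \<rho>) powr (- p)"
  have "(\<integral>\<^sup>+y. indicator {y. \<rho> \<le> dist x y} y * ennreal (dist x y powr (- p)) \<partial>M)
      \<le> (\<integral>\<^sup>+y. (\<Sum>k. ennreal (?b k) * indicator (?B k) y) \<partial>M)"
  proof (intro nn_integral_mono)
    fix y assume y: "y \<in> space M"
    show "indicator {y. \<rho> \<le> dist x y} y * ennreal (dist x y powr (- p))
       \<le> (\<Sum>k. ennreal (?b k) * indicator (?B k) y)"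
    proof (cases "\<rho> \<le> dist x y")
      case True
      have "\<exists>n. dist x y / \<rho> < 2 ^ n"
        using real_arch_pow[of 2 "dist x y / \<rho>"] by auto
      define n where "n = (LEAST n. dist x y / \<rho> < 2 ^ n)"
      have n: "dist x y / \<rho> < 2 ^ n"
        unfolding n_def by (rule LeastI_ex) fact
      \<comment> \<open>The least exponent is positive because \<open>\<rho> \<le> dist x y\<close>;
        its predecessor \<open>k\<close> is the index of the shell of \<open>y\<close>.\<close>
      have "n \<noteq> 0" using n True \<rho> by (auto simp: field_simps intro!: Nat.gr0I)
      then obtain k where k: "n = Suc k" by (cases n) auto
      have k1: "\<not> dist x y / \<rho> < 2 ^ k"
        using not_less_Least[of k "\<lambda>n. dist x y / \<rho> < 2 ^ n"] k unfolding n_def by auto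
      have "dist x y powr (- p) \<le> ?b k"
        using k1 \<rho> p by (intro powr_mono2') (auto simp: field_simps)
      then have "indicator {y. \<rho> \<le> dist x y} y * ennreal (dist x y powr (- p))
          \<le> ennreal (?b k) * indicator (?B k) y"
        using n k \<rho> y by (auto simp: indicator_def field_simps intro!: ennreal_leI)
      also have "\<dots> \<le> (\<Sum>k. ennreal (?b k) * indicator (?B k) y)"
        by (rule le_suminf_ennreal)
      finally show ?thesis .
    qed auto
  qed
  also have "\<dots> = (\<Sum>k. ennreal (?b k) * emeasure M (?B k))"
    by (subst nn_integral_suminf) (auto simp: nn_integral_cmult)
  also have "\<dots> \<le> (\<Sum>k. ennreal (2 * A * \<rho> powr (1 - p) * ?q ^ k))"
  proof (intro suminf_le)
    fix k
    have "ennreal (?b k) * emeasure M (?B k) \<le> ennreal (?b k) * ennreal (A * (2 ^ Suc k * \<rho>))"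
      using \<rho> x by (intro mult_left_mono emeasure_cball_le) auto
    also have "\<dots> = ennreal (?b k * (A * (2 ^ Suc k * \<rho>)))"
      using A_pos \<rho> by (simp add: ennreal_mult)
    also have "?b k * (A * (2 ^ Suc k * \<rho>)) = 2 * A * (2 ^ k * \<rho>) powr (1 - p)"
      using \<rho> by (simp add: powr_diff powr_minus field_simps)
    also have "\<dots> = 2 * A * \<rho> powr (1 - p) * ?q ^ k"
      using \<rho> by (simp add: powr_mult powr_powr flip: powr_realpow) (simp add: mult_ac)
    finally show "ennreal (?b k) * emeasure M (?B k) \<le> ennreal (2 * A * \<rho> powr (1 - p) * ?q ^ k)" .
  qed auto
  also have "\<dots> = ennreal (\<Sum>k. 2 * A * \<rho> powr (1 - p) * ?q ^ k)"
    using q A_pos by (intro suminf_ennreal2) (auto intro!: summable_mult summable_geometric)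
  also have "(\<Sum>k. 2 * A * \<rho> powr (1 - p) * ?q ^ k) = tail_const p * \<rho> powr (1 - p)"
    using q by (subst suminf_mult) (auto simp: suminf_geometric summable_geometric tail_const_def)
  finally show ?thesis .
qed

text \<open>The same decomposition with shells shrinking towards \<open>x\<close>;
  \<open>q < 1\<close> lets the decay of their measure win over the growth of the integrand.\<close>

lemma nn_integral_near:
  assumes x: "x \<in> space M" and \<rho>: "0 < \<rho>" and q: "0 \<le> q" "q < 1"
  shows "(\<integral>\<^sup>+y. indicator {y. dist x y \<le> \<rho>} y * ennreal (dist x y powr (- q)) \<partial>M)
           \<le> ennreal (near_const q * \<rho> powr (1 - q))"
proof -
  let ?q = "2 powr (q - 1)"
  have q2: "0 < ?q" "?q < 1" using q by (auto simp: powr_less_one)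
  let ?B = "\<lambda>k::nat. space M \<inter> cball x (\<rho> / 2 ^ k)"
  let ?b = "\<lambda>k::nat. (\<rho> / 2 ^ Suc k) powr (- q)"
  have "(\<integral>\<^sup>+y. indicator {y. dist x y \<le> \<rho>} y * ennreal (dist x y powr (- q)) \<partial>M)
      \<le> (\<integral>\<^sup>+y. (\<Sum>k. ennreal (?b k) * indicator (?B k) y) \<partial>M)"
  proof (intro nn_integral_mono)
    fix y assume y: "y \<in> space M"
    \<comment> \<open>The point \<open>y = x\<close> lies in no shell, but contributes nothing:
      \<open>0 powr (- q) = 0\<close>.\<close>
    show "indicator {y. dist x y \<le> \<rho>} y * ennreal (dist x y powr (- q))
       \<le> (\<Sum>k. ennreal (?b k) * indicator (?B k) y)"
    proof (cases "dist x y \<le> \<rho> \<and> dist x y > 0")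
      case True
      have "\<exists>n. \<rho> / dist x y < 2 ^ n"
        using real_arch_pow[of 2 "\<rho> / dist x y"] by auto
      define n where "n = (LEAST n. \<rho> / dist x y < 2 ^ n)"
      have n: "\<rho> / dist x y < 2 ^ n"
        unfolding n_def by (rule LeastI_ex) fact
      have "n \<noteq> 0" using n True \<rho> by (auto simp: field_simps intro!: Nat.gr0I)
      then obtain k where k: "n = Suc k" by (cases n) auto
      have k1: "\<not> \<rho> / dist x y < 2 ^ k"
        using not_less_Least[of k "\<lambda>n. \<rho> / dist x y < 2 ^ n"] k unfolding n_def by auto
      have "dist x y powr (- q) \<le> ?b k"
        using n k True \<rho> q by (intro powr_mono2') (auto simp: field_simps)
      then have "indicator {y. dist x y \<le> \<rho>} y * ennreal (dist x y powr (- q))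
          \<le> ennreal (?b k) * indicator (?B k) y"
        using k1 True \<rho> y by (auto simp: indicator_def field_simps intro!: ennreal_leI)
      also have "\<dots> \<le> (\<Sum>k. ennreal (?b k) * indicator (?B k) y)"
        by (rule le_suminf_ennreal)
      finally show ?thesis .
    qed auto
  qed
  also have "\<dots> = (\<Sum>k. ennreal (?b k) * emeasure M (?B k))"
    by (subst nn_integral_suminf) (auto simp: nn_integral_cmult)
  also have "\<dots> \<le> (\<Sum>k. ennreal (2 powr q * A * \<rho> powr (1 - q) * ?q ^ k))"
  proof (intro suminf_le)
    fix k
    have "ennreal (?b k) * emeasure M (?B k) \<le> ennreal (?b k) * ennreal (A * (\<rho> / 2 ^ k))"
      using \<rho> x by (intro mult_left_mono emeasure_cball_le) auto
    also have "\<dots> = ennreal (?b k * (A * (\<rho> / 2 ^ k)))"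
      using A_pos \<rho> by (intro ennreal_mult[symmetric]) auto
    also have "?b k * (A * (\<rho> / 2 ^ k)) = 2 powr q * A * \<rho> powr (1 - q) * ?q ^ k"
    proof -
      have "?b k = 2 powr q * (\<rho> / 2 ^ k) powr (- q)"
        using \<rho> by (simp add: powr_mult powr_divide powr_minus field_simps)
      then have "?b k * (A * (\<rho> / 2 ^ k)) = 2 powr q * A * (\<rho> / 2 ^ k) powr (1 - q)"
        using \<rho> by (simp add: powr_diff powr_minus field_simps)
      also have "(\<rho> / 2 ^ k) powr (1 - q) = \<rho> powr (1 - q) * ?q ^ k"
      proof -
        have "(2 ^ k) powr (1 - q) = 1 / ?q ^ k"
          using powr_minus_divide[of 2 "(1-q)* real k"]
          by (simp add: powr_powr mult.commute flip: powr_realpow)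
             (simp add: powr_minus_divide[symmetric] algebra_simps)
        then show ?thesis using \<rho> by (simp add: powr_divide)
      qed
      finally show ?thesis by simp
    qed
    finally show "ennreal (?b k) * emeasure M (?B k) \<le> ennreal (2 powr q * A * \<rho> powr (1 - q) * ?q ^ k)" .
  qed auto
  also have "\<dots> = ennreal (\<Sum>k. 2 powr q * A * \<rho> powr (1 - q) * ?q ^ k)"
    using q2 A_pos by (intro suminf_ennreal2) (auto intro!: summable_mult summable_geometric)
  also have "(\<Sum>k. 2 powr q * A * \<rho> powr (1 - q) * ?q ^ k) = near_const q * \<rho> powr (1 - q)"
    using q2 by (subst suminf_mult) (auto simp: suminf_geometric summable_geometric near_const_def)
  finally show ?thesis .
qed

text \<open>A point lies in balls of arbitrarily small measure. This is what makes arc endpoints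
  negligible.\<close>

lemma AE_neq:
  assumes "p \<in> space M"
  shows "AE x in M. x \<noteq> p"
proof (rule AE_I)
  show "{x \<in> space M. \<not> x \<noteq> p} \<subseteq> {p}" by auto
  have *: "{p} = space M \<inter> {p}" using assms by auto
  show "{p} \<in> sets M" by (subst *) (intro sets_Int_borel, simp)
  have "emeasure M {p} \<le> ennreal e" if "e > 0" for e :: real
  proof -
    have "emeasure M {p} \<le> emeasure M (space M \<inter> cball p (e / A))"
      using assms that A_pos by (intro emeasure_mono) auto
    also have "\<dots> \<le> ennreal (A * (e / A))"
      using assms that A_pos by (intro emeasure_cball_le) auto
    finally show ?thesis using A_pos by simp
  qed
  then show "emeasure M {p} = 0"
    by (metis ennreal_le_epsilon add_0 bot.extremum_uniqueI bot_ennreal)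
qed

section \<open>Gagliardo double integral of a function controlled piecewise\<close>

text \<open>The outer 2 counts the two orders of a pair. The first summand is the near part, times
  the measure \<open>A * D\<close> of a piece; in the second, the far part, the 4 is the 2 from
  \<open>2 * D\<close> times the two ends of an arc. The power of \<open>D\<close> is split
  off.\<close>

definition gagliardo_const :: "real \<Rightarrow> real \<Rightarrow> real" where
  "gagliardo_const r \<kappa> = 2 * (A * near_const (2 * r) * \<kappa> powr (1 - 2 * r)
     + 4 * tail_const (1 + 2 * r) * \<kappa> powr (- (2 * r)) * near_const (2 * r))"

lemma gagliardo_const_nonneg: "0 < r \<Longrightarrow> r < 1 / 2 \<Longrightarrow> 0 \<le> gagliardo_const r \<kappa>"
  unfolding gagliardo_const_def using A_pos
  by (intro mult_nonneg_nonneg add_nonneg_nonneg tail_const_nonneg near_const_nonneg) auto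

lemma fst_borel [measurable]: "fst \<in> borel_measurable (M \<Otimes>\<^sub>M M)"
  by (rule measurable_compose[OF measurable_fst measurable_ident_borel])

lemma snd_borel [measurable]: "snd \<in> borel_measurable (M \<Otimes>\<^sub>M M)"
  by (rule measurable_compose[OF measurable_snd measurable_ident_borel])

text \<open>\<open>S i\<close> models an arc without endpoints, \<open>p i\<close> and
  \<open>q i\<close> its two ends, \<open>D\<close> a common bound for arc lengths, and
  \<open>e i\<close> a squared 1/2-Hoelder constant of \<open>w\<close> on the arc.\<close>

context
  fixes r \<kappa> D :: real and I :: "'i set" and S :: "'i \<Rightarrow> 'a set"
    and p q :: "'i \<Rightarrow> 'a" and e :: "'i \<Rightarrow> real" and w :: "'a \<Rightarrow> real"
  assumes fin: "finite I" and S [measurable]: "\<And>i. i \<in> I \<Longrightarrow> S i \<in> sets M"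
    and cover: "AE x in M. x \<in> (\<Union>i\<in>I. S i)"
    and w [measurable]: "w \<in> borel_measurable M"
    and D: "0 < D" and \<kappa>: "0 < \<kappa>"
    and pq: "\<And>i. i \<in> I \<Longrightarrow> p i \<in> space M" "\<And>i. i \<in> I \<Longrightarrow> q i \<in> space M"
    and dist_p: "\<And>i x. i \<in> I \<Longrightarrow> x \<in> S i \<Longrightarrow> dist x (p i) \<le> D"
    and dist_q: "\<And>i x. i \<in> I \<Longrightarrow> x \<in> S i \<Longrightarrow> dist x (q i) \<le> D"
    and e: "\<And>i. i \<in> I \<Longrightarrow> 0 \<le> e i"
    and w_bound: "\<And>i x. i \<in> I \<Longrightarrow> x \<in> S i \<Longrightarrow> (w x)\<^sup>2 \<le> D * e i"
begin

lemma emeasure_piece_le: "i \<in> I \<Longrightarrow> emeasure M (S i) \<le> ennreal (A * D)"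
proof -
  assume i: "i \<in> I"
  have "emeasure M (S i) \<le> emeasure M (space M \<inter> cball (p i) D)"
    using dist_p[OF i] sets.sets_into_space[OF S[OF i]]
    by (intro emeasure_mono) (auto simp: dist_commute)
  also have "\<dots> \<le> ennreal (A * D)"
    using pq i D by (intro emeasure_cball_le) auto
  finally show ?thesis .
qed

lemma nn_integral_square_le:
  "(\<integral>\<^sup>+x. ennreal ((w x)\<^sup>2) \<partial>M) \<le> ennreal (A * D\<^sup>2 * (\<Sum>i\<in>I. e i))"
proof -
  have "(\<integral>\<^sup>+x. ennreal ((w x)\<^sup>2) \<partial>M) \<le> (\<integral>\<^sup>+x. (\<Sum>i\<in>I. ennreal (D * e i) * indicator (S i) x) \<partial>M)"
  proof (rule nn_integral_mono_AE, use cover in eventually_elim)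
    fix x assume "x \<in> (\<Union>i\<in>I. S i)"
    then obtain i where i: "i \<in> I" "x \<in> S i" by auto
    then have "ennreal ((w x)\<^sup>2) \<le> ennreal (D * e i) * indicator (S i) x"
      using w_bound by (auto intro!: ennreal_leI)
    also have "\<dots> \<le> (\<Sum>i\<in>I. ennreal (D * e i) * indicator (S i) x)"
      using fin i(1) by (intro member_le_sum) auto
    finally show "ennreal ((w x)\<^sup>2) \<le> (\<Sum>i\<in>I. ennreal (D * e i) * indicator (S i) x)" .
  qed
  also have "\<dots> = (\<Sum>i\<in>I. ennreal (D * e i) * emeasure M (S i))"
    by (subst nn_integral_sum) (auto simp: nn_integral_cmult)
  also have "\<dots> \<le> (\<Sum>i\<in>I. ennreal (D * e i) * ennreal (A * D))"
    by (intro sum_mono mult_left_mono emeasure_piece_le) auto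
  also have "\<dots> = ennreal (\<Sum>i\<in>I. D * e i * (A * D))"
    using e D A_pos by (simp add: ennreal_mult[symmetric])
  also have "(\<Sum>i\<in>I. D * e i * (A * D)) = A * D\<^sup>2 * (\<Sum>i\<in>I. e i)"
    by (simp add: sum_distrib_left power2_eq_square mult_ac)
  finally show ?thesis .
qed

text \<open>The majorant \<open>K (x, y)\<close> involves only the arc of its first argument. Each
  pair is dominated by \<open>K (x, y) + K (y, x)\<close>, so it suffices to integrate
  \<open>K\<close>; the inner integral in \<open>y\<close> leaves a constant plus the power
  \<open>- 2 r\<close> of the distances from \<open>x\<close> to the ends of its arc.\<close>

lemma nn_integral_gagliardo_le:
  assumes r: "0 < r" "r < 1 / 2"
    and near: "\<And>i j x y. i \<in> I \<Longrightarrow> j \<in> I \<Longrightarrow> x \<in> S i \<Longrightarrow> y \<in> S j \<Longrightarrow>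
       dist x y < \<kappa> * min (dist x (p i)) (dist x (q i)) \<Longrightarrow> (w y - w x)\<^sup>2 \<le> dist x y * e i"
  shows "(\<integral>\<^sup>+z. ennreal ((w (snd z) - w (fst z))\<^sup>2 / dist (fst z) (snd z) powr (1 + 2 * r)) \<partial>(M \<Otimes>\<^sub>M M))
     \<le> ennreal (gagliardo_const r \<kappa> * D powr (2 - 2 * r) * (\<Sum>i\<in>I. e i))"
proof -
  interpret P: pair_sigma_finite M M ..
  define \<delta> where "\<delta> i x = min (dist x (p i)) (dist x (q i))" for i x
  \<comment> \<open>First branch: what \<open>near\<close> leaves after division by the kernel.
    Second branch: the share of \<open>x\<close> in \<open>(w y - w x)\<^sup>2 \<le> 2 * (w
    x)\<^sup>2 + 2 * (w y)\<^sup>2\<close>; the share of \<open>y\<close> comes from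
    \<open>f j (y, x)\<close>.\<close>
  define f where "f i z = e i * (if dist (fst z) (snd z) < \<kappa> * \<delta> i (fst z)
      then dist (fst z) (snd z) powr (- (2 * r))
      else 2 * D * dist (fst z) (snd z) powr (- (1 + 2 * r)))" for i and z :: "'a \<times> 'a"
  define K where "K z = (\<Sum>i\<in>I. indicator (S i) (fst z) * ennreal (f i z))" for z
  let ?N = "near_const (2 * r)" and ?T = "tail_const (1 + 2 * r)"
  have NT: "0 \<le> ?N" "0 \<le> ?T" using r near_const_nonneg tail_const_nonneg by auto
  have [measurable]: "f i \<in> borel_measurable (M \<Otimes>\<^sub>M M)" for i
    unfolding f_def \<delta>_def by measurable
  have K_meas [measurable]: "K \<in> borel_measurable (M \<Otimes>\<^sub>M M)"
    unfolding K_def by measurable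
  have \<delta>_nonneg: "0 \<le> \<delta> i x" for i x by (simp add: \<delta>_def)
  have f_nonneg: "i \<in> I \<Longrightarrow> 0 \<le> f i z" for i z
    using e[of i] D by (simp add: f_def)
  have f_le_K: "ennreal (f i z) \<le> K z" if "i \<in> I" "fst z \<in> S i" for i z
  proof -
    have "ennreal (f i z) = indicator (S i) (fst z) * ennreal (f i z)" using that by simp
    also have "\<dots> \<le> K z" unfolding K_def using that fin by (intro member_le_sum) auto
    finally show ?thesis .
  qed
  have main: "ennreal ((w y - w x)\<^sup>2 / dist x y powr (1 + 2 * r)) \<le> K (x, y) + K (y, x)"
    if xy: "i \<in> I" "j \<in> I" "x \<in> S i" "y \<in> S j" for i j x y
  proof (cases "x = y")
    case False
    then have d: "dist x y > 0" by simp
    have close: "(w y - w x)\<^sup>2 / dist x y powr (1 + 2 * r) \<le> f i (x, y)"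
      if h: "i \<in> I" "j \<in> I" "x \<in> S i" "y \<in> S j" "dist x y < \<kappa> * \<delta> i x" "dist x y > 0" for i j x y
    proof -
      have "(w y - w x)\<^sup>2 / dist x y powr (1 + 2 * r) \<le> (dist x y * e i) / dist x y powr (1 + 2 * r)"
        using near[OF h(1-4)] h(5) by (intro divide_right_mono) (auto simp: \<delta>_def)
      also have "\<dots> = f i (x, y)"
        using h by (simp add: f_def powr_add powr_minus field_simps)
      finally show ?thesis .
    qed
    show ?thesis
    proof (cases "dist x y < \<kappa> * \<delta> i x")
      case True
      have "ennreal ((w y - w x)\<^sup>2 / dist x y powr (1 + 2 * r)) \<le> ennreal (f i (x, y))"
        using close[OF xy True d] by (rule ennreal_leI)
      also have "\<dots> \<le> K (x, y)" using xy by (intro f_le_K) auto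
      also have "\<dots> \<le> K (x, y) + K (y, x)" by simp
      finally show ?thesis .
    next
      case F1: False
      show ?thesis
      proof (cases "dist y x < \<kappa> * \<delta> j y")
        case True
        \<comment> \<open>The pair is far relative to the arc of \<open>x\<close> but near relative
          to that of \<open>y\<close>, so the roles are exchanged.\<close>
        have "ennreal ((w y - w x)\<^sup>2 / dist x y powr (1 + 2 * r)) \<le> ennreal (f j (y, x))"
          using close[OF xy(2,1,4,3) True] d by (intro ennreal_leI) (simp add: dist_commute power2_commute)
        also have "\<dots> \<le> K (y, x)" using xy by (intro f_le_K) auto
        also have "\<dots> \<le> K (x, y) + K (y, x)" by simp
        finally show ?thesis .
      next
        case F2: False
        \<comment> \<open>Far relative to both arcs: both majorants are in their second branch and
          their sum is exactly the bound obtained here.\<close>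
        have "(w y - w x)\<^sup>2 \<le> 2 * (w x)\<^sup>2 + 2 * (w y)\<^sup>2"
          using zero_le_power2[of "w x + w y"] by (simp add: power2_eq_square algebra_simps)
        also have "\<dots> \<le> 2 * (D * e i) + 2 * (D * e j)"
          using w_bound[of i x] w_bound[of j y] xy by auto
        finally have "(w y - w x)\<^sup>2 / dist x y powr (1 + 2 * r)
            \<le> (2 * (D * e i) + 2 * (D * e j)) / dist x y powr (1 + 2 * r)"
          by (intro divide_right_mono) auto
        also have "\<dots> = f i (x, y) + f j (y, x)"
          using F1 F2 d unfolding f_def powr_minus_divide
          by (simp add: dist_commute add_divide_distrib mult_ac)
        finally have "ennreal ((w y - w x)\<^sup>2 / dist x y powr (1 + 2 * r)) \<le> ennreal (f i (x, y)) + ennreal (f j (y, x))"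
          using f_nonneg xy by (simp add: ennreal_leI flip: ennreal_plus)
        also have "\<dots> \<le> K (x, y) + K (y, x)"
          using xy by (intro add_mono f_le_K) auto
        finally show ?thesis .
      qed
    qed
  qed simp
  let ?k = "\<lambda>z. ennreal ((w (snd z) - w (fst z))\<^sup>2 / dist (fst z) (snd z) powr (1 + 2 * r))"
  have "(\<integral>\<^sup>+z. ?k z \<partial>(M \<Otimes>\<^sub>M M)) = (\<integral>\<^sup>+x. \<integral>\<^sup>+y. ?k (x, y) \<partial>M \<partial>M)"
    using nn_integral_fst[of ?k M] by simp
  also have "\<dots> \<le> (\<integral>\<^sup>+x. \<integral>\<^sup>+y. K (x, y) + K (y, x) \<partial>M \<partial>M)"
  proof (rule nn_integral_mono_AE, use cover in eventually_elim)
    fix x assume x: "x \<in> (\<Union>i\<in>I. S i)"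
    show "(\<integral>\<^sup>+y. ?k (x, y) \<partial>M) \<le> (\<integral>\<^sup>+y. K (x, y) + K (y, x) \<partial>M)"
      by (rule nn_integral_mono_AE, use cover in eventually_elim) (use main x in auto)
  qed
  also have "\<dots> = (\<integral>\<^sup>+x. (\<integral>\<^sup>+y. K (x, y) \<partial>M) + (\<integral>\<^sup>+y. K (y, x) \<partial>M) \<partial>M)"
    by (intro nn_integral_cong nn_integral_add) (auto)
  also have "\<dots> = (\<integral>\<^sup>+x. (\<integral>\<^sup>+y. K (x, y) \<partial>M) \<partial>M) + (\<integral>\<^sup>+x. (\<integral>\<^sup>+y. K (y, x) \<partial>M) \<partial>M)"
    by (intro nn_integral_add) auto
  also have "(\<integral>\<^sup>+x. (\<integral>\<^sup>+y. K (y, x) \<partial>M) \<partial>M) = (\<integral>\<^sup>+x. (\<integral>\<^sup>+y. K (x, y) \<partial>M) \<partial>M)"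
    using P.Fubini[of "\<lambda>z. K z"] by simp
  also have "(\<integral>\<^sup>+x. (\<integral>\<^sup>+y. K (x, y) \<partial>M) \<partial>M) \<le>
     ennreal ((A * ?N * \<kappa> powr (1 - 2 * r) + 4 * ?T * \<kappa> powr (- (2 * r)) * ?N) * D powr (2 - 2 * r) * (\<Sum>i\<in>I. e i))"
  proof -
    let ?a = "?N * (\<kappa> * D) powr (1 - 2 * r)" and ?b = "2 * D * ?T * \<kappa> powr (- (2 * r))"
    let ?h = "\<lambda>i x. ennreal ?a + ennreal ?b * (ennreal (dist x (p i) powr (- (2 * r))) + ennreal (dist x (q i) powr (- (2 * r))))"
    \<comment> \<open>The two ends are excluded so that \<open>\<delta> i x\<close>, which scales
      the radius of the near and tail integrals, is positive.\<close>
    have inner: "(\<integral>\<^sup>+y. ennreal (f i (x, y)) \<partial>M) \<le> ennreal (e i) * ?h i x"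
      if i: "i \<in> I" and x: "x \<in> S i" and xM: "x \<in> space M" and xp: "x \<noteq> p i" "x \<noteq> q i" for i x
    proof -
      have \<delta>: "0 < \<delta> i x" "\<delta> i x \<le> D" using xp dist_p[OF i x] by (auto simp: \<delta>_def)
      let ?n = "\<lambda>y. indicator {y. dist x y \<le> \<kappa> * \<delta> i x} y * ennreal (dist x y powr (- (2 * r)))"
      let ?t = "\<lambda>y. indicator {y. \<kappa> * \<delta> i x \<le> dist x y} y * ennreal (dist x y powr (- (1 + 2 * r)))"
      have "(\<integral>\<^sup>+y. ennreal (f i (x, y)) \<partial>M)
          \<le> (\<integral>\<^sup>+y. ennreal (e i) * (?n y + ennreal (2 * D) * ?t y) \<partial>M)"
      proof (intro nn_integral_mono)
        fix y
        show "ennreal (f i (x, y)) \<le> ennreal (e i) * (?n y + ennreal (2 * D) * ?t y)"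
        proof (cases "dist x y < \<kappa> * \<delta> i x")
          case True
          then have "ennreal (f i (x, y)) = ennreal (e i) * ?n y"
            using e[OF i] by (simp add: f_def ennreal_mult)
          also have "\<dots> \<le> ennreal (e i) * (?n y + ennreal (2 * D) * ?t y)"
            by (intro mult_left_mono) auto
          finally show ?thesis .
        next
          case False
          then have "ennreal (f i (x, y)) = ennreal (e i) * (ennreal (2 * D) * ?t y)"
            using e[OF i] D by (simp add: f_def ennreal_mult[symmetric])
          also have "\<dots> \<le> ennreal (e i) * (?n y + ennreal (2 * D) * ?t y)"
            by (intro mult_left_mono) auto
          finally show ?thesis .
        qed
      qed
      also have "\<dots> = ennreal (e i) * ((\<integral>\<^sup>+y. ?n y \<partial>M) + ennreal (2 * D) * (\<integral>\<^sup>+y. ?t y \<partial>M))"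
        by (simp add: nn_integral_cmult nn_integral_add)
      also have "\<dots> \<le> ennreal (e i) * (ennreal (?N * (\<kappa> * \<delta> i x) powr (1 - 2 * r))
          + ennreal (2 * D) * ennreal (?T * (\<kappa> * \<delta> i x) powr (1 - (1 + 2 * r))))"
        using xM \<kappa> \<delta> r by (intro mult_left_mono add_mono nn_integral_near nn_integral_tail) auto
      also have "\<dots> \<le> ennreal (e i) * ?h i x"
      proof (intro mult_left_mono add_mono)
        show "ennreal (?N * (\<kappa> * \<delta> i x) powr (1 - 2 * r)) \<le> ennreal ?a"
          using NT \<kappa> \<delta> r by (intro ennreal_leI mult_left_mono powr_mono2) auto
        have "ennreal (2 * D) * ennreal (?T * (\<kappa> * \<delta> i x) powr (1 - (1 + 2 * r)))
            = ennreal (?b * \<delta> i x powr (- (2 * r)))"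
          using NT D \<kappa> \<delta> by (simp add: powr_mult mult_ac flip: ennreal_mult)
        also have "\<dots> = ennreal ?b * ennreal (\<delta> i x powr (- (2 * r)))"
          using NT D by (simp add: ennreal_mult)
        \<comment> \<open>The negative power of a minimum is one of the two powers, hence at most
          their sum. This separates the two ends of the arc.\<close>
        also have "\<dots> \<le> ennreal ?b * (ennreal (dist x (p i) powr (- (2 * r))) + ennreal (dist x (q i) powr (- (2 * r))))"
          by (intro mult_left_mono) (auto simp: \<delta>_def min_def)
        finally show "ennreal (2 * D) * ennreal (?T * (\<kappa> * \<delta> i x) powr (1 - (1 + 2 * r))) \<le> \<dots>" .
      qed auto
      finally show ?thesis .
    qed
    have "(\<integral>\<^sup>+x. (\<integral>\<^sup>+y. K (x, y) \<partial>M) \<partial>M)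
        = (\<integral>\<^sup>+x. (\<Sum>i\<in>I. indicator (S i) x * (\<integral>\<^sup>+y. ennreal (f i (x, y)) \<partial>M)) \<partial>M)"
      unfolding K_def by (intro nn_integral_cong) (simp add: nn_integral_sum nn_integral_cmult)
    also have "\<dots> \<le> (\<integral>\<^sup>+x. (\<Sum>i\<in>I. indicator (S i) x * (ennreal (e i) * ?h i x)) \<partial>M)"
    proof (rule nn_integral_mono_AE)
      have "AE x in M. \<forall>i\<in>I. x \<noteq> p i \<and> x \<noteq> q i"
        using fin pq by (subst AE_ball_countable) (auto intro!: AE_neq countable_finite)
      then show "AE x in M. (\<Sum>i\<in>I. indicator (S i) x * (\<integral>\<^sup>+y. ennreal (f i (x, y)) \<partial>M))
          \<le> (\<Sum>i\<in>I. indicator (S i) x * (ennreal (e i) * ?h i x))"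
      proof (rule AE_mp, intro AE_I2 impI sum_mono)
        fix x i assume "x \<in> space M" "\<forall>i\<in>I. x \<noteq> p i \<and> x \<noteq> q i" "i \<in> I"
        then show "indicator (S i) x * (\<integral>\<^sup>+y. ennreal (f i (x, y)) \<partial>M)
          \<le> indicator (S i) x * (ennreal (e i) * ?h i x)"
          using inner[of i x] by (cases "x \<in> S i") auto
      qed
    qed
    also have "\<dots> = (\<Sum>i\<in>I. ennreal (e i) * (\<integral>\<^sup>+x. ?h i x * indicator (S i) x \<partial>M))"
      by (subst nn_integral_sum) (auto simp: mult_ac nn_integral_cmult intro!: sum.cong)
    also have "\<dots> \<le> (\<Sum>i\<in>I. ennreal (e i) * ennreal (?a * (A * D) + ?b * (2 * (?N * D powr (1 - 2 * r)))))"
    proof (intro sum_mono mult_left_mono)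
      fix i assume i: "i \<in> I"
      \<comment> \<open>The piece lies in the ball of radius \<open>D\<close> around either end, and
        there \<open>2 * r < 1\<close> makes the singularity integrable.\<close>
      have *: "(\<integral>\<^sup>+x. ennreal (dist x z powr (- (2 * r))) * indicator (S i) x \<partial>M) \<le> ennreal (?N * D powr (1 - 2 * r))"
        if "z \<in> space M" "\<And>x. x \<in> S i \<Longrightarrow> dist x z \<le> D" for z
      proof -
        have "(\<integral>\<^sup>+x. ennreal (dist x z powr (- (2 * r))) * indicator (S i) x \<partial>M)
           \<le> (\<integral>\<^sup>+x. indicator {x. dist z x \<le> D} x * ennreal (dist z x powr (- (2 * r))) \<partial>M)"
          using that by (intro nn_integral_mono) (auto simp: indicator_def dist_commute)
        also have "\<dots> \<le> ennreal (?N * D powr (1 - 2 * r))"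
          using that D r by (intro nn_integral_near) auto
        finally show ?thesis .
      qed
      have "(\<integral>\<^sup>+x. ?h i x * indicator (S i) x \<partial>M) = ennreal ?a * emeasure M (S i)
         + ennreal ?b * ((\<integral>\<^sup>+x. ennreal (dist x (p i) powr (- (2 * r))) * indicator (S i) x \<partial>M)
           + (\<integral>\<^sup>+x. ennreal (dist x (q i) powr (- (2 * r))) * indicator (S i) x \<partial>M))"
        using i by (simp add: distrib_right nn_integral_add nn_integral_cmult mult.assoc)
      also have "\<dots> \<le> ennreal ?a * ennreal (A * D)
         + ennreal ?b * (ennreal (?N * D powr (1 - 2 * r)) + ennreal (?N * D powr (1 - 2 * r)))"
        using i by (intro add_mono mult_left_mono emeasure_piece_le * pq dist_p dist_q) auto
      also have "\<dots> = ennreal (?a * (A * D) + ?b * (2 * (?N * D powr (1 - 2 * r))))"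
        using NT A_pos D by (simp flip: ennreal_mult ennreal_plus)
      finally show "(\<integral>\<^sup>+x. ?h i x * indicator (S i) x \<partial>M) \<le> \<dots>" .
    qed auto
    also have "\<dots> = ennreal (\<Sum>i\<in>I. e i * (?a * (A * D) + ?b * (2 * (?N * D powr (1 - 2 * r)))))"
    proof -
      have "0 \<le> ?a * (A * D) + ?b * (2 * (?N * D powr (1 - 2 * r)))"
        using NT A_pos D by (intro add_nonneg_nonneg mult_nonneg_nonneg) auto
      then show ?thesis
        using e by (simp add: ennreal_mult[symmetric] del: ennreal_plus)
    qed
    also have "(\<Sum>i\<in>I. e i * (?a * (A * D) + ?b * (2 * (?N * D powr (1 - 2 * r)))))
       = (A * ?N * \<kappa> powr (1 - 2 * r) + 4 * ?T * \<kappa> powr (- (2 * r)) * ?N) * D powr (2 - 2 * r) * (\<Sum>i\<in>I. e i)"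
    proof -
      have "D powr (2 - 2 * r) = D * D powr (1 - 2 * r)"
        using D by (simp add: powr_diff power2_eq_square)
      then show ?thesis using D \<kappa>
        unfolding sum_distrib_right[symmetric] by (simp add: powr_mult algebra_simps)
    qed
    finally show ?thesis .
  qed
  finally have "(\<integral>\<^sup>+z. ?k z \<partial>(M \<Otimes>\<^sub>M M)) \<le>
     ennreal ((A * ?N * \<kappa> powr (1 - 2 * r) + 4 * ?T * \<kappa> powr (- (2 * r)) * ?N) * D powr (2 - 2 * r) * (\<Sum>i\<in>I. e i)) +
     ennreal ((A * ?N * \<kappa> powr (1 - 2 * r) + 4 * ?T * \<kappa> powr (- (2 * r)) * ?N) * D powr (2 - 2 * r) * (\<Sum>i\<in>I. e i))"
    by (auto intro: add_mono)
  also have "\<dots> = ennreal (gagliardo_const r \<kappa> * D powr (2 - 2 * r) * (\<Sum>i\<in>I. e i))"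
    using NT A_pos e by (subst ennreal_plus[symmetric])
      (auto simp: gagliardo_const_def algebra_simps intro!: mult_nonneg_nonneg add_nonneg_nonneg sum_nonneg)
  finally show ?thesis .
qed

end

end

section \<open>Regular closed curves and arc length\<close>

locale closed_curve =
  fixes c :: "real \<Rightarrow> real^2" and c' :: "real \<Rightarrow> real^2"
  assumes deriv: "\<And>t. (c has_vector_derivative c' t) (at t)"
    and cont_deriv: "continuous_on UNIV c'"
    and periodic: "\<And>t. c (t + 1) = c t"
    and inj: "inj_on c {0..<1}"
    and deriv_nz: "\<And>t. c' t \<noteq> 0"

lemma closed_curve_of_smooth:
  assumes "smooth_closed_curve c"
  shows "closed_curve c (\<lambda>t. vector_derivative c (at t))"
proof -
  note smooth = assms[unfolded smooth_closed_curve_def]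
  obtain D where D': "D (0::nat) = c \<and> (\<forall>k t. (D k has_vector_derivative D (Suc k) t) (at t))"
    using conjunct1[OF smooth] by (rule exE)
  then have D: "D (0::nat) = c" "\<And>k t. (D k has_vector_derivative D (Suc k) t) (at t)"
    by simp_all
  have eq: "vector_derivative c (at t) = D 1 t" for t
    using vector_derivative_at[OF D(2)[of 0 t]] D(1) by simp
  have "continuous_on UNIV (D 1)"
    by (intro continuous_at_imp_continuous_on ballI has_vector_derivative_continuous[OF D(2)])
  moreover have "(c has_vector_derivative D 1 t) (at t)" for t
    using D(2)[of 0 t] D(1) by simp
  moreover have "\<And>t. c (t + 1) = c t" "inj_on c {0..<1}" "\<And>t. vector_derivative c (at t) \<noteq> 0"
    using conjunct2[OF smooth] by simp_all
  ultimately show ?thesis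
    by unfold_locales (simp_all only: eq not_False_eq_True)
qed

context closed_curve begin

lemma cont: "continuous_on X c"
  by (intro continuous_at_imp_continuous_on ballI has_vector_derivative_continuous[OF deriv])

lemma cont_compose: "continuous_on X f \<Longrightarrow> continuous_on X (\<lambda>x. c (f x))"
  using continuous_on_compose2[OF cont[of UNIV]] by blast

lemma periodic_int: "c (t + of_int k) = c t"
proof -
  have nat: "c (t + real n) = c t" for n t
    by (induction n) (use periodic in \<open>auto simp: add.assoc[symmetric] add.commute[of 1]\<close>)
  show ?thesis
  proof (cases "k \<ge> 0")
    case True then show ?thesis using nat[of t "nat k"] by simp
  next
    case False then show ?thesis using nat[of "t + of_int k" "nat (- k)"] by simp
  qed
qed

text \<open>Both parameters are reduced to their fractional parts, where \<open>c\<close> is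
  injective; \<open>k\<close> is the difference of the floors.\<close>

lemma eq_iff: "c t = c u \<longleftrightarrow> (\<exists>k::int. u = t + of_int k)"
proof
  assume "c t = c u"
  then have "c (frac t) = c (frac u)"
    using periodic_int[of t "- \<lfloor>t\<rfloor>"] periodic_int[of u "- \<lfloor>u\<rfloor>"] by (simp add: frac_def)
  then have "frac t = frac u"
    using inj by (auto simp: inj_on_def frac_ge_0 frac_lt_1)
  then have "u = t + of_int (\<lfloor>u\<rfloor> - \<lfloor>t\<rfloor>)" by (simp add: frac_def)
  then show "\<exists>k::int. u = t + of_int k" ..
qed (auto simp: periodic_int)

lemma deriv_periodic: "c' (t + 1) = c' t"
proof -
  have "((\<lambda>s. c (s + 1)) has_vector_derivative c' (t + 1)) (at t)"
    using deriv[of "t + 1"] unfolding has_vector_derivative_def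
    by (rule has_derivative_compose[of "\<lambda>s. s + 1" "\<lambda>s. s", rotated])
       (auto intro!: derivative_eq_intros)
  then show ?thesis
    using vector_derivative_unique_at[OF deriv[of t]] periodic by simp
qed

lemma deriv_periodic_int: "c' (t + of_int k) = c' t"
proof -
  have nat: "c' (t + real n) = c' t" for n t
    by (induction n) (use deriv_periodic in \<open>auto simp: add.assoc[symmetric] add.commute[of 1]\<close>)
  show ?thesis
  proof (cases "k \<ge> 0")
    case True then show ?thesis using nat[of t "nat k"] by simp
  next
    case False then show ?thesis using nat[of "t + of_int k" "nat (- k)"] by simp
  qed
qed

lemma range_eq: "range c = c ` {0..1}"
proof -
  have "c t \<in> c ` {0..1}" for t
    using periodic_int[of t "- \<lfloor>t\<rfloor>"] frac_ge_0[of t] frac_lt_1[of t]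
    by (intro image_eqI[of _ _ "frac t"]) (auto simp: frac_def)
  then show ?thesis by auto
qed

lemma compact_range: "compact (range c)"
  unfolding range_eq by (intro compact_continuous_image cont compact_Icc)

lemma deriv_bounds: "\<exists>l L. 0 < l \<and> (\<forall>t. l \<le> norm (c' t) \<and> norm (c' t) \<le> L)"
proof -
  have cn: "continuous_on {0..1} (\<lambda>t. norm (c' t))"
    using cont_deriv by (intro continuous_on_norm) (auto intro: continuous_on_subset)
  obtain a where a: "a \<in> {0..1}" "\<And>t. t \<in> {0..1} \<Longrightarrow> norm (c' a) \<le> norm (c' t)"
    using continuous_attains_inf[OF compact_Icc _ cn] by auto
  obtain b where b: "b \<in> {0..1}" "\<And>t. t \<in> {0..1} \<Longrightarrow> norm (c' t) \<le> norm (c' b)"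
    using continuous_attains_sup[OF compact_Icc _ cn] by auto
  have "norm (c' a) \<le> norm (c' t) \<and> norm (c' t) \<le> norm (c' b)" for t
  proof -
    have "c' t = c' (frac t)" using deriv_periodic_int[of t "- \<lfloor>t\<rfloor>"] by (simp add: frac_def)
    then show ?thesis using a b frac_ge_0[of t] frac_lt_1[of t] by auto
  qed
  then show ?thesis using deriv_nz[of a] by (intro exI[of _ "norm (c' a)"] exI[of _ "norm (c' b)"]) auto
qed

text \<open>For close parameters the curve is nearly its tangent, by uniform continuity of
  \<open>c'\<close>. For the others, up to half a period, the chord length has a positive minimum by
  compactness, as two parameters with the same image differ by an integer.\<close>

lemma chord_lower: "\<exists>a>0. \<forall>t u. \<bar>u - t\<bar> \<le> 1 / 2 \<longrightarrow> a * \<bar>u - t\<bar> \<le> norm (c u - c t)"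
proof -
  obtain l where l: "0 < l" "\<And>t. l \<le> norm (c' t)" using deriv_bounds by blast
  \<comment> \<open>The interval contains all parameters within
    \<open>\<epsilon> \<le> 1 / 2\<close> of some \<open>t\<close> in [0, 1].\<close>
  have "uniformly_continuous_on {-1..2} c'"
    using cont_deriv by (intro compact_uniformly_continuous) (auto intro: continuous_on_subset)
  then obtain \<eta> where \<eta>: "0 < \<eta>" "\<And>t u. t \<in> {-1..2} \<Longrightarrow> u \<in> {-1..2} \<Longrightarrow> dist u t < \<eta> \<Longrightarrow> dist (c' u) (c' t) < l / 2"
    unfolding uniformly_continuous_on_def using half_gt_zero[OF l(1)] by blast
  define \<epsilon> where "\<epsilon> = min (\<eta> / 2) (1 / 2)"
  have \<epsilon>: "0 < \<epsilon>" "\<epsilon> < \<eta>" "\<epsilon> \<le> 1 / 2" using \<eta>(1) by (auto simp: \<epsilon>_def)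
  have close: "l / 2 * \<bar>u - t\<bar> \<le> norm (c u - c t)" if t: "t \<in> {0..1}" and u: "\<bar>u - t\<bar> \<le> \<epsilon>" for t u
  proof -
    let ?S = "{t - \<epsilon>..t + \<epsilon>}"
    \<comment> \<open>With the tangent at \<open>t\<close> removed, the rest has derivative at most
      \<open>l / 2\<close> nearby, whereas the tangent contributes at least
      \<open>l * \<bar>u - t\<bar>\<close>.\<close>
    define F where "F s = c s - s *\<^sub>R c' t" for s
    have "norm (F u - F t) \<le> l / 2 * norm (u - t)"
    proof (rule differentiable_bound[of ?S F "\<lambda>s h. h *\<^sub>R (c' s - c' t)"])
      fix s assume s: "s \<in> ?S"
      show "(F has_derivative (\<lambda>h. h *\<^sub>R (c' s - c' t))) (at s within ?S)"
        unfolding F_def using deriv[of s, unfolded has_vector_derivative_def, THEN has_derivative_at_withinI]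
        by (rule has_derivative_eq_rhs[OF has_derivative_diff])
           (auto intro!: derivative_eq_intros simp: algebra_simps)
      have "dist (c' s) (c' t) < l / 2" using s t \<epsilon> by (intro \<eta>) (auto simp: dist_real_def)
      then show "onorm (\<lambda>h. h *\<^sub>R (c' s - c' t)) \<le> l / 2"
        using mult_left_mono[of "norm (c' s - c' t)" "l / 2"]
        by (intro onorm_le) (simp add: dist_norm mult.commute[of l])
    qed (use u in auto)
    then have "norm ((c u - c t) - (u - t) *\<^sub>R c' t) \<le> l / 2 * \<bar>u - t\<bar>"
      by (simp add: F_def algebra_simps)
    moreover have "norm ((u - t) *\<^sub>R c' t) \<ge> l * \<bar>u - t\<bar>"
      using l(2)[of t] by (simp add: mult.commute mult_right_mono)
    ultimately show ?thesis
      using norm_triangle_ineq2[of "(u - t) *\<^sub>R c' t" "c u - c t"] by (simp add: norm_minus_commute)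
  qed
  \<comment> \<open>Pairs of a base parameter and an offset. Periodicity reduces the base to [0, 1],
    which is what makes the set compact.\<close>
  define K where "K = {0..1::real} \<times> ({- (1 / 2)..- \<epsilon>} \<union> {\<epsilon>..1 / 2})"
  have K1: "compact K"
    unfolding K_def by (intro compact_Times compact_Un compact_Icc)
  have "(0, 1 / 2) \<in> K"
    using \<epsilon> by (simp add: K_def)
  then have K2: "K \<noteq> {}" by blast
  have K3: "continuous_on K (\<lambda>z. norm (c (fst z + snd z) - c (fst z)))"
    by (intro continuous_on_norm continuous_on_diff cont_compose continuous_on_add
          continuous_on_fst continuous_on_snd continuous_on_id)
  have "\<exists>z\<in>K. \<forall>y\<in>K. norm (c (fst z + snd z) - c (fst z)) \<le> norm (c (fst y + snd y) - c (fst y))"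
    by (rule continuous_attains_inf[OF K1 K2 K3])
  then obtain z where z: "z \<in> K" "\<And>y. y \<in> K \<Longrightarrow>
      norm (c (fst z + snd z) - c (fst z)) \<le> norm (c (fst y + snd y) - c (fst y))"
    by (elim bexE) (rule that, assumption, erule bspec)
  obtain t0 d0 where z0: "z = (t0, d0)" by force
  define \<mu> where "\<mu> = norm (c (t0 + d0) - c t0)"
  have "c (t0 + d0) \<noteq> c t0"
  proof
    assume "c (t0 + d0) = c t0"
    then obtain k :: int where "t0 + d0 = t0 + of_int k" using eq_iff[of t0] by metis
    then have d0: "d0 = of_int k" by simp
    have "\<bar>d0\<bar> \<le> 1/2" "d0 \<noteq> 0" using z(1) z0 \<epsilon> by (auto simp: K_def)
    then have "\<bar>k\<bar> < 1" "k \<noteq> 0" using d0 by (auto simp flip: of_int_abs)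
    then show False by linarith
  qed
  then have \<mu>: "\<mu> > 0" by (simp add: \<mu>_def)
  define a where "a = min (l / 2) \<mu>"
  have "a * \<bar>u - t\<bar> \<le> norm (c u - c t)" if ut: "\<bar>u - t\<bar> \<le> 1 / 2" for t u
  proof -
    define t1 where "t1 = t - of_int \<lfloor>t\<rfloor>"
    define u1 where "u1 = u - of_int \<lfloor>t\<rfloor>"
    have t1: "t1 \<in> {0..1}" using frac_ge_0[of t] frac_lt_1[of t] by (simp add: t1_def frac_def)
    have eq: "c t1 = c t" "c u1 = c u" "u1 - t1 = u - t"
      using periodic_int[of t "- \<lfloor>t\<rfloor>"] periodic_int[of u "- \<lfloor>t\<rfloor>"] by (auto simp: t1_def u1_def)
    show ?thesis
    proof (cases "\<bar>u - t\<bar> \<le> \<epsilon>")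
      case True
      have "a * \<bar>u - t\<bar> \<le> l / 2 * \<bar>u - t\<bar>" by (intro mult_right_mono) (auto simp: a_def)
      then show ?thesis using close[OF t1, of u1] True eq by simp
    next
      case False
      then have "(t1, u1 - t1) \<in> K" using t1 ut eq unfolding K_def by (cases "u \<ge> t"; auto)
      from z(2)[OF this] have "\<mu> \<le> norm (c u1 - c t1)" by (simp add: z0 \<mu>_def del: norm_minus_commute)
      moreover have "a * \<bar>u - t\<bar> \<le> \<mu> * 1" using ut \<mu> l by (intro mult_mono) (auto simp: a_def)
      ultimately show ?thesis using eq by simp
    qed
  qed
  moreover have "a > 0" using \<mu> l by (simp add: a_def)
  ultimately show ?thesis by blast
qed

lemma lipschitz:
  assumes "\<And>t. norm (c' t) \<le> L"
  shows "norm (c u - c t) \<le> L * \<bar>u - t\<bar>"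
proof -
  have "norm (c u - c t) \<le> L * norm (u - t)"
  proof (rule differentiable_bound[of UNIV c "\<lambda>s h. h *\<^sub>R c' s"])
    show "(c has_derivative (\<lambda>h. h *\<^sub>R c' s)) (at s within UNIV)" for s
      using deriv[of s] by (simp add: has_vector_derivative_def)
    show "onorm (\<lambda>h. h *\<^sub>R c' s) \<le> L" for s
      using assms[of s] by (intro onorm_le) (simp add: mult.commute[of L] mult_left_mono)
  qed auto
  then show ?thesis by simp
qed

lemma near_parameter:
  assumes "y \<in> range c"
  shows "\<exists>u. c u = y \<and> \<bar>u - t\<bar> \<le> 1 / 2"
proof -
  obtain s where s: "y = c s" using assms by auto
  have "c (s + of_int (- round (s - t))) = y" using s periodic_int[of s "- round (s - t)"] by simp
  moreover have "\<bar>s + of_int (- round (s - t)) - t\<bar> \<le> 1 / 2"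
    using of_int_round_abs_le[of "s - t"] by (simp add: abs_minus_commute algebra_simps)
  ultimately show ?thesis by blast
qed

text \<open>The closed curve is cut at a point \<open>c t0\<close> outside \<open>X\<close>. On the
  remaining open period \<open>c\<close> is injective, so it is a homeomorphism from the compact
  parameter set of \<open>X\<close> onto \<open>X\<close>, and a compact connected set of reals is
  an interval.\<close>

lemma connected_compact_eq_image_Icc:
  assumes X: "compact X" "connected X" "X \<noteq> {}" "X \<subseteq> range c"
  shows "\<exists>\<alpha> \<beta>. \<alpha> \<le> \<beta> \<and> \<beta> \<le> \<alpha> + 1 \<and> X = c ` {\<alpha>..\<beta>}"
proof (cases "X = range c")
  case True
  then show ?thesis by (intro exI[of _ 0] exI[of _ 1]) (simp add: range_eq)
next
  case False
  then obtain t0 where t0: "c t0 \<notin> X" using X by auto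
  define S where "S = {t \<in> {t0..t0 + 1}. c t \<in> X}"
  have S: "compact S"
  proof -
    have "S = {t0..t0+1} \<inter> c -` X" by (auto simp: S_def)
    then have "closed S"
      using continuous_closed_preimage[OF cont[of "{t0..t0+1}"] _ compact_imp_closed[OF X(1)]] by simp
    moreover have "bounded S"
      by (rule bounded_subset[OF bounded_closed_interval[of t0 "t0+1"]]) (auto simp: S_def)
    ultimately show ?thesis by (simp add: compact_eq_bounded_closed)
  qed
  have image: "c ` S = X"
  proof
    show "X \<subseteq> c ` S"
    proof
      fix y assume y: "y \<in> X"
      then obtain u where u: "c u = y" "\<bar>u - (t0 + 1/2)\<bar> \<le> 1 / 2"
        using near_parameter[of y "t0 + 1/2"] X by auto
      have "u \<in> {t0..t0+1}" using abs_le_D1[OF u(2)] abs_le_D2[OF u(2)] by auto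
      then show "y \<in> c ` S" using y u(1) by (auto simp: S_def)
    qed
  qed (auto simp: S_def)
  have injS: "inj_on c S"
  proof (rule inj_onI)
    fix s t assume s: "s \<in> S" and t: "t \<in> S" and "c s = c t"
    then obtain k :: int where k: "t = s + of_int k" using eq_iff by auto
    \<comment> \<open>Both ends of the period map to the omitted point, so two parameters in
      \<open>S\<close> differ by less than 1.\<close>
    have ne: "s \<noteq> t0" "t \<noteq> t0" "s \<noteq> t0 + 1" "t \<noteq> t0 + 1"
      using s t t0 periodic[of t0] by (auto simp: S_def)
    then have "\<bar>of_int k :: real\<bar> < 1" using s t k unfolding S_def by auto
    then have "k = 0" by (simp flip: of_int_abs)
    then show "s = t" using k by simp
  qed
  have "connected S"
  proof -
    have "continuous_on (c ` S) (inv_into S c)"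
      using S injS by (intro continuous_on_inv cont) auto
    then have "connected (inv_into S c ` X)"
      using X(2) image connected_continuous_image by blast
    then show ?thesis using image injS by (metis inv_into_image_cancel order_refl)
  qed
  then obtain \<alpha> \<beta> where ab: "S = {\<alpha>..\<beta>}"
    using S connected_compact_interval_1 by blast
  have "S \<noteq> {}" using image X(3) by auto
  then have "\<alpha> \<le> \<beta>" using ab by simp
  moreover have "\<alpha> \<in> S" "\<beta> \<in> S" using calculation ab by auto
  then have "\<beta> \<le> \<alpha> + 1" by (auto simp: S_def)
  ultimately show ?thesis using image ab by blast
qed

end

section \<open>Arc length on a system of closed curves\<close>

text \<open>The interval is cut at the integer \<open>\<lfloor>a\<rfloor> + 1\<close>; the part
  beyond it, moved back by one period, completes the rest to a period that starts at an
  integer.\<close>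

lemma nn_integral_periodic_shift:
  fixes F :: "real \<Rightarrow> ennreal"
  assumes [measurable]: "F \<in> borel_measurable borel" and per: "\<And>t. F (t + 1) = F t"
  shows "(\<integral>\<^sup>+t. F t * indicator {a..<a + 1} t \<partial>lborel) = (\<integral>\<^sup>+t. F t * indicator {0..<1} t \<partial>lborel)"
proof -
  have per_nat: "F (t + real n) = F t" for n t
    by (induction n) (use per in \<open>auto simp: add.assoc[symmetric] add.commute[of 1]\<close>)
  have per_int: "F (t + of_int k) = F t" for k t
  proof (cases "k \<ge> 0")
    case True then show ?thesis using per_nat[of t "nat k"] by simp
  next
    case False then show ?thesis using per_nat[of "t + of_int k" "nat (- k)"] by simp
  qed
  have shift: "(\<integral>\<^sup>+t. F t * indicator {b + of_int k..<d + of_int k} t \<partial>lborel) = (\<integral>\<^sup>+t. F t * indicator {b..<d} t \<partial>lborel)"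
    for b d and k :: int
  proof -
    have "(\<integral>\<^sup>+t. F t * indicator {b + of_int k..<d + of_int k} t \<partial>lborel)
        = (\<integral>\<^sup>+t. F (of_int k + 1 * t) * indicator {b + of_int k..<d + of_int k} (of_int k + 1 * t) \<partial>lborel)"
      by (subst nn_integral_real_affine[where c=1 and t="of_int k"]) auto
    also have "\<dots> = (\<integral>\<^sup>+t. F t * indicator {b..<d} t \<partial>lborel)"
      by (intro nn_integral_cong) (use per_int in \<open>auto simp: indicator_def add.commute\<close>)
    finally show ?thesis .
  qed
  have split: "(\<integral>\<^sup>+t. F t * indicator {b..<d} t \<partial>lborel)
      = (\<integral>\<^sup>+t. F t * indicator {b..<z} t \<partial>lborel) + (\<integral>\<^sup>+t. F t * indicator {z..<d} t \<partial>lborel)"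
    if "b \<le> z" "z \<le> d" for b z d
  proof -
    have "(\<integral>\<^sup>+t. F t * indicator {b..<d} t \<partial>lborel)
      = (\<integral>\<^sup>+t. F t * indicator {b..<z} t + F t * indicator {z..<d} t \<partial>lborel)"
      by (intro nn_integral_cong) (use that in \<open>auto simp: indicator_def\<close>)
    then show ?thesis by (simp add: nn_integral_add)
  qed
  let ?n = "of_int \<lfloor>a\<rfloor> :: real"
  have n: "?n \<le> a" "a \<le> ?n + 1" by linarith+
  have "(\<integral>\<^sup>+t. F t * indicator {a..<a + 1} t \<partial>lborel)
     = (\<integral>\<^sup>+t. F t * indicator {a..<?n + 1} t \<partial>lborel) + (\<integral>\<^sup>+t. F t * indicator {?n + 1..<a + 1} t \<partial>lborel)"
    using n by (intro split) auto
  also have "(\<integral>\<^sup>+t. F t * indicator {?n + 1..<a + 1} t \<partial>lborel) = (\<integral>\<^sup>+t. F t * indicator {?n..<a} t \<partial>lborel)"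
    using shift[of ?n 1 a] by simp
  also have "(\<integral>\<^sup>+t. F t * indicator {a..<?n + 1} t \<partial>lborel) + (\<integral>\<^sup>+t. F t * indicator {?n..<a} t \<partial>lborel)
     = (\<integral>\<^sup>+t. F t * indicator {?n..<?n + 1} t \<partial>lborel)"
    using split[of ?n a "?n + 1"] n by (simp add: add.commute)
  also have "\<dots> = (\<integral>\<^sup>+t. F t * indicator {0..<1} t \<partial>lborel)"
    using shift[of 0 "\<lfloor>a\<rfloor>" 1] by (simp add: add.commute)
  finally show ?thesis .
qed

text \<open>Each threshold is inherited by smaller numbers, so the minimum over the finitely many
  indices serves all of them. The inserted 1 covers \<open>m = 0\<close>.\<close>

lemma ex_common_lower_bound:
  fixes m :: nat
  assumes "\<And>j. j < m \<Longrightarrow> \<exists>a>0::real. \<forall>b. 0 < b \<and> b \<le> a \<longrightarrow> P j b"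
  shows "\<exists>a>0. \<forall>j<m. P j a"
proof -
  obtain a where a: "\<And>j. j < m \<Longrightarrow> 0 < a j \<and> (\<forall>b. 0 < b \<and> b \<le> a j \<longrightarrow> P j b)"
    using assms by metis
  let ?a = "Min (insert 1 (a ` {..<m}))"
  have "0 < ?a" using a by (subst Min_gr_iff) auto
  moreover have "?a \<le> a j" if "j < m" for j using that by (intro Min_le) auto
  ultimately show ?thesis using a by blast
qed

locale boundary_curves =
  fixes m :: nat and c :: "nat \<Rightarrow> real \<Rightarrow> real^2"
  assumes smooth: "\<And>j. j < m \<Longrightarrow> smooth_closed_curve (c j)"
    and disj: "disjoint_family_on (\<lambda>j. range (c j)) {..<m}"
begin

abbreviation c' :: "nat \<Rightarrow> real \<Rightarrow> real^2" where
  "c' j t \<equiv> vector_derivative (c j) (at t)"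

abbreviation \<gamma> :: "(real^2) set" where "\<gamma> \<equiv> curve_system m c"

abbreviation \<sigma> :: "(real^2) measure" where "\<sigma> \<equiv> arclength m c"

lemma curve: "j < m \<Longrightarrow> closed_curve (c j) (c' j)"
  by (rule closed_curve_of_smooth[OF smooth])

lemma same_component: "j < m \<Longrightarrow> k < m \<Longrightarrow> c j t = c k u \<Longrightarrow> j = k"
  using disj unfolding disjoint_family_on_def by blast

lemma in_\<gamma>: "j < m \<Longrightarrow> c j t \<in> \<gamma>"
  by (auto simp: curve_system_def)

lemma compact_\<gamma>: "compact \<gamma>"
  unfolding curve_system_def
  by (intro compact_UN) (auto intro: closed_curve.compact_range[OF curve])

lemma borel_\<gamma> [measurable]: "\<gamma> \<in> sets borel"
  using compact_\<gamma> by (intro borel_closed compact_imp_closed)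

lemma space_\<sigma> [simp]: "space \<sigma> = \<gamma>"
  by (simp add: arclength_def space_restrict_space)

lemma sets_\<sigma>: "sets \<sigma> = sets (restrict_space borel \<gamma>)"
  by (simp add: arclength_def)

lemma in_sets_\<sigma>: "B \<in> sets borel \<Longrightarrow> B \<subseteq> \<gamma> \<Longrightarrow> B \<in> sets \<sigma>"
  unfolding sets_\<sigma> by (subst sets_restrict_space_iff) auto

lemma measurable_curve: "j < m \<Longrightarrow> c j \<in> borel_measurable borel"
  by (intro borel_measurable_continuous_onI closed_curve.cont[OF curve])

lemma measurable_speed: "j < m \<Longrightarrow> (\<lambda>t. norm (c' j t)) \<in> borel_measurable borel"
  by (intro borel_measurable_continuous_onI continuous_on_norm closed_curve.cont_deriv[OF curve])

lemma nn_integral_arclength: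
  assumes f: "f \<in> borel_measurable \<sigma>"
  shows "(\<integral>\<^sup>+x. f x \<partial>\<sigma>)
    = (\<Sum>j<m. \<integral>\<^sup>+t. ennreal (norm (c' j t)) * f (c j t) * indicator {0..<1} t \<partial>lborel)"
proof -
  let ?R = "restrict_space lborel {0..<1::real}"
  let ?P = "count_space {..<m} \<Otimes>\<^sub>M ?R"
  let ?d = "\<lambda>(j, t). ennreal (norm (c' j t))"
  interpret R: finite_measure ?R
    by (intro finite_measureI) (simp add: space_restrict_space emeasure_restrict_space)
  have cm: "(\<lambda>(j, t). c j t) \<in> measurable ?P (restrict_space borel \<gamma>)"
  proof (rule measurable_restrict_space2)
    show "(\<lambda>(j, t). c j t) \<in> borel_measurable ?P"
      by (rule measurable_pair_measure_countable1)
         (auto intro!: measurable_restrict_space1 measurable_curve)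
  qed (auto simp: space_pair_measure in_\<gamma>)
  have dm [measurable]: "?d \<in> borel_measurable ?P"
    by (rule measurable_pair_measure_countable1)
       (auto intro!: measurable_restrict_space1 measurable_compose[OF measurable_speed])
  have fr: "f \<in> borel_measurable (restrict_space borel \<gamma>)"
    using f measurable_cong_sets[OF sets_\<sigma> refl] by blast
  have fc [measurable]: "(\<lambda>z. f (case z of (j, t) \<Rightarrow> c j t)) \<in> borel_measurable ?P"
    by (rule measurable_compose[OF cm fr])
  have "(\<integral>\<^sup>+x. f x \<partial>\<sigma>) = (\<integral>\<^sup>+z. f (case z of (j, t) \<Rightarrow> c j t) \<partial>density ?P ?d)"
    unfolding arclength_def using cm fr by (intro nn_integral_distr) auto
  also have "\<dots> = (\<integral>\<^sup>+z. ?d z * f (case z of (j, t) \<Rightarrow> c j t) \<partial>?P)"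
    by (rule nn_integral_density) measurable
  also have "\<dots> = (\<integral>\<^sup>+j. \<integral>\<^sup>+t. ?d (j, t) * f (case (j, t) of (j, t) \<Rightarrow> c j t) \<partial>?R \<partial>count_space {..<m})"
    by (rule R.nn_integral_fst[symmetric]) measurable
  also have "\<dots> = (\<Sum>j<m. \<integral>\<^sup>+t. ennreal (norm (c' j t)) * f (c j t) \<partial>?R)"
    by (simp add: nn_integral_count_space_finite)
  also have "\<dots> = (\<Sum>j<m. \<integral>\<^sup>+t. ennreal (norm (c' j t)) * f (c j t) * indicator {0..<1} t \<partial>lborel)"
    by (intro sum.cong refl nn_integral_restrict_space) auto
  finally show ?thesis .
qed

lemma measurable_speed_indicator:
  assumes "j < m" "B \<in> sets borel"
  shows "(\<lambda>t. ennreal (norm (c' j t)) * indicator B (c j t)) \<in> borel_measurable borel"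
proof -
  have "(\<lambda>t. indicator B (c j t) :: ennreal) \<in> borel_measurable borel"
    using assms by (intro measurable_compose[OF measurable_curve]) auto
  then show ?thesis using measurable_speed[OF assms(1)] by measurable
qed

text \<open>The free starting points \<open>a j\<close> allow the period to be centred at a given
  parameter, or to begin where a given arc begins, so that no wrap-around occurs.\<close>

lemma emeasure_arclength:
  assumes B: "B \<in> sets borel" "B \<subseteq> \<gamma>"
  shows "emeasure \<sigma> B
    = (\<Sum>j<m. \<integral>\<^sup>+t. ennreal (norm (c' j t)) * indicator B (c j t) * indicator {a j..<a j + 1} t \<partial>lborel)"
proof -
  have "emeasure \<sigma> B = (\<integral>\<^sup>+x. indicator B x \<partial>\<sigma>)"
    using in_sets_\<sigma>[OF B] by simp
  also have "\<dots> = (\<Sum>j<m. \<integral>\<^sup>+t. ennreal (norm (c' j t)) * indicator B (c j t) * indicator {0..<1} t \<partial>lborel)"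
    using in_sets_\<sigma>[OF B] by (intro nn_integral_arclength) auto
  also have "\<dots> = (\<Sum>j<m. \<integral>\<^sup>+t. ennreal (norm (c' j t)) * indicator B (c j t) * indicator {a j..<a j + 1} t \<partial>lborel)"
  proof (intro sum.cong refl nn_integral_periodic_shift[symmetric])
    fix j t assume j: "j \<in> {..<m}"
    then interpret closed_curve "c j" "c' j" by (intro curve) auto
    show "ennreal (norm (c' j (t + 1))) * indicator B (c j (t + 1)) = ennreal (norm (c' j t)) * indicator B (c j t)"
      by (simp only: periodic deriv_periodic)
  qed (use measurable_speed_indicator B in auto)
  finally show ?thesis .
qed

lemma speed_bounds: "\<exists>l L. 0 < l \<and> 0 < L \<and> (\<forall>j<m. \<forall>t. l \<le> norm (c' j t) \<and> norm (c' j t) \<le> L)"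
proof -
  \<comment> \<open>Lower and upper bound are encoded by one number \<open>a\<close>, because a
    condition of this shape persists for smaller \<open>a\<close>.\<close>
  have "\<exists>a>0. \<forall>j<m. \<forall>t. a \<le> norm (c' j t) \<and> norm (c' j t) \<le> 1 / a"
  proof (rule ex_common_lower_bound)
    fix j assume "j < m"
    then interpret closed_curve "c j" "c' j" by (rule curve)
    obtain l L where l: "0 < l" "\<And>t. l \<le> norm (c' j t)" "\<And>t. norm (c' j t) \<le> L"
      using deriv_bounds by blast
    have L: "0 < L" using l(1) l(2)[of 0] l(3)[of 0] by linarith
    have "b \<le> norm (c' j t) \<and> norm (c' j t) \<le> 1 / b" if b: "0 < b" "b \<le> min l (1 / L)" for b t
    proof -
      have "L \<le> 1 / b" using b L by (simp add: field_simps)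
      then show ?thesis using b l(2,3)[of t] by simp
    qed
    then show "\<exists>a>0. \<forall>b. 0 < b \<and> b \<le> a \<longrightarrow> (\<forall>t. b \<le> norm (c' j t) \<and> norm (c' j t) \<le> 1 / b)"
      using l L by (intro exI[of _ "min l (1 / L)"]) auto
  qed
  then obtain a where a: "0 < a" "\<forall>j<m. \<forall>t. a \<le> norm (c' j t) \<and> norm (c' j t) \<le> 1 / a" by blast
  then show ?thesis by (intro exI[of _ a] exI[of _ "1 / a"]) auto
qed

text \<open>Distinct curves have positive distance, so a boundary point near \<open>c j t\<close>
  lies on the curve \<open>j\<close>, where \<open>chord_lower\<close> applies. One
  \<open>\<kappa>\<close> serves as both threshold and factor, since both properties persist when it
  shrinks.\<close>

lemma chord_arc:
  "\<exists>\<kappa>>0. \<forall>j<m. \<forall>t. \<forall>y\<in>\<gamma>. dist (c j t) y < \<kappa> \<longrightarrow>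
     (\<exists>u. y = c j u \<and> \<kappa> * \<bar>u - t\<bar> \<le> dist (c j t) y)"
proof (rule ex_common_lower_bound)
  fix j assume j: "j < m"
  then interpret closed_curve "c j" "c' j" by (rule curve)
  let ?Y = "\<Union>k\<in>{..<m} - {j}. range (c k)"
  have Y: "compact ?Y"
    by (intro compact_UN) (auto intro: closed_curve.compact_range[OF curve])
  have YJ: "range (c j) \<inter> ?Y = {}"
    using same_component j by fastforce
  obtain d where "d > 0 \<and> (\<forall>x\<in>range (c j). \<forall>y\<in>?Y. d \<le> dist x y)"
    using separate_compact_closed[OF compact_range compact_imp_closed[OF Y] YJ] unfolding Bex_def by (rule exE)
  then have d: "d > 0" "\<And>x y. x \<in> range (c j) \<Longrightarrow> y \<in> ?Y \<Longrightarrow> d \<le> dist x y"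
    by blast+
  obtain a where a: "a > 0" "\<And>t u. \<bar>u - t\<bar> \<le> 1 / 2 \<Longrightarrow> a * \<bar>u - t\<bar> \<le> norm (c j u - c j t)"
    using chord_lower by blast
  have "\<exists>u. y = c j u \<and> b * \<bar>u - t\<bar> \<le> dist (c j t) y"
    if b: "0 < b" "b \<le> min a d" and y: "y \<in> \<gamma>" "dist (c j t) y < b" for b t y
  proof -
    have "y \<notin> ?Y" using d(2)[of "c j t" y] y(2) b by fastforce
    then have "y \<in> range (c j)" using y(1) by (auto simp: curve_system_def)
    then obtain u where u: "c j u = y" "\<bar>u - t\<bar> \<le> 1 / 2" using near_parameter by blast
    have "b * \<bar>u - t\<bar> \<le> a * \<bar>u - t\<bar>" using b by (intro mult_right_mono) auto
    also have "\<dots> \<le> dist (c j t) y" using a(2)[OF u(2)] u(1) by (simp add: dist_norm norm_minus_commute)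
    finally show ?thesis using u by blast
  qed
  then show "\<exists>a>0. \<forall>b. 0 < b \<and> b \<le> a \<longrightarrow> (\<forall>t. \<forall>y\<in>\<gamma>. dist (c j t) y < b \<longrightarrow>
     (\<exists>u. y = c j u \<and> b * \<bar>u - t\<bar> \<le> dist (c j t) y))"
    using a(1) d(1) by (intro exI[of _ "min a d"]) auto
qed

lemma finite_measure_\<sigma>:
  assumes L: "0 < L" "\<And>j t. j < m \<Longrightarrow> norm (c' j t) \<le> L"
  shows "emeasure \<sigma> \<gamma> \<le> ennreal (real m * L)"
proof -
  have "emeasure \<sigma> \<gamma> = (\<Sum>j<m. \<integral>\<^sup>+t. ennreal (norm (c' j t)) * indicator \<gamma> (c j t) * indicator {0..<0 + 1} t \<partial>lborel)"
    by (rule emeasure_arclength) auto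
  also have "\<dots> \<le> (\<Sum>j<m. \<integral>\<^sup>+t. ennreal L * indicator {0..<1::real} t \<partial>lborel)"
  proof (rule sum_mono, rule nn_integral_mono)
    fix j t assume "j \<in> {..<m}"
    then show "ennreal (norm (c' j t)) * indicator \<gamma> (c j t) * indicator {0..<0 + 1} t \<le> ennreal L * indicator {0..<1} t"
      using L(2)[of j t] by (auto split: split_indicator intro!: ennreal_leI)
  qed
  also have "\<dots> = ennreal (real m * L)"
    using L by (simp add: nn_integral_cmult ennreal_mult ennreal_of_nat_eq_real_of_nat)
  finally show ?thesis .
qed

text \<open>For small radii the points of a ball have parameters within
  \<open>\<rho> / \<kappa>\<close> of that of the centre, so their length is at most
  \<open>L * (2 * \<rho> / \<kappa>)\<close>. For radii of at least \<open>\<kappa> / 2\<close> the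
  total length \<open>real m * L\<close> suffices.\<close>

lemma ahlfors_arclength: "\<exists>A. ahlfors_upper \<sigma> A"
proof -
  obtain l L where L: "0 < L" "\<And>j t. j < m \<Longrightarrow> norm (c' j t) \<le> L"
    using speed_bounds by blast
  obtain \<kappa> where \<kappa>: "0 < \<kappa>" and arc: "\<And>j t y. j < m \<Longrightarrow> y \<in> \<gamma> \<Longrightarrow> dist (c j t) y < \<kappa> \<Longrightarrow>
     \<exists>u. y = c j u \<and> \<kappa> * \<bar>u - t\<bar> \<le> dist (c j t) y"
    using chord_arc by metis
  \<comment> \<open>The summand 1 serves small radii; \<open>real m\<close> serves large ones, where
    \<open>A * \<rho>\<close> is at least \<open>(1 + real m) * L\<close>.\<close>
  define A where "A = 2 * (1 + real m) * L / \<kappa>"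
  have A: "0 < A" using L \<kappa> by (simp add: A_def)
  have "emeasure \<sigma> (\<gamma> \<inter> cball x \<rho>) \<le> ennreal (A * \<rho>)" if x: "x \<in> \<gamma>" and \<rho>: "0 < \<rho>" for x \<rho>
  proof (cases "\<rho> < \<kappa> / 2")
    case False
    have "emeasure \<sigma> (\<gamma> \<inter> cball x \<rho>) \<le> emeasure \<sigma> \<gamma>"
      using in_sets_\<sigma> by (intro emeasure_mono) auto
    also have "\<dots> \<le> ennreal (real m * L)" by (rule finite_measure_\<sigma>[OF L])
    also have "real m * L \<le> A * \<rho>"
    proof -
      have "real m * L \<le> (2 * (1 + real m) * L / \<kappa>) * (\<kappa> / 2)" using \<kappa> L by (simp add: field_simps)
      also have "\<dots> \<le> A * \<rho>" unfolding A_def using False L \<kappa> by (intro mult_left_mono) auto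
      finally show ?thesis .
    qed
    then have "ennreal (real m * L) \<le> ennreal (A * \<rho>)" by (rule ennreal_leI)
    finally show ?thesis .
  next
    case True
    obtain j t where j: "j < m" "x = c j t" using x by (auto simp: curve_system_def)
    then interpret closed_curve "c j" "c' j" by (intro curve) auto
    let ?B = "\<gamma> \<inter> cball x \<rho>"
    let ?a = "\<lambda>k::nat. t - 1 / 2"
    have *: "k = j \<and> \<bar>\<tau> - t\<bar> \<le> \<rho> / \<kappa>"
      if k: "k < m" "c k \<tau> \<in> ?B" "\<tau> \<in> {t - 1/2..<t - 1/2 + 1}" for k \<tau>
    proof -
      have "dist (c j t) (c k \<tau>) < \<kappa>" using k j True \<kappa> by auto
      then obtain u where u: "c k \<tau> = c j u" "\<kappa> * \<bar>u - t\<bar> \<le> dist (c j t) (c k \<tau>)"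
        using arc[OF j(1) in_\<gamma>[OF k(1)]] by blast
      have kj: "k = j" using same_component[OF k(1) j(1) u(1)] .
      have "\<kappa> * \<bar>u - t\<bar> \<le> \<rho>" using u(2) k j by auto
      then have ut: "\<bar>u - t\<bar> \<le> \<rho> / \<kappa>" using \<kappa> by (simp add: field_simps)
      moreover have "\<rho> / \<kappa> < 1 / 2" using True \<kappa> by (simp add: field_simps)
      ultimately have "\<bar>u - t\<bar> < 1 / 2" by linarith
      moreover obtain i :: int where i: "u = \<tau> + of_int i" using u(1) kj eq_iff by auto
      \<comment> \<open>The parameter \<open>u\<close> lies strictly inside the window centred at
        \<open>t\<close>, so it is less than a period away from \<open>\<tau>\<close>.\<close>
      ultimately have "\<bar>of_int i :: real\<bar> < 1"
        using k(3) unfolding atLeastLessThan_iff abs_less_iff by linarith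
      then have "i = 0" by (simp flip: of_int_abs)
      then show ?thesis using kj i ut by simp
    qed
    have "emeasure \<sigma> ?B = (\<Sum>k<m. \<integral>\<^sup>+\<tau>. ennreal (norm (c' k \<tau>)) * indicator ?B (c k \<tau>) * indicator {?a k..<?a k + 1} \<tau> \<partial>lborel)"
      by (rule emeasure_arclength) auto
    also have "\<dots> \<le> (\<Sum>k<m. if k = j then (\<integral>\<^sup>+\<tau>. ennreal L * indicator {t - \<rho> / \<kappa>..t + \<rho> / \<kappa>} \<tau> \<partial>lborel) else 0)"
    proof (intro sum_mono)
      fix k assume k: "k \<in> {..<m}"
      show "(\<integral>\<^sup>+\<tau>. ennreal (norm (c' k \<tau>)) * indicator ?B (c k \<tau>) * indicator {?a k..<?a k + 1} \<tau> \<partial>lborel)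
        \<le> (if k = j then (\<integral>\<^sup>+\<tau>. ennreal L * indicator {t - \<rho> / \<kappa>..t + \<rho> / \<kappa>} \<tau> \<partial>lborel) else 0)"
      proof (cases "k = j")
        case True
        have "(\<integral>\<^sup>+\<tau>. ennreal (norm (c' k \<tau>)) * indicator ?B (c k \<tau>) * indicator {?a k..<?a k + 1} \<tau> \<partial>lborel)
          \<le> (\<integral>\<^sup>+\<tau>. ennreal L * indicator {t - \<rho> / \<kappa>..t + \<rho> / \<kappa>} \<tau> \<partial>lborel)"
        proof (intro nn_integral_mono)
          fix \<tau>
          show "ennreal (norm (c' k \<tau>)) * indicator ?B (c k \<tau>) * indicator {?a k..<?a k + 1} \<tau>
             \<le> ennreal L * indicator {t - \<rho> / \<kappa>..t + \<rho> / \<kappa>} \<tau>"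
          proof (cases "c k \<tau> \<in> ?B \<and> \<tau> \<in> {?a k..<?a k + 1}")
            case True
            then have "\<tau> \<in> {t - \<rho> / \<kappa>..t + \<rho> / \<kappa>}" using *[of k \<tau>] k by (auto simp: abs_le_iff)
            then show ?thesis using True L k by (auto intro!: ennreal_leI)
          next
            case False
            then show ?thesis by (auto simp: indicator_def)
          qed
        qed
        then show ?thesis using True by simp
      next
        case False
        have "ennreal (norm (c' k \<tau>)) * indicator ?B (c k \<tau>) * indicator {?a k..<?a k + 1} \<tau> = 0" for \<tau>
          using *[of k \<tau>] False k unfolding indicator_def by auto
        then have "(\<integral>\<^sup>+\<tau>. ennreal (norm (c' k \<tau>)) * indicator ?B (c k \<tau>) * indicator {?a k..<?a k + 1} \<tau> \<partial>lborel) = 0"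
          by (subst nn_integral_cong[where v="\<lambda>_. 0"]) (simp_all only: nn_integral_const mult_zero_left)
        then show ?thesis using False by simp
      qed
    qed
    also have "\<dots> = ennreal L * ennreal (2 * (\<rho> / \<kappa>))"
      using j \<rho> \<kappa> by (simp add: nn_integral_cmult)
    also have "\<dots> = ennreal (2 * L / \<kappa> * \<rho>)"
      using L \<rho> \<kappa> by (subst ennreal_mult[symmetric]) (auto simp: field_simps)
    also have "2 * L / \<kappa> * \<rho> \<le> A * \<rho>"
      unfolding A_def using L \<rho> \<kappa> by (intro mult_right_mono divide_right_mono) auto
    then have "ennreal (2 * L / \<kappa> * \<rho>) \<le> ennreal (A * \<rho>)" by (rule ennreal_leI)
    finally show ?thesis .
  qed
  moreover have "finite_measure \<sigma>"
    using finite_measure_\<sigma>[OF L] by (intro finite_measureI) (auto simp: top_unique)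
  ultimately have "ahlfors_upper \<sigma> A"
    using A sets_\<sigma> by (intro ahlfors_upper.intro ahlfors_upper_axioms.intro) auto
  then show ?thesis ..
qed

text \<open>The curve through one point of \<open>X\<close> and the union of the others are disjoint
  closed sets covering \<open>X\<close>.\<close>

lemma connected_subset_component:
  assumes X: "connected X" "X \<noteq> {}" "X \<subseteq> \<gamma>"
  shows "\<exists>j<m. X \<subseteq> range (c j)"
proof -
  obtain x where "x \<in> X" using X(2) by blast
  moreover then obtain j where "j < m" "x \<in> range (c j)"
    using X(3) unfolding curve_system_def by blast
  ultimately have j: "x \<in> X" "j < m" "x \<in> range (c j)" by blast+
  let ?Y = "\<Union>k\<in>{..<m} - {j}. range (c k)"
  have cl: "closed (range (c j))" "closed ?Y"
    using closed_curve.compact_range[OF curve] j(2) by (auto intro!: closed_UN compact_imp_closed)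
  have sub: "X \<subseteq> range (c j) \<union> ?Y" using X(3) by (auto simp: curve_system_def)
  have dj: "range (c j) \<inter> ?Y \<inter> X = {}"
    using same_component j(2) by fastforce
  have "range (c j) \<inter> X = {} \<or> ?Y \<inter> X = {}"
    by (rule connected_closedD[OF X(1) dj sub cl])
  then have "X \<subseteq> range (c j)" using j sub by blast
  then show ?thesis using j by blast
qed

text \<open>An \<open>arc\<close> comes with a merely continuous parametrisation. Only its image is
  kept, and described by the regular parametrisation of the boundary, for which speed bounds are
  available.\<close>

lemma arc_parametrisation:
  assumes "arc p" "path_image p \<subseteq> \<gamma>"
  shows "\<exists>j \<alpha> \<beta>. j < m \<and> \<alpha> \<le> \<beta> \<and> \<beta> \<le> \<alpha> + 1 \<and> path_image p = c j ` {\<alpha>..\<beta>}"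
proof -
  have p: "compact (path_image p)" "connected (path_image p)" "path_image p \<noteq> {}"
    using assms arc_imp_path by (auto intro: compact_path_image connected_path_image)
  obtain j where j: "j < m" "path_image p \<subseteq> range (c j)"
    using connected_subset_component[OF p(2,3) assms(2)] by blast
  then interpret closed_curve "c j" "c' j" by (intro curve) auto
  show ?thesis using connected_compact_eq_image_Icc[OF p j(2)] j(1) by blast
qed

text \<open>The speed is at least \<open>l\<close> on the period starting at
  \<open>\<alpha>\<close>, and the other curves only add nonnegative terms. This turns arc length
  into a bound for parameter length.\<close>

lemma emeasure_arclength_ge:
  assumes l: "0 < l" "\<And>t. l \<le> norm (c' j t)" and j: "j < m"
    and ab: "\<alpha> \<le> \<beta>" "\<beta> \<le> \<alpha> + 1" and B: "B \<in> sets borel"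
  shows "ennreal l * emeasure lborel ({\<alpha>..\<beta>} \<inter> c j -` B) \<le> emeasure \<sigma> (c j ` {\<alpha>..\<beta>} \<inter> B)"
proof -
  interpret closed_curve "c j" "c' j" using j by (rule curve)
  let ?X = "c j ` {\<alpha>..\<beta>} \<inter> B"
  have [measurable]: "c j \<in> borel_measurable borel" using j by (rule measurable_curve)
  have vm: "c j -` B \<in> sets borel"
    using measurable_sets[of "c j" borel borel B] B by simp
  have "c j ` {\<alpha>..\<beta>} \<in> sets borel"
    by (intro borel_compact compact_continuous_image cont) auto
  then have X: "?X \<in> sets borel" "?X \<subseteq> \<gamma>"
    using B j in_\<gamma> by auto
  have "ennreal l * emeasure lborel ({\<alpha>..\<beta>} \<inter> c j -` B)
      = (\<integral>\<^sup>+t. ennreal l * indicator ({\<alpha>..\<beta>} \<inter> c j -` B) t \<partial>lborel)"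
    using vm by (subst nn_integral_cmult_indicator) auto
  also have "\<dots> \<le> (\<integral>\<^sup>+t. ennreal (norm (c' j t)) * indicator ?X (c j t) * indicator {\<alpha>..<\<alpha> + 1} t \<partial>lborel)"
  proof (rule nn_integral_mono_AE)
    \<comment> \<open>If \<open>\<beta> = \<alpha> + 1\<close>, the half-open window misses
      \<open>\<beta>\<close>.\<close>
    have "AE t in lborel. t \<noteq> \<beta>" by (rule AE_lborel_singleton)
    then show "AE t in lborel. ennreal l * indicator ({\<alpha>..\<beta>} \<inter> c j -` B) t
      \<le> ennreal (norm (c' j t)) * indicator ?X (c j t) * indicator {\<alpha>..<\<alpha> + 1} t"
      by eventually_elim (use l ab in \<open>auto simp: indicator_def intro!: ennreal_leI\<close>)
  qed
  also have "\<dots> \<le> (\<Sum>j<m. \<integral>\<^sup>+t. ennreal (norm (c' j t)) * indicator ?X (c j t) * indicator {\<alpha>..<\<alpha> + 1} t \<partial>lborel)"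
    using j by (intro member_le_sum[where f="\<lambda>k. \<integral>\<^sup>+t. ennreal (norm (c' k t)) * indicator ?X (c k t) * indicator {\<alpha>..<\<alpha> + 1} t \<partial>lborel"]) auto
  also have "\<dots> = emeasure \<sigma> ?X"
    by (rule emeasure_arclength[OF X, of "\<lambda>_. \<alpha>", symmetric])
  finally show ?thesis .
qed

end

section \<open>P1 functions on triangulations\<close>

lemma triangle_interior_nonempty:
  fixes K :: "(real^2) set"
  assumes "2 simplex K"
  shows "interior K \<noteq> {}"
proof -
  have "aff_dim K = int DIM(real^2)" using aff_dim_simplex[OF assms] by simp
  then have "rel_interior K = interior K"
    by (intro rel_interior_interior affine_hull_UNIV)
  moreover have "K \<noteq> {}" using assms by auto
  ultimately show ?thesis
    using rel_interior_eq_empty[OF convex_simplex[OF assms]] by simp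
qed

text \<open>
  The interior hypothesis excludes the junk value \<open>diameter K / 0 = 0\<close>.
\<close>

lemma diameter_square_le_area:
  fixes K :: "(real^2) set"
  assumes K: "bounded K" "interior K \<noteq> {}" and ratio: "diameter K / inradius K \<le> \<kappa>"
  shows "0 < diameter K" "(diameter K)\<^sup>2 \<le> 4 * \<kappa>\<^sup>2 / pi * measure lebesgue (interior K)"
proof -
  let ?R = "{r. 0 \<le> r \<and> (\<exists>x. cball x r \<subseteq> K)}"
  have le_diam: "2 * r \<le> diameter K" if r: "r \<in> ?R" for r
  proof -
    obtain x where "0 \<le> r" "cball x r \<subseteq> K" using r by blast
    then show ?thesis using diameter_subset[OF _ K(1), of "cball x r"] by simp
  qed
  then have bdd: "bdd_above ?R"
    by (intro bdd_aboveI[where M="diameter K / 2"]) force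
  obtain x0 r0 where r0: "0 < r0" "cball x0 r0 \<subseteq> K"
    using K(2) mem_interior_cball by blast
  have "r0 \<le> inradius K"
    unfolding inradius_def using r0 by (intro cSup_upper bdd) auto
  then have inr: "0 < inradius K" using r0 by simp
  show d: "0 < diameter K" using le_diam[of r0] r0 by fastforce
  \<comment> \<open>A disc of more than half the inradius avoids the question whether the supremum
    is attained; it costs the factor 4 in the area bound.\<close>
  obtain r where r: "r \<in> ?R" "inradius K / 2 < r"
  proof -
    have "?R \<noteq> {}" using r0 by fastforce
    then have "\<exists>r\<in>?R. inradius K / 2 < r"
      using less_cSup_iff[OF _ bdd, of "inradius K / 2"] inr by (simp only: inradius_def) simp
    then show ?thesis using that by (elim bexE)
  qed
  then obtain x where x: "cball x r \<subseteq> K" by blast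
  have "0 < r" using r inr by linarith
  have "pi * r\<^sup>2 = measure lebesgue (ball x r)"
    using \<open>0 < r\<close> content_ball[of r x] by (simp add: unit_ball_vol_2)
  also have "\<dots> \<le> measure lebesgue (interior K)"
  proof (rule measure_mono_fmeasurable)
    show "ball x r \<subseteq> interior K"
      using x ball_subset_cball[of x r] by (intro interior_maximal) auto
    show "interior K \<in> lmeasurable"
      using K(1) by (intro lmeasurable_open bounded_interior open_interior)
  qed auto
  finally have area: "pi * r\<^sup>2 \<le> measure lebesgue (interior K)" .
  have "diameter K \<le> \<kappa> * inradius K" using ratio inr by (simp add: field_simps)
  moreover have "0 < \<kappa>" using less_le_trans[OF d calculation] inr by (rule zero_less_mult_pos2)
  ultimately have "diameter K \<le> \<kappa> * (2 * r)"
    using r(2) mult_left_mono[of "inradius K" "2 * r" \<kappa>] by linarith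
  then have "(diameter K)\<^sup>2 \<le> (\<kappa> * (2 * r))\<^sup>2" using d by (intro power_mono) auto
  also have "\<dots> = 4 * \<kappa>\<^sup>2 / pi * (pi * r\<^sup>2)" by (simp add: power_mult_distrib)
  also have "\<dots> \<le> 4 * \<kappa>\<^sup>2 / pi * measure lebesgue (interior K)"
    using area by (intro mult_left_mono) auto
  finally show "(diameter K)\<^sup>2 \<le> 4 * \<kappa>\<^sup>2 / pi * measure lebesgue (interior K)" .
qed

text \<open>By conformity the intersection is a face of both triangles, and a face that meets the
  interior is the whole triangle.\<close>

lemma triangulation_interiors_disjoint:
  assumes T: "triangulation \<T>" and KL: "K \<in> \<T>" "L \<in> \<T>" "x \<in> interior K" "x \<in> interior L"
  shows "K = L"
proof -
  have "K \<inter> L face_of K" "K \<inter> L face_of L"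
    using T KL unfolding triangulation_def by (metis, metis Int_commute)
  moreover have "x \<in> K \<inter> L" using KL interior_subset by blast
  ultimately have "K \<inter> L = K" "K \<inter> L = L"
    using KL(3,4) face_of_disjoint_interior[of "K \<inter> L" K] face_of_disjoint_interior[of "K \<inter> L" L] by blast+
  then show ?thesis by simp
qed

text \<open>Uniqueness of the derivative is what gives the description \<open>THE\<close> in
  \<open>grad\<close> its value.\<close>

lemma grad_eq_on_open:
  assumes "open U" "x \<in> U" and eq: "\<And>y. y \<in> U \<Longrightarrow> v y = a \<bullet> y + b"
  shows "grad v x = a"
proof -
  have "((\<lambda>y. a \<bullet> y + b) has_derivative (\<lambda>h. h \<bullet> a)) (at x)"
    by (auto intro!: derivative_eq_intros simp: inner_commute)
  then have D: "GDERIV v x :> a"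
    unfolding gderiv_def
    by (rule has_derivative_transform_within_open[OF _ assms(1,2)]) (simp add: eq)
  have "d = a" if "GDERIV v x :> d" for d
  proof -
    have "(\<lambda>h. h \<bullet> d) = (\<lambda>h. h \<bullet> a)"
      using that D unfolding gderiv_def by (rule has_derivative_unique)
    then have "(d - a) \<bullet> (d - a) = 0" by (metis inner_diff_right diff_self)
    then show ?thesis by simp
  qed
  then show ?thesis unfolding grad_def using D by blast
qed

text \<open>Off the triangle frontiers, which are negligible by convexity, each point of the domain
  lies in the interior of exactly one triangle, and there the squared gradient norm equals the step
  function \<open>G\<close>.\<close>

lemma H1_seminorm_P1:
  assumes T: "triangulates \<T> \<Omega>" and \<Omega>: "open \<Omega>" "convex \<Omega>"
    and v: "\<And>K x. K \<in> \<T> \<Longrightarrow> x \<in> K \<Longrightarrow> v x = a K \<bullet> x + b K"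
  shows "(H1_seminorm \<Omega> v)\<^sup>2 = (\<Sum>K\<in>\<T>. (norm (a K))\<^sup>2 * measure lebesgue (interior K))"
    (is "_ = ?E")
proof -
  have tri: "triangulation \<T>" and simp2: "\<And>K. K \<in> \<T> \<Longrightarrow> 2 simplex K" and Un: "\<Union>\<T> = closure \<Omega>"
    using T unfolding triangulates_def by auto
  have fin: "finite \<T>" using tri unfolding triangulation_def by blast
  define G where "G x = (\<Sum>K\<in>\<T>. (norm (a K))\<^sup>2 * indicator (interior K) x)" for x :: "real^2"
  define B where "B = (\<Union>K\<in>\<T>. frontier K)"
  have negB: "negligible B"
    unfolding B_def using fin simp2
    by (intro negligible_Union) (auto intro: negligible_convex_frontier convex_simplex)
  have lm: "interior K \<in> lmeasurable" if "K \<in> \<T>" for K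
    using compact_imp_bounded[OF compact_simplex[OF simp2[OF that]]]
    by (intro lmeasurable_open bounded_interior open_interior)
  have "(G has_integral ?E) UNIV"
    unfolding G_def using lm
    by (intro has_integral_sum fin has_integral_mult_right) (simp add: lmeasurable_iff_has_integral)
  moreover have G0: "G x = 0" if "x \<notin> closure \<Omega>" for x
    unfolding G_def using that Un interior_subset by (intro sum.neutral) (auto simp: indicator_def)
  then have "(\<lambda>x. if x \<in> closure \<Omega> then G x else 0) = G" by auto
  ultimately have "(G has_integral ?E) (closure \<Omega>)"
    using has_integral_restrict_UNIV[of "closure \<Omega>" G ?E] by simp
  \<comment> \<open>The triangles fill the closure while the seminorm integrates over the open set;
    the difference is the frontier.\<close>
  moreover have nf: "negligible (frontier \<Omega>)" using \<Omega>(2) by (rule negligible_convex_frontier)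
  have "negligible {x \<in> closure \<Omega> - \<Omega>. G x \<noteq> 0}"
    by (rule negligible_subset[OF nf]) (use \<Omega>(1) in \<open>auto simp: frontier_def interior_open\<close>)
  moreover have "negligible {x \<in> \<Omega> - closure \<Omega>. G x \<noteq> 0}"
    by (rule negligible_subset[OF negligible_empty]) (use closure_subset[of \<Omega>] in auto)
  ultimately have int: "(G has_integral ?E) \<Omega>"
    using has_integral_spike_set_eq by blast
  have G_nonneg: "0 \<le> G x" for x unfolding G_def by (intro sum_nonneg) auto
  have absG: "G absolutely_integrable_on \<Omega>"
    using int G_nonneg by (intro nonnegative_absolutely_integrable_1) auto
  have eq: "(norm (grad v x))\<^sup>2 = G x" if x: "x \<in> \<Omega> - B" for x
  proof -
    have "x \<in> \<Union>\<T>" unfolding Un using x closure_subset[of \<Omega>] by auto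
    then obtain K where K: "K \<in> \<T>" "x \<in> K" by (elim UnionE)
    then have xK: "x \<in> interior K"
      using x K closure_subset[of K] by (auto simp: B_def frontier_def)
    have "grad v x = a K"
      using xK v[OF K(1)] interior_subset by (intro grad_eq_on_open[of "interior K"]) auto
    moreover have "G x = (\<Sum>L\<in>\<T>. if L = K then (norm (a K))\<^sup>2 else 0)"
      unfolding G_def
    proof (rule sum.cong[OF refl])
      fix L assume "L \<in> \<T>"
      then have "L \<noteq> K \<Longrightarrow> x \<notin> interior L"
        using triangulation_interiors_disjoint[OF tri _ K(1) _ xK, of L] by blast
      then show "(norm (a L))\<^sup>2 * indicator (interior L) x = (if L = K then (norm (a K))\<^sup>2 else 0)"
        using xK by (cases "L = K") simp_all
    qed
    ultimately show ?thesis using fin K(1) by simp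
  qed
  have "(\<lambda>x. (norm (grad v x))\<^sup>2) absolutely_integrable_on \<Omega>"
    by (rule absolutely_integrable_spike[OF absG negB eq])
  then have "(LINT x:\<Omega>|lebesgue. (norm (grad v x))\<^sup>2) = integral \<Omega> (\<lambda>x. (norm (grad v x))\<^sup>2)"
    by (rule set_lebesgue_integral_eq_integral(2))
  also have "\<dots> = integral \<Omega> G"
    using integral_spike[OF negB, of \<Omega> "\<lambda>x. (norm (grad v x))\<^sup>2" G] eq by simp
  also have "\<dots> = ?E" using int by (rule integral_unique)
  finally have "H1_seminorm \<Omega> v = sqrt ?E" by (simp add: H1_seminorm_def)
  moreover have "0 \<le> ?E" by (intro sum_nonneg) auto
  ultimately show ?thesis by simp
qed

lemma unit_square_open_convex: "open unit_square" "convex unit_square"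
proof -
  have eq: "unit_square = box 0 1"
    by (auto simp: unit_square_def mem_box_cart)
  show "open unit_square" "convex unit_square" unfolding eq by auto
qed

text \<open>The sets are numbered, and each point is assigned to the set of least number containing
  it. For triangles this assigns a shared edge to a single triangle, so a boundary running along it
  is counted once.\<close>

lemma borel_disjoint_refinement:
  assumes fin: "finite \<T>" and borel: "\<And>K. K \<in> \<T> \<Longrightarrow> K \<in> sets borel"
  shows "\<exists>P. (\<forall>K\<in>\<T>. P K \<in> sets borel) \<and> (\<forall>K. P K \<subseteq> K) \<and> disjoint_family_on P \<T>
    \<and> (\<Union>K\<in>\<T>. P K) = \<Union>\<T>"
proof -
  obtain f :: "'a set \<Rightarrow> nat" where f: "inj_on f \<T>"
    using finite_imp_inj_to_nat_seg[OF fin] by blast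
  define P where "P K = K - \<Union>{L\<in>\<T>. f L < f K}" for K
  have 1: "P K \<in> sets borel" if "K \<in> \<T>" for K
    unfolding P_def using that borel fin by (intro sets.Diff sets.finite_Union) auto
  have 2: "P K \<subseteq> K" for K by (auto simp: P_def)
  have 3: "disjoint_family_on P \<T>"
    unfolding disjoint_family_on_def
  proof (intro ballI impI)
    fix K L assume KL: "K \<in> \<T>" "L \<in> \<T>" "K \<noteq> L"
    then have "f K < f L \<or> f L < f K" using f by (metis inj_onD linorder_neqE_nat)
    then show "P K \<inter> P L = {}" using KL by (auto simp: P_def)
  qed
  have "x \<in> (\<Union>K\<in>\<T>. P K)" if x: "x \<in> \<Union>\<T>" for x
  proof -
    obtain K0 where "K0 \<in> \<T>" "x \<in> K0" using x by blast
    then obtain K where K: "K \<in> \<T> \<and> x \<in> K" "\<And>L. L \<in> \<T> \<and> x \<in> L \<Longrightarrow> f K \<le> f L"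
      using ex_has_least_nat[of "\<lambda>K. K \<in> \<T> \<and> x \<in> K" K0 f] by blast
    then have "x \<in> P K" unfolding P_def by (auto simp: not_less[symmetric])
    then show ?thesis using K by blast
  qed
  then have "(\<Union>K\<in>\<T>. P K) = \<Union>\<T>" using 2 by blast
  then show ?thesis
    using 1 2 3 by (intro exI[of _ P]) simp
qed

section \<open>Sobolev norms of piecewise defined functions\<close>

locale ahlfors_plane = ahlfors_upper M A for M :: "(real^2) measure" and A
begin

lemma gagliardo_altdef:
  "gagliardo r w z = (w (snd z) - w (fst z))\<^sup>2 / dist (fst z) (snd z) powr (1 + 2 * r)"
  by (simp add: gagliardo_def case_prod_beta dist_norm norm_minus_commute)

lemma gagliardo_nonneg: "0 \<le> gagliardo r w z"
  by (simp add: gagliardo_altdef)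

lemma measurable_gagliardo [measurable]:
  assumes [measurable]: "w \<in> borel_measurable M"
  shows "gagliardo r w \<in> borel_measurable (M \<Otimes>\<^sub>M M)"
  unfolding gagliardo_altdef[abs_def] by measurable

lemma sobolev_spaceD:
  assumes "w \<in> sobolev_space M r"
  shows "w \<in> borel_measurable M" "integrable M (\<lambda>x. (w x)\<^sup>2)"
    "0 < r \<Longrightarrow> integrable (M \<Otimes>\<^sub>M M) (gagliardo r w)"
  using assms by (auto simp: sobolev_space_def)

lemma sobolev_space_add:
  assumes u: "u \<in> sobolev_space M r" and w: "w \<in> sobolev_space M r"
  shows "(\<lambda>x. u x + w x) \<in> sobolev_space M r"
proof -
  note [measurable] = sobolev_spaceD(1)[OF u] sobolev_spaceD(1)[OF w]
  have sq: "(a + b)\<^sup>2 \<le> 2 * a\<^sup>2 + 2 * b\<^sup>2" for a b :: real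
    using zero_le_power2[of "a - b"] by (simp add: power2_eq_square algebra_simps)
  have "integrable M (\<lambda>x. (u x + w x)\<^sup>2)"
  proof (rule Bochner_Integration.integrable_bound[where f="\<lambda>x. 2 * (u x)\<^sup>2 + 2 * (w x)\<^sup>2"])
    show "integrable M (\<lambda>x. 2 * (u x)\<^sup>2 + 2 * (w x)\<^sup>2)"
      using sobolev_spaceD(2)[OF u] sobolev_spaceD(2)[OF w] by auto
    have "norm ((u x + w x)\<^sup>2) \<le> norm (2 * (u x)\<^sup>2 + 2 * (w x)\<^sup>2)" for x
      using sq[of "u x" "w x"] by simp
    then show "AE x in M. norm ((u x + w x)\<^sup>2) \<le> norm (2 * (u x)\<^sup>2 + 2 * (w x)\<^sup>2)"
      by (rule AE_I2)
  qed measurable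
  moreover have "integrable (M \<Otimes>\<^sub>M M) (gagliardo r (\<lambda>x. u x + w x))" if r: "0 < r"
  proof (rule Bochner_Integration.integrable_bound[where f="\<lambda>z. 2 * gagliardo r u z + 2 * gagliardo r w z"])
    show "integrable (M \<Otimes>\<^sub>M M) (\<lambda>z. 2 * gagliardo r u z + 2 * gagliardo r w z)"
      using sobolev_spaceD(3)[OF u r] sobolev_spaceD(3)[OF w r] by auto
    have "gagliardo r (\<lambda>x. u x + w x) z \<le> 2 * gagliardo r u z + 2 * gagliardo r w z" for z
    proof -
      have "((u (snd z) + w (snd z)) - (u (fst z) + w (fst z)))\<^sup>2
        \<le> 2 * (u (snd z) - u (fst z))\<^sup>2 + 2 * (w (snd z) - w (fst z))\<^sup>2"
        using sq[of "u (snd z) - u (fst z)" "w (snd z) - w (fst z)"] by (simp add: algebra_simps)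
      from divide_right_mono[OF this, of "dist (fst z) (snd z) powr (1 + 2 * r)"]
      show ?thesis by (simp add: gagliardo_altdef add_divide_distrib)
    qed
    then show "AE z in M \<Otimes>\<^sub>M M. norm (gagliardo r (\<lambda>x. u x + w x) z) \<le> norm (2 * gagliardo r u z + 2 * gagliardo r w z)"
      by (auto simp: gagliardo_nonneg)
  qed measurable
  ultimately show ?thesis by (simp add: sobolev_space_def)
qed

lemma gagliardo_scale: "gagliardo r (\<lambda>x. a * w x) z = a\<^sup>2 * gagliardo r w z"
  by (simp add: gagliardo_altdef power_mult_distrib flip: right_diff_distrib)

lemma sobolev_space_scale:
  assumes w: "w \<in> sobolev_space M r"
  shows "(\<lambda>x. a * w x) \<in> sobolev_space M r" "sobolev_norm M r (\<lambda>x. a * w x) = \<bar>a\<bar> * sobolev_norm M r w"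
proof -
  note [measurable] = sobolev_spaceD(1)[OF w]
  show "(\<lambda>x. a * w x) \<in> sobolev_space M r"
    using sobolev_spaceD[OF w] by (auto simp: sobolev_space_def power_mult_distrib gagliardo_scale[abs_def])
  show "sobolev_norm M r (\<lambda>x. a * w x) = \<bar>a\<bar> * sobolev_norm M r w"
    by (simp add: sobolev_norm_def power_mult_distrib gagliardo_scale[abs_def] real_sqrt_mult distrib_left)
qed

lemma sobolev_norm_nonneg: "0 \<le> sobolev_norm M r w"
  unfolding sobolev_norm_def
  by (auto intro!: add_nonneg_nonneg Bochner_Integration.integral_nonneg gagliardo_nonneg)

text \<open>Membership in the dual bounds the values on the unit ball, so the real
  \<open>SUP\<close> is a genuine supremum; the rest is scaling.\<close>

lemma dual_norm_bound:
  assumes \<phi>: "\<phi> \<in> sobolev_dual M r"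
  shows "w \<in> sobolev_space M r \<Longrightarrow> \<bar>\<phi> w\<bar> \<le> dual_norm M r \<phi> * sobolev_norm M r w"
    and "0 \<le> dual_norm M r \<phi>"
proof -
  obtain B where "\<forall>w\<in>sobolev_space M r. \<bar>\<phi> w\<bar> \<le> B * sobolev_norm M r w"
    using \<phi> unfolding sobolev_dual_def mem_Collect_eq by (elim conjE exE)
  then have B: "\<And>w. w \<in> sobolev_space M r \<Longrightarrow> \<bar>\<phi> w\<bar> \<le> B * sobolev_norm M r w" by simp
  have scale: "\<phi> (\<lambda>x. a * w x) = a * \<phi> w" if "w \<in> sobolev_space M r" for a w
    using \<phi> that unfolding sobolev_dual_def by auto
  let ?U = "{w \<in> sobolev_space M r. sobolev_norm M r w \<le> 1}"
  have bdd: "bdd_above ((\<lambda>w. \<bar>\<phi> w\<bar>) ` ?U)"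
  proof (rule bdd_aboveI2)
    fix w assume w: "w \<in> ?U"
    have "\<bar>\<phi> w\<bar> \<le> B * sobolev_norm M r w" using B w by auto
    also have "\<dots> \<le> \<bar>B\<bar> * 1" using w sobolev_norm_nonneg by (intro mult_mono) auto
    finally show "\<bar>\<phi> w\<bar> \<le> \<bar>B\<bar>" by simp
  qed
  have upper: "\<bar>\<phi> w\<bar> \<le> dual_norm M r \<phi>" if "w \<in> ?U" for w
    unfolding dual_norm_def using that bdd by (rule cSUP_upper)
  have "(\<lambda>_. 0) \<in> ?U"
    by (simp add: sobolev_space_def sobolev_norm_def gagliardo_altdef[abs_def])
  from upper[OF this] show "0 \<le> dual_norm M r \<phi>" by linarith
  assume w: "w \<in> sobolev_space M r"
  show "\<bar>\<phi> w\<bar> \<le> dual_norm M r \<phi> * sobolev_norm M r w"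
  proof (cases "sobolev_norm M r w = 0")
    case True
    \<comment> \<open>Normalising is impossible here; the bound with \<open>B\<close> forces
      \<open>\<phi> w = 0\<close>.\<close>
    then show ?thesis using B[OF w] by simp
  next
    case False
    let ?s = "sobolev_norm M r w"
    have s: "0 < ?s" using False sobolev_norm_nonneg[of r w] by simp
    have "(\<lambda>x. inverse ?s * w x) \<in> ?U"
      using sobolev_space_scale[OF w, of "inverse ?s"] s by simp
    from upper[OF this] have "inverse ?s * \<bar>\<phi> w\<bar> \<le> dual_norm M r \<phi>"
      using s scale[OF w] by (simp add: abs_mult)
    then show ?thesis using s by (simp add: field_simps)
  qed
qed

text \<open>Functionals are additive only on the Sobolev space, so membership of the partial sums is
  carried through the induction.\<close>

lemma sobolev_dual_sum:
  assumes \<phi>: "\<phi> \<in> sobolev_dual M r" and w: "w \<in> sobolev_space M r"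
    and f: "\<And>i. i < (n::nat) \<Longrightarrow> f i \<in> sobolev_space M r"
  shows "\<phi> (\<lambda>x. w x + (\<Sum>i<n. b i * f i x)) = \<phi> w + (\<Sum>i<n. b i * \<phi> (f i))"
proof -
  have add: "\<phi> (\<lambda>x. u x + w x) = \<phi> u + \<phi> w" if "u \<in> sobolev_space M r" "w \<in> sobolev_space M r" for u w
    using \<phi> that unfolding sobolev_dual_def by auto
  have scale: "\<phi> (\<lambda>x. a * w x) = a * \<phi> w" if "w \<in> sobolev_space M r" for a w
    using \<phi> that unfolding sobolev_dual_def by auto
  have "k \<le> n \<Longrightarrow> (\<lambda>x. w x + (\<Sum>i<k. b i * f i x)) \<in> sobolev_space M r \<and>
     \<phi> (\<lambda>x. w x + (\<Sum>i<k. b i * f i x)) = \<phi> w + (\<Sum>i<k. b i * \<phi> (f i))" for k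
  proof (induction k)
    case 0
    then show ?case using w by simp
  next
    case (Suc k)
    let ?u = "\<lambda>x. w x + (\<Sum>i<k. b i * f i x)" and ?t = "\<lambda>x. b k * f k x"
    have IH: "?u \<in> sobolev_space M r" "\<phi> ?u = \<phi> w + (\<Sum>i<k. b i * \<phi> (f i))" using Suc by simp_all
    have fk: "f k \<in> sobolev_space M r" using f Suc.prems by simp
    have t: "?t \<in> sobolev_space M r" by (rule sobolev_space_scale(1)[OF fk])
    have eq: "(\<lambda>x. w x + (\<Sum>i<Suc k. b i * f i x)) = (\<lambda>x. ?u x + ?t x)" by (simp add: add.assoc)
    show ?case
      unfolding eq using sobolev_space_add[OF IH(1) t] add[OF IH(1) t] IH(2) scale[OF fk] by simp
  qed
  then show ?thesis by blast
qed

text \<open>The bounds for nonnegative extended integrals first give integrability, hence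
  membership, and then bound the Bochner integrals in the norm.\<close>

lemma sobolev_of_pieces:
  fixes r \<kappa> D :: real and I :: "'i set"
  assumes fin: "finite I" and S: "\<And>i. i \<in> I \<Longrightarrow> S i \<in> sets M"
    and cover: "AE x in M. x \<in> (\<Union>i\<in>I. S i)"
    and w [measurable]: "w \<in> borel_measurable M"
    and D: "0 < D" and \<kappa>: "0 < \<kappa>"
    and pq: "\<And>i. i \<in> I \<Longrightarrow> p i \<in> space M" "\<And>i. i \<in> I \<Longrightarrow> q i \<in> space M"
    and dist_p: "\<And>i x. i \<in> I \<Longrightarrow> x \<in> S i \<Longrightarrow> dist x (p i) \<le> D"
    and dist_q: "\<And>i x. i \<in> I \<Longrightarrow> x \<in> S i \<Longrightarrow> dist x (q i) \<le> D"
    and e: "\<And>i. i \<in> I \<Longrightarrow> 0 \<le> e i"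
    and w_bound: "\<And>i x. i \<in> I \<Longrightarrow> x \<in> S i \<Longrightarrow> (w x)\<^sup>2 \<le> D * e i"
    and r: "0 \<le> r" "r < 1 / 2"
    and near: "\<And>i j x y. i \<in> I \<Longrightarrow> j \<in> I \<Longrightarrow> x \<in> S i \<Longrightarrow> y \<in> S j \<Longrightarrow>
       dist x y < \<kappa> * min (dist x (p i)) (dist x (q i)) \<Longrightarrow> (w y - w x)\<^sup>2 \<le> dist x y * e i"
  shows "w \<in> sobolev_space M r"
    and "sobolev_norm M r w \<le> sqrt (A * D\<^sup>2 * (\<Sum>i\<in>I. e i))
      + (if r = 0 then 0 else sqrt (gagliardo_const r \<kappa> * D powr (2 - 2 * r) * (\<Sum>i\<in>I. e i)))"
proof -
  have E: "0 \<le> (\<Sum>i\<in>I. e i)" using e by (intro sum_nonneg)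
  have L2: "(\<integral>\<^sup>+x. ennreal ((w x)\<^sup>2) \<partial>M) \<le> ennreal (A * D\<^sup>2 * (\<Sum>i\<in>I. e i))"
    by (rule nn_integral_square_le[OF fin S cover w D \<kappa> pq dist_p dist_q e w_bound])
  have G: "(\<integral>\<^sup>+z. ennreal (gagliardo r w z) \<partial>(M \<Otimes>\<^sub>M M))
     \<le> ennreal (gagliardo_const r \<kappa> * D powr (2 - 2 * r) * (\<Sum>i\<in>I. e i))" if "0 < r"
    unfolding gagliardo_altdef
    by (rule nn_integral_gagliardo_le[OF fin S cover w D \<kappa> pq dist_p dist_q e w_bound that r(2) near])
  have 1: "integrable M (\<lambda>x. (w x)\<^sup>2)"
    using le_less_trans[OF L2 ennreal_less_top] by (intro integrableI_nonneg) auto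
  have 2: "integrable (M \<Otimes>\<^sub>M M) (gagliardo r w)" if "0 < r"
    using le_less_trans[OF G[OF that] ennreal_less_top]
    by (intro integrableI_nonneg) (auto simp: gagliardo_nonneg)
  show "w \<in> sobolev_space M r" using 1 2 w by (simp add: sobolev_space_def)
  have "(LINT x|M. (w x)\<^sup>2) \<le> A * D\<^sup>2 * (\<Sum>i\<in>I. e i)"
    using A_pos D E by (intro integral_real_bounded L2) auto
  moreover have "(LINT z|(M \<Otimes>\<^sub>M M). gagliardo r w z) \<le> gagliardo_const r \<kappa> * D powr (2 - 2 * r) * (\<Sum>i\<in>I. e i)"
    if "0 < r"
    using gagliardo_const_nonneg[OF that r(2)] E by (intro integral_real_bounded G that) auto
  ultimately show "sobolev_norm M r w \<le> sqrt (A * D\<^sup>2 * (\<Sum>i\<in>I. e i))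
      + (if r = 0 then 0 else sqrt (gagliardo_const r \<kappa> * D powr (2 - 2 * r) * (\<Sum>i\<in>I. e i)))"
    using r(1) by (auto simp: sobolev_norm_def intro!: add_mono)
qed

end

section \<open>Variation of a P1 function along an arc\<close>

context boundary_curves begin

text \<open>On the parameters of \<open>P K\<close> the function is
  \<open>a K \<bullet> c j t + b K\<close>, with derivative at most \<open>norm (a K) * L\<close>;
  converting parameter length into arc length costs \<open>1 / l\<close>. The sum is taken over the
  whole arc so that it does not depend on \<open>t\<close> and \<open>u\<close>.\<close>

lemma arc_square_diff_le:
  assumes l: "0 < l" "\<And>t. l \<le> norm (c' j t)" "\<And>t. norm (c' j t) \<le> L"
    and fm: "finite_measure \<sigma>"
    and j: "j < m" and ab: "\<alpha> \<le> \<beta>" "\<beta> \<le> \<alpha> + 1" and tu: "t \<in> {\<alpha>..\<beta>}" "u \<in> {\<alpha>..\<beta>}"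
    and fin: "finite \<T>" and P: "\<And>K. K \<in> \<T> \<Longrightarrow> P K \<in> sets borel" and disj: "disjoint_family_on P \<T>"
    and cover: "\<gamma> \<subseteq> (\<Union>K\<in>\<T>. P K)"
    and v: "continuous_on \<gamma> v" "\<And>K x. K \<in> \<T> \<Longrightarrow> x \<in> P K \<Longrightarrow> v x = a K \<bullet> x + b K"
  shows "(v (c j u) - v (c j t))\<^sup>2
    \<le> \<bar>u - t\<bar> * (L\<^sup>2 / l * (\<Sum>K\<in>\<T>. (norm (a K))\<^sup>2 * measure \<sigma> (c j ` {\<alpha>..\<beta>} \<inter> P K)))"
proof -
  interpret closed_curve "c j" "c' j" using j by (rule curve)
  interpret finite_measure \<sigma> by (rule fm)
  let ?m = "\<lambda>K. measure \<sigma> (c j ` {\<alpha>..\<beta>} \<inter> P K)"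
  have [measurable]: "c j \<in> borel_measurable borel" using j by (rule measurable_curve)
  have vm: "c j -` P K \<in> sets borel" if "K \<in> \<T>" for K
    using measurable_sets[of "c j" borel borel "P K"] P[OF that] by simp
  have meas: "measure lborel ({t..u} \<inter> c j -` P K) \<le> ?m K / l"
    if K: "K \<in> \<T>" and tu: "\<alpha> \<le> t" "u \<le> \<beta>" for t u K
  proof -
    have "ennreal l * emeasure lborel ({t..u} \<inter> c j -` P K) \<le> ennreal l * emeasure lborel ({\<alpha>..\<beta>} \<inter> c j -` P K)"
      using vm[OF K] tu by (intro mult_left_mono emeasure_mono) auto
    also have "\<dots> \<le> emeasure \<sigma> (c j ` {\<alpha>..\<beta>} \<inter> P K)"
      by (rule emeasure_arclength_ge[OF l(1,2) j ab P[OF K]])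
    also have "\<dots> = ennreal (?m K)" by (rule emeasure_eq_measure)
    finally have "ennreal l * emeasure lborel ({t..u} \<inter> c j -` P K) \<le> ennreal (?m K)" .
    moreover have "emeasure lborel ({t..u} \<inter> c j -` P K) = ennreal (measure lborel ({t..u} \<inter> c j -` P K))"
    proof (rule emeasure_eq_ennreal_measure)
      have "emeasure lborel ({t..u} \<inter> c j -` P K) \<le> emeasure lborel (cbox t u)"
        using vm[OF K] by (intro emeasure_mono) auto
      also have "\<dots> < \<infinity>" by (rule emeasure_lborel_cbox_finite)
      finally show "emeasure lborel ({t..u} \<inter> c j -` P K) \<noteq> top" by simp
    qed
    ultimately have "ennreal (l * measure lborel ({t..u} \<inter> c j -` P K)) \<le> ennreal (?m K)"
      using l(1) by (simp add: ennreal_mult)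
    then have "l * measure lborel ({t..u} \<inter> c j -` P K) \<le> ?m K"
      by (subst (asm) ennreal_le_iff) auto
    then show ?thesis using l(1) by (simp add: field_simps)
  qed
  have L: "0 \<le> L" using l(3)[of 0] norm_ge_zero order_trans by blast
  have main: "(v (c j u) - v (c j t))\<^sup>2 \<le> (u - t) * (L\<^sup>2 / l * (\<Sum>K\<in>\<T>. (norm (a K))\<^sup>2 * ?m K))"
    if tu: "\<alpha> \<le> t" "t \<le> u" "u \<le> \<beta>" for t u
  proof -
    have "(v (c j u) - v (c j t))\<^sup>2 \<le> (u - t) *
       (\<Sum>K\<in>\<T>. (norm (a K) * L)\<^sup>2 * measure lborel ({t..u} \<inter> c j -` P K))"
    proof (rule square_diff_le_sum_pieces[where f="\<lambda>t. v (c j t)" and G="\<lambda>K t. a K \<bullet> c j t + b K" and G'="\<lambda>K t. a K \<bullet> c' j t"])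
      show "continuous_on {t..u} (\<lambda>t. v (c j t))"
        using j by (intro continuous_on_compose2[OF v(1) cont]) (auto simp: in_\<gamma>)
      show "{t..u} = (\<Union>K\<in>\<T>. {t..u} \<inter> c j -` P K)"
        using subsetD[OF cover in_\<gamma>[OF j]] by auto
      show "disjoint_family_on (\<lambda>K. {t..u} \<inter> c j -` P K) \<T>"
        using disj unfolding disjoint_family_on_def by blast
      show "((\<lambda>t. a K \<bullet> c j t + b K) has_real_derivative a K \<bullet> c' j s) (at s)" for K s
        using deriv[of s] unfolding has_vector_derivative_def has_field_derivative_def
        by (auto intro!: derivative_eq_intros simp: mult.commute)
      show "continuous_on UNIV (\<lambda>t. a K \<bullet> c' j t)" for K
        by (intro continuous_on_inner continuous_on_const cont_deriv)
      show "\<bar>a K \<bullet> c' j s\<bar> \<le> norm (a K) * L" for K s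
      proof -
        have "\<bar>a K \<bullet> c' j s\<bar> \<le> norm (a K) * norm (c' j s)" by (rule Cauchy_Schwarz_ineq2)
        also have "\<dots> \<le> norm (a K) * L" using l(3) by (intro mult_left_mono) auto
        finally show ?thesis .
      qed
    qed (use fin tu vm v(2) in auto)
    also have "\<dots> \<le> (u - t) * (\<Sum>K\<in>\<T>. (norm (a K) * L)\<^sup>2 * (?m K / l))"
      using tu by (intro mult_left_mono sum_mono meas) auto
    also have "(\<Sum>K\<in>\<T>. (norm (a K) * L)\<^sup>2 * (?m K / l)) = L\<^sup>2 / l * (\<Sum>K\<in>\<T>. (norm (a K))\<^sup>2 * ?m K)"
      by (simp add: sum_distrib_left power_mult_distrib mult_ac)
    finally show ?thesis .
  qed
  show ?thesis
  proof (cases "t \<le> u")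
    case True
    then show ?thesis using main[of t u] tu by simp
  next
    case False
    then show ?thesis using main[of u t] tu by (simp add: power2_commute)
  qed
qed

end

section \<open>Interpolation by piecewise constants on arcs\<close>

text \<open>Unless the intersection is empty, a ball around one of its points, with radius the
  diameter, contains it; the centre is then on the boundary, as linear growth requires.\<close>

lemma (in boundary_curves) measure_triangle_le:
  assumes ah: "ahlfors_upper \<sigma> A" and K: "bounded K" "0 < diameter K" "B \<subseteq> K" "B \<in> sets borel"
  shows "measure \<sigma> (\<gamma> \<inter> B) \<le> A * diameter K"
proof -
  interpret ahlfors_upper \<sigma> A by (rule ah)
  show ?thesis
  proof (cases "\<gamma> \<inter> B = {}")
    case True
    then show ?thesis using K A_pos by simp
  next
    case False
    then obtain x where x: "x \<in> \<gamma>" "x \<in> B" by blast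
    have "\<gamma> \<inter> B \<subseteq> \<gamma> \<inter> cball x (diameter K)"
    proof
      fix y assume y: "y \<in> \<gamma> \<inter> B"
      then have "dist x y \<le> diameter K"
        using x K(3) by (intro diameter_bounded_bound[OF K(1)]) auto
      then show "y \<in> \<gamma> \<inter> cball x (diameter K)" using y by simp
    qed
    then have "emeasure \<sigma> (\<gamma> \<inter> B) \<le> emeasure \<sigma> (\<gamma> \<inter> cball x (diameter K))"
      by (intro emeasure_mono) (auto intro!: in_sets_\<sigma>)
    also have "\<dots> \<le> ennreal (A * diameter K)"
      using emeasure_cball_le[of x "diameter K"] x K by simp
    finally show ?thesis
      using A_pos K by (simp add: emeasure_eq_measure)
  qed
qed

text \<open>One partition of the boundary, with the arc \<open>i\<close> described by a parameter
  interval of the curve \<open>J i\<close>. By the speed bound, \<open>D\<close> dominates the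
  lengths of all arcs.\<close>

locale arc_mesh = boundary_curves m c + S: ahlfors_plane "arclength m c" A
  for m c A +
  fixes n :: nat and g :: "nat \<Rightarrow> real \<Rightarrow> real^2" and L \<kappa> D :: real
    and J :: "nat \<Rightarrow> nat" and \<alpha> \<beta> :: "nat \<Rightarrow> real"
  assumes L: "0 < L" and speed: "\<And>j t. j < m \<Longrightarrow> norm (c' j t) \<le> L"
    and \<kappa>: "0 < \<kappa>"
    and chord: "\<And>j t y. j < m \<Longrightarrow> y \<in> \<gamma> \<Longrightarrow> dist (c j t) y < \<kappa> \<Longrightarrow>
        \<exists>u. y = c j u \<and> \<kappa> * \<bar>u - t\<bar> \<le> dist (c j t) y"
    and part: "arc_partition \<gamma> n g"
    and D: "0 < D"
    and J: "\<And>i. i < n \<Longrightarrow> J i < m"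
    and ab: "\<And>i. i < n \<Longrightarrow> \<alpha> i \<le> \<beta> i" "\<And>i. i < n \<Longrightarrow> \<beta> i \<le> \<alpha> i + 1"
    and image: "\<And>i. i < n \<Longrightarrow> path_image (g i) = c (J i) ` {\<alpha> i..\<beta> i}"
    and D_ge: "\<And>i. i < n \<Longrightarrow> L * (\<beta> i - \<alpha> i) \<le> D"
begin

abbreviation \<Gamma> :: "nat \<Rightarrow> (real^2) set" where "\<Gamma> i \<equiv> path_image (g i)"

definition endpoints :: "(real^2) set" where
  "endpoints = (\<Union>i<n. {pathstart (g i), pathfinish (g i)})"

text \<open>The same finite set is removed from every arc: the pieces become disjoint, with a single
  exceptional null set.\<close>

definition piece :: "nat \<Rightarrow> (real^2) set" where
  "piece i = \<Gamma> i - endpoints"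

lemma \<Gamma>_sub: "i < n \<Longrightarrow> \<Gamma> i \<subseteq> \<gamma>"
  using part unfolding arc_partition_def by blast

lemma \<Gamma>_cover: "(\<Union>i<n. \<Gamma> i) = \<gamma>"
  using part unfolding arc_partition_def by blast

lemma borel_\<Gamma>: "i < n \<Longrightarrow> \<Gamma> i \<in> sets borel"
  using part unfolding arc_partition_def
  by (intro borel_closed closed_path_image arc_imp_path) blast

lemma finite_endpoints: "finite endpoints"
  by (simp add: endpoints_def)

lemma endpoints_sub: "endpoints \<subseteq> \<gamma>"
  using \<Gamma>_sub pathstart_in_path_image pathfinish_in_path_image unfolding endpoints_def by blast

lemma piece_unique: "i < n \<Longrightarrow> k < n \<Longrightarrow> x \<in> piece i \<Longrightarrow> x \<in> \<Gamma> k \<Longrightarrow> k = i"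
  using part unfolding arc_partition_def piece_def endpoints_def by blast

lemma piece_sets: "i < n \<Longrightarrow> piece i \<in> sets \<sigma>"
  unfolding piece_def using \<Gamma>_sub finite_endpoints
  by (intro in_sets_\<sigma> sets.Diff borel_\<Gamma>) (auto intro: borel_closed finite_imp_closed)

lemma AE_no_endpoint: "AE x in \<sigma>. x \<notin> endpoints"
proof -
  have "AE x in \<sigma>. \<forall>z\<in>endpoints. x \<noteq> z"
    using finite_endpoints endpoints_sub
    by (subst AE_ball_countable) (auto intro!: S.AE_neq countable_finite)
  then show ?thesis by eventually_elim auto
qed

lemma AE_piece: "AE x in \<sigma>. x \<in> (\<Union>i\<in>{..<n}. piece i)"
proof -
  have "AE x in \<sigma>. x \<in> \<gamma>" using AE_space[of \<sigma>] by simp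
  with AE_no_endpoint show ?thesis
    by eventually_elim (use \<Gamma>_cover in \<open>auto simp: piece_def\<close>)
qed

lemma dist_param: "i < n \<Longrightarrow> dist (c (J i) u) (c (J i) t) \<le> L * \<bar>u - t\<bar>"
  using closed_curve.lipschitz[OF curve[OF J] speed[OF J]] by (simp add: dist_norm)

text \<open>The distance from \<open>c (J i) t\<close> to the image of an end \<open>s\<close> is at
  most \<open>L * \<bar>t - s\<bar>\<close>. The hypothesis therefore puts \<open>y\<close> within
  \<open>\<kappa> * \<bar>t - s\<bar>\<close>, and the chord-arc bound gives a parameter of
  \<open>y\<close> closer to \<open>t\<close> than either end is.\<close>

lemma near_param:
  assumes i: "i < n" and t: "t \<in> {\<alpha> i..\<beta> i}" and y: "y \<in> \<gamma>"
    and near: "dist (c (J i) t) y < \<kappa> / L * min (dist (c (J i) t) (c (J i) (\<alpha> i))) (dist (c (J i) t) (c (J i) (\<beta> i)))"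
  shows "\<exists>u\<in>{\<alpha> i..\<beta> i}. y = c (J i) u \<and> \<kappa> * \<bar>u - t\<bar> \<le> dist (c (J i) t) y"
proof -
  let ?x = "c (J i) t"
  have *: "dist ?x y < \<kappa> * \<bar>t - s\<bar>" if "s = \<alpha> i \<or> s = \<beta> i" for s
  proof -
    note near
    also have "\<kappa> / L * min (dist ?x (c (J i) (\<alpha> i))) (dist ?x (c (J i) (\<beta> i))) \<le> \<kappa> / L * dist ?x (c (J i) s)"
      using that \<kappa> L by (intro mult_left_mono) auto
    also have "\<dots> \<le> \<kappa> / L * (L * \<bar>t - s\<bar>)"
      using \<kappa> L dist_param[OF i, of t s] by (intro mult_left_mono) auto
    finally show ?thesis using L by simp
  qed
  have "\<kappa> * \<bar>t - \<alpha> i\<bar> \<le> \<kappa> * 1" using t ab[OF i] \<kappa> by (intro mult_left_mono) auto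
  then have "dist ?x y < \<kappa>" using *[of "\<alpha> i"] by simp
  then obtain u where u: "y = c (J i) u" "\<kappa> * \<bar>u - t\<bar> \<le> dist ?x y"
    using chord[OF J[OF i] y] by blast
  have "\<kappa> * \<bar>u - t\<bar> < \<kappa> * \<bar>t - \<alpha> i\<bar>" "\<kappa> * \<bar>u - t\<bar> < \<kappa> * \<bar>t - \<beta> i\<bar>"
    using u(2) *[of "\<alpha> i"] *[of "\<beta> i"] by auto
  then have "\<bar>u - t\<bar> < \<bar>t - \<alpha> i\<bar>" "\<bar>u - t\<bar> < \<bar>t - \<beta> i\<bar>" using \<kappa> by auto
  then have "u \<in> {\<alpha> i..\<beta> i}" using t by auto
  then show ?thesis using u by blast
qed

text \<open>The images of the parameter ends serve as reference points \<open>p i\<close> and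
  \<open>q i\<close>. By \<open>near_param\<close>, pairs meeting the distance condition lie on one
  arc, so the difference bound is asked only of two parameters of the same interval.\<close>

lemma sobolev_of_arcs:
  assumes w: "w \<in> borel_measurable \<sigma>" and r: "0 \<le> r" "r < 1 / 2"
    and e: "\<And>i. i < n \<Longrightarrow> 0 \<le> e i"
    and w_bound: "\<And>i x. i < n \<Longrightarrow> x \<in> piece i \<Longrightarrow> (w x)\<^sup>2 \<le> D * e i"
    and near: "\<And>i t u. i < n \<Longrightarrow> t \<in> {\<alpha> i..\<beta> i} \<Longrightarrow> u \<in> {\<alpha> i..\<beta> i} \<Longrightarrow>
       c (J i) t \<in> piece i \<Longrightarrow> c (J i) u \<in> piece i \<Longrightarrow>
       (w (c (J i) u) - w (c (J i) t))\<^sup>2 \<le> \<kappa> * \<bar>u - t\<bar> * e i"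
  shows "w \<in> sobolev_space \<sigma> r"
    and "sobolev_norm \<sigma> r w \<le> sqrt (A * D\<^sup>2 * (\<Sum>i<n. e i))
      + (if r = 0 then 0 else sqrt (S.gagliardo_const r (\<kappa> / L) * D powr (2 - 2 * r) * (\<Sum>i<n. e i)))"
proof -
  let ?p = "\<lambda>i. c (J i) (\<alpha> i)" and ?q = "\<lambda>i. c (J i) (\<beta> i)"
  have pq: "?p i \<in> space \<sigma>" "?q i \<in> space \<sigma>" if "i \<in> {..<n}" for i
    using that J in_\<gamma> by auto
  have d: "dist x (?p i) \<le> D \<and> dist x (?q i) \<le> D" if i: "i \<in> {..<n}" and x: "x \<in> piece i" for i x
  proof -
    have "x \<in> c (J i) ` {\<alpha> i..\<beta> i}" using x image i by (auto simp: piece_def)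
    then obtain t where t: "x = c (J i) t" "t \<in> {\<alpha> i..\<beta> i}" by (rule imageE)
    have "L * \<bar>t - \<alpha> i\<bar> \<le> L * (\<beta> i - \<alpha> i)" "L * \<bar>t - \<beta> i\<bar> \<le> L * (\<beta> i - \<alpha> i)"
      using t(2) L by (auto intro!: mult_left_mono)
    then show ?thesis
      using dist_param[of i t "\<alpha> i"] dist_param[of i t "\<beta> i"] D_ge[of i] i t(1) by auto
  qed
  have nr: "(w y - w x)\<^sup>2 \<le> dist x y * e i"
    if i: "i \<in> {..<n}" and j: "j \<in> {..<n}" and x: "x \<in> piece i" and y: "y \<in> piece j"
      and d: "dist x y < \<kappa> / L * min (dist x (?p i)) (dist x (?q i))" for i j x y
  proof -
    have "x \<in> c (J i) ` {\<alpha> i..\<beta> i}" using x image i by (auto simp: piece_def)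
    then obtain t where t: "x = c (J i) t" "t \<in> {\<alpha> i..\<beta> i}" by (rule imageE)
    have "y \<in> \<gamma>" using y j \<Gamma>_sub by (auto simp: piece_def)
    then obtain u where u: "u \<in> {\<alpha> i..\<beta> i}" "y = c (J i) u" "\<kappa> * \<bar>u - t\<bar> \<le> dist x y"
      using near_param[of i t y] i t d by auto
    \<comment> \<open>\<open>y\<close> was given on \<open>piece j\<close>; it is no endpoint and
      lies on the arc \<open>i\<close>, hence in \<open>piece i\<close>.\<close>
    have "y \<in> piece i"
      using y u image i by (auto simp: piece_def)
    then have "(w y - w x)\<^sup>2 \<le> \<kappa> * \<bar>u - t\<bar> * e i"
      using near[of i t u] i t u x by auto
    also have "\<dots> \<le> dist x y * e i" using u(3) e i by (intro mult_right_mono) auto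
    finally show ?thesis .
  qed
  have \<kappa>L: "0 < \<kappa> / L" using \<kappa> L by simp
  have ps: "piece i \<in> sets \<sigma>" if "i \<in> {..<n}" for i using that piece_sets by simp
  have e': "0 \<le> e i" if "i \<in> {..<n}" for i using that e by simp
  have wb: "(w x)\<^sup>2 \<le> D * e i" if "i \<in> {..<n}" "x \<in> piece i" for i x using that w_bound by simp
  have dp: "dist x (?p i) \<le> D" if "i \<in> {..<n}" "x \<in> piece i" for i x using d[OF that] by simp
  have dq: "dist x (?q i) \<le> D" if "i \<in> {..<n}" "x \<in> piece i" for i x using d[OF that] by simp
  show "w \<in> sobolev_space \<sigma> r"
    by (rule S.sobolev_of_pieces(1)[OF finite_lessThan ps AE_piece w D \<kappa>L pq dp dq e' wb r nr])
  show "sobolev_norm \<sigma> r w \<le> sqrt (A * D\<^sup>2 * (\<Sum>i<n. e i))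
      + (if r = 0 then 0 else sqrt (S.gagliardo_const r (\<kappa> / L) * D powr (2 - 2 * r) * (\<Sum>i<n. e i)))"
    by (rule S.sobolev_of_pieces(2)[OF finite_lessThan ps AE_piece w D \<kappa>L pq dp dq e' wb r nr])
qed

text \<open>An indicator of an arc is constant on every piece, so its differences there vanish;
  \<open>1 / D\<close> is chosen to make \<open>D * e i = 1\<close>. Membership lets
  \<open>\<phi>\<close> act linearly on the interpolant.\<close>

lemma indicator_in_sobolev_space:
  assumes k: "k < n" and r: "0 \<le> r" "r < 1 / 2"
  shows "indicat_real (\<Gamma> k) \<in> sobolev_space \<sigma> r"
proof (rule sobolev_of_arcs(1)[where e="\<lambda>_. 1 / D"])
  show "indicat_real (\<Gamma> k) \<in> borel_measurable \<sigma>"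
    using borel_\<Gamma>[OF k] by (intro S.borel_measurableI borel_measurable_indicator)
  show "(indicat_real (\<Gamma> k) (c (J i) u) - indicat_real (\<Gamma> k) (c (J i) t))\<^sup>2 \<le> \<kappa> * \<bar>u - t\<bar> * (1 / D)"
    if i: "i < n" and p: "c (J i) t \<in> piece i" "c (J i) u \<in> piece i" for i t u
  proof -
    have "c (J i) t \<in> \<Gamma> k \<longleftrightarrow> c (J i) u \<in> \<Gamma> k"
      using piece_unique[OF i k p(1)] piece_unique[OF i k p(2)] p by (auto simp: piece_def)
    then show ?thesis using \<kappa> D by (simp add: indicator_def)
  qed
qed (use D r in \<open>auto simp: indicator_def\<close>)

text \<open>The finite element function enters only through measurability and the squared Hoelder
  constants \<open>\<epsilon> i\<close>, so this part does not see the triangulation of the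
  square.\<close>

lemma interpolation_error:
  assumes v: "v \<in> borel_measurable \<sigma>" and r: "0 \<le> r" "r < 1 / 2"
    and \<epsilon>: "\<And>i. i < n \<Longrightarrow> 0 \<le> \<epsilon> i"
    and v_diff: "\<And>i t u. i < n \<Longrightarrow> t \<in> {\<alpha> i..\<beta> i} \<Longrightarrow> u \<in> {\<alpha> i..\<beta> i} \<Longrightarrow>
       (v (c (J i) u) - v (c (J i) t))\<^sup>2 \<le> \<bar>u - t\<bar> * \<epsilon> i"
    and x: "\<And>i. i < n \<Longrightarrow> x i \<in> \<Gamma> i"
    and \<phi>: "\<phi> \<in> sobolev_dual \<sigma> r"
  defines "E \<equiv> (1 / L + 1 / \<kappa>) * (\<Sum>i<n. \<epsilon> i)"
  shows "\<bar>\<phi> v - dirac_approx n g x \<phi> v\<bar> \<le> dual_norm \<sigma> r \<phi> * (sqrt (A * D\<^sup>2 * E)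
      + (if r = 0 then 0 else sqrt (S.gagliardo_const r (\<kappa> / L) * D powr (2 - 2 * r) * E)))"
proof -
  define w where "w y = v y - (\<Sum>i<n. v (x i) * indicat_real (\<Gamma> i) y)" for y
  \<comment> \<open>Two demands are met at once: \<open>1 / L\<close> gives
    \<open>(w y)\<^sup>2 \<le> D * e i\<close>, as parameters on an arc differ by at most
    \<open>D / L\<close>, and \<open>1 / \<kappa>\<close> gives
    \<open>\<epsilon> i \<le> \<kappa> * e i\<close> for the difference bound.\<close>
  define e where "e i = (1 / L + 1 / \<kappa>) * \<epsilon> i" for i
  have sum_e: "(\<Sum>i<n. e i) = E" by (simp add: e_def E_def sum_distrib_left)
  have w_piece: "w y = v y - v (x i)" if i: "i < n" and y: "y \<in> piece i" for i y
  proof -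
    have "(\<Sum>k<n. v (x k) * indicat_real (\<Gamma> k) y) = (\<Sum>k<n. if k = i then v (x i) else 0)"
    proof (rule sum.cong[OF refl])
      fix k assume k: "k \<in> {..<n}"
      have "y \<in> \<Gamma> i" using y by (simp add: piece_def)
      moreover have "k \<noteq> i \<Longrightarrow> y \<notin> \<Gamma> k" using piece_unique[OF i _ y, of k] k by blast
      ultimately show "v (x k) * indicat_real (\<Gamma> k) y = (if k = i then v (x i) else 0)"
        by (cases "k = i") simp_all
    qed
    then show ?thesis using i by (simp add: w_def)
  qed
  have "(\<lambda>y. indicat_real (\<Gamma> i) y) \<in> borel_measurable \<sigma>" if "i < n" for i
    using borel_\<Gamma>[OF that] by (intro S.borel_measurableI borel_measurable_indicator)
  then have w_meas: "w \<in> borel_measurable \<sigma>"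
    unfolding w_def using v by (intro borel_measurable_diff borel_measurable_sum borel_measurable_times) auto
  have e_nonneg: "0 \<le> e i" if "i < n" for i using \<epsilon>[OF that] L \<kappa> by (simp add: e_def)
  have param: "\<exists>t\<in>{\<alpha> i..\<beta> i}. y = c (J i) t" if "i < n" "y \<in> \<Gamma> i" for i y
    using that image by auto
  have bound: "(w y)\<^sup>2 \<le> D * e i" if i: "i < n" and y: "y \<in> piece i" for i y
  proof -
    obtain t where t: "t \<in> {\<alpha> i..\<beta> i}" "y = c (J i) t" using param[OF i, of y] y by (auto simp: piece_def)
    obtain s where s: "s \<in> {\<alpha> i..\<beta> i}" "x i = c (J i) s" using param[OF i x[OF i]] by blast
    have "(w y)\<^sup>2 \<le> \<bar>t - s\<bar> * \<epsilon> i"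
      using v_diff[OF i s(1) t(1)] w_piece[OF i y] s t by simp
    also have "\<dots> \<le> (D / L) * \<epsilon> i"
    proof (intro mult_right_mono \<epsilon>[OF i])
      have "\<bar>t - s\<bar> \<le> \<beta> i - \<alpha> i" using s t by auto
      also have "\<dots> \<le> D / L" using D_ge[OF i] L by (simp add: field_simps)
      finally show "\<bar>t - s\<bar> \<le> D / L" .
    qed
    also have "\<dots> \<le> D * e i" using \<epsilon>[OF i] D \<kappa> L by (simp add: e_def field_simps)
    finally show ?thesis .
  qed
  have near: "(w (c (J i) u) - w (c (J i) t))\<^sup>2 \<le> \<kappa> * \<bar>u - t\<bar> * e i"
    if i: "i < n" and tu: "t \<in> {\<alpha> i..\<beta> i}" "u \<in> {\<alpha> i..\<beta> i}"
      and p: "c (J i) t \<in> piece i" "c (J i) u \<in> piece i" for i t u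
  proof -
    have "(w (c (J i) u) - w (c (J i) t))\<^sup>2 \<le> \<bar>u - t\<bar> * \<epsilon> i"
      using v_diff[OF i tu] by (simp add: w_piece[OF i p(1)] w_piece[OF i p(2)])
    also have "\<dots> \<le> \<bar>u - t\<bar> * (\<kappa> * e i)"
      using \<epsilon>[OF i] \<kappa> L by (intro mult_left_mono) (auto simp: e_def field_simps)
    finally show ?thesis by (simp add: mult_ac)
  qed
  have ws: "w \<in> sobolev_space \<sigma> r"
    by (rule sobolev_of_arcs(1)[OF w_meas r e_nonneg bound near])
  have wn: "sobolev_norm \<sigma> r w \<le> sqrt (A * D\<^sup>2 * E)
      + (if r = 0 then 0 else sqrt (S.gagliardo_const r (\<kappa> / L) * D powr (2 - 2 * r) * E))"
    using sobolev_of_arcs(2)[OF w_meas r e_nonneg bound near] by (simp only: sum_e)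
  \<comment> \<open>\<open>v\<close> is decomposed into \<open>w\<close> and indicators because
    these are known to lie in the Sobolev space, where \<open>\<phi>\<close> is additive.\<close>
  have "\<phi> v = \<phi> (\<lambda>y. w y + (\<Sum>i<n. v (x i) * indicat_real (\<Gamma> i) y))"
    by (simp add: w_def)
  also have "\<dots> = \<phi> w + (\<Sum>i<n. v (x i) * \<phi> (indicat_real (\<Gamma> i)))"
    by (rule S.sobolev_dual_sum[OF \<phi> ws indicator_in_sobolev_space[OF _ r]])
  finally have "\<phi> v - dirac_approx n g x \<phi> v = \<phi> w"
    by (simp add: dirac_approx_def mult.commute)
  then have "\<bar>\<phi> v - dirac_approx n g x \<phi> v\<bar> \<le> dual_norm \<sigma> r \<phi> * sobolev_norm \<sigma> r w"
    using S.dual_norm_bound(1)[OF \<phi> ws] by simp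
  also have "\<dots> \<le> dual_norm \<sigma> r \<phi> * (sqrt (A * D\<^sup>2 * E)
      + (if r = 0 then 0 else sqrt (S.gagliardo_const r (\<kappa> / L) * D powr (2 - 2 * r) * E)))"
    using wn S.dual_norm_bound(2)[OF \<phi>] by (rule mult_left_mono)
  finally show ?thesis .
qed

text \<open>Arcs overlap only in endpoints, so each may be replaced by its piece without changing
  the measure, and the pieces are disjoint.\<close>

lemma sum_measure_arcs_le:
  assumes B: "B \<in> sets borel"
  shows "(\<Sum>i<n. measure \<sigma> (\<Gamma> i \<inter> B)) \<le> measure \<sigma> (\<gamma> \<inter> B)"
proof -
  have pB: "piece i \<inter> B \<in> sets \<sigma>" if "i < n" for i
    unfolding piece_def using \<Gamma>_sub[OF that] finite_endpoints B
    by (intro in_sets_\<sigma> sets.Int sets.Diff borel_\<Gamma> that) (auto intro: borel_closed finite_imp_closed)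
  have "measure \<sigma> (\<Gamma> i \<inter> B) = measure \<sigma> (piece i \<inter> B)" if i: "i < n" for i
  proof (rule measure_eq_AE)
    show "AE x in \<sigma>. x \<in> \<Gamma> i \<inter> B \<longleftrightarrow> x \<in> piece i \<inter> B"
      using AE_no_endpoint by eventually_elim (auto simp: piece_def)
    show "\<Gamma> i \<inter> B \<in> sets \<sigma>"
      using \<Gamma>_sub[OF i] borel_\<Gamma>[OF i] B by (intro in_sets_\<sigma>) auto
  qed (rule pB[OF i])
  then have "(\<Sum>i<n. measure \<sigma> (\<Gamma> i \<inter> B)) = (\<Sum>i<n. measure \<sigma> (piece i \<inter> B))" by simp
  also have "\<dots> = measure \<sigma> (\<Union>i<n. piece i \<inter> B)"
  proof (rule S.finite_measure_finite_Union[symmetric])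
    show "disjoint_family_on (\<lambda>i. piece i \<inter> B) {..<n}"
      unfolding disjoint_family_on_def using piece_unique by (fastforce simp: piece_def)
  qed (use pB in auto)
  also have "\<dots> \<le> measure \<sigma> (\<gamma> \<inter> B)"
    using \<Gamma>_sub B by (intro S.finite_measure_mono in_sets_\<sigma>) (auto simp: piece_def)
  finally show ?thesis .
qed

end

section \<open>Summation over the triangles and the final estimate\<close>

text \<open>This is the inverse estimate for gradients: boundary length in a triangle is at most
  \<open>A\<close> times its diameter, and shape regularity together with the lower size bound
  \<open>\<eta>\<close> compares the diameter with area divided by \<open>\<eta>\<close>.\<close>

lemma (in boundary_curves) sum_gradients_le:
  assumes ah: "ahlfors_upper \<sigma> A" and T: "triangulates \<T> unit_square"
    and ratio: "\<And>K. K \<in> \<T> \<Longrightarrow> diameter K / inradius K \<le> \<rho>"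
    and size: "0 < \<eta>" "\<And>K. K \<in> \<T> \<Longrightarrow> \<eta> \<le> diameter K"
    and P: "\<And>K. K \<in> \<T> \<Longrightarrow> P K \<in> sets borel" "\<And>K. P K \<subseteq> K"
    and v: "\<And>K x. K \<in> \<T> \<Longrightarrow> x \<in> K \<Longrightarrow> v x = a K \<bullet> x + b K"
  shows "(\<Sum>K\<in>\<T>. (norm (a K))\<^sup>2 * measure \<sigma> (\<gamma> \<inter> P K))
    \<le> A * (4 * \<rho>\<^sup>2 / pi) / \<eta> * (H1_seminorm unit_square v)\<^sup>2"
proof -
  have A: "0 < A" using ah by (simp add: ahlfors_upper_def ahlfors_upper_axioms_def)
  have "measure \<sigma> (\<gamma> \<inter> P K) \<le> A * (4 * \<rho>\<^sup>2 / pi) / \<eta> * measure lebesgue (interior K)"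
    if K: "K \<in> \<T>" for K
  proof -
    have K2: "2 simplex K" using T K unfolding triangulates_def by blast
    have bd: "bounded K" using compact_simplex[OF K2] by (rule compact_imp_bounded)
    note diam = diameter_square_le_area[OF bd triangle_interior_nonempty[OF K2] ratio[OF K]]
    have "measure \<sigma> (\<gamma> \<inter> P K) \<le> A * diameter K"
      by (rule measure_triangle_le[OF ah bd diam(1) P(2) P(1)[OF K]])
    \<comment> \<open>A second factor \<open>diameter K\<close>, needed to reach the area, is bought
      with \<open>1 / \<eta>\<close>.\<close>
    also have "\<dots> \<le> A * ((diameter K)\<^sup>2 / \<eta>)"
    proof (rule mult_left_mono)
      have "\<eta> * diameter K \<le> diameter K * diameter K"
        using size(2)[OF K] diam(1) by (intro mult_right_mono) auto
      then show "diameter K \<le> (diameter K)\<^sup>2 / \<eta>"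
        using size(1) by (simp add: field_simps power2_eq_square)
    qed (use A in simp)
    also have "\<dots> \<le> A * ((4 * \<rho>\<^sup>2 / pi * measure lebesgue (interior K)) / \<eta>)"
      using A size(1) diam(2) by (intro mult_left_mono divide_right_mono) auto
    finally show ?thesis by simp
  qed
  then have "(\<Sum>K\<in>\<T>. (norm (a K))\<^sup>2 * measure \<sigma> (\<gamma> \<inter> P K))
      \<le> (\<Sum>K\<in>\<T>. (norm (a K))\<^sup>2 * (A * (4 * \<rho>\<^sup>2 / pi) / \<eta> * measure lebesgue (interior K)))"
    by (intro sum_mono mult_left_mono) auto
  also have "\<dots> = A * (4 * \<rho>\<^sup>2 / pi) / \<eta> * (\<Sum>K\<in>\<T>. (norm (a K))\<^sup>2 * measure lebesgue (interior K))"
    unfolding sum_distrib_left by (intro sum.cong) (simp_all only: mult_ac)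
  also have "(\<Sum>K\<in>\<T>. (norm (a K))\<^sup>2 * measure lebesgue (interior K)) = (H1_seminorm unit_square v)\<^sup>2"
    by (rule H1_seminorm_P1[OF T unit_square_open_convex v, symmetric])
  finally show ?thesis .
qed

text \<open>
  Since the arcs have \<open>D \<le> L\<close>, the \<open>L\<^sup>2\<close> part, of order \<open>D\<close>, is absorbed by \<open>D\<^bsup>1-r\<^esup>\<close>.
\<close>

lemma sobolev_bound_absorb:
  fixes r :: real
  assumes D: "0 < D" "D \<le> L" "D \<le> R * h'" and pos: "0 \<le> A" "0 \<le> E" "0 < R" "0 < h'" and r: "0 \<le> r" "r < 1 / 2"
    and G: "0 < r \<Longrightarrow> 0 \<le> G"
  shows "sqrt (A * D\<^sup>2 * E) + (if r = 0 then 0 else sqrt (G * D powr (2 - 2 * r) * E))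
    \<le> (sqrt A * L powr r + sqrt \<bar>G\<bar>) * R powr (1 - r) * (h' powr (1 - r) * sqrt E)"
proof -
  have p: "sqrt (D powr (2 - 2 * r)) = D powr (1 - r)"
  proof -
    have "D powr (2 - 2 * r) = (D powr (1 - r))\<^sup>2"
      using D(1) by (simp add: power2_eq_square flip: powr_add)
    then show ?thesis by simp
  qed
  have "D powr (1 - r) \<le> (R * h') powr (1 - r)"
    using D r by (intro powr_mono2) auto
  then have Dp: "D powr (1 - r) \<le> R powr (1 - r) * h' powr (1 - r)"
    using pos by (simp add: powr_mult)
  have "D = D powr r * D powr (1 - r)" using D(1) by (simp flip: powr_add)
  also have "\<dots> \<le> L powr r * D powr (1 - r)"
    using D r by (intro mult_right_mono powr_mono2) auto
  finally have "sqrt A * D * sqrt E \<le> sqrt A * (L powr r * D powr (1 - r)) * sqrt E"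
    using pos by (intro mult_right_mono mult_left_mono) auto
  moreover have "sqrt (A * D\<^sup>2 * E) = sqrt A * D * sqrt E"
    using D by (simp add: real_sqrt_mult)
  \<comment> \<open>\<open>G\<close> is known to be nonnegative only for \<open>0 < r\<close>; the
    absolute value keeps the constant nonnegative for \<open>r = 0\<close>, where this term is
    absent.\<close>
  moreover have "(if r = 0 then 0 else sqrt (G * D powr (2 - 2 * r) * E)) \<le> sqrt \<bar>G\<bar> * D powr (1 - r) * sqrt E"
    using r G pos by (auto simp: real_sqrt_mult p)
  ultimately have "sqrt (A * D\<^sup>2 * E) + (if r = 0 then 0 else sqrt (G * D powr (2 - 2 * r) * E))
     \<le> (sqrt A * L powr r + sqrt \<bar>G\<bar>) * D powr (1 - r) * sqrt E"
    by (simp add: algebra_simps)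
  also have "\<dots> \<le> (sqrt A * L powr r + sqrt \<bar>G\<bar>) * (R powr (1 - r) * h' powr (1 - r)) * sqrt E"
    using Dp pos by (intro mult_right_mono mult_left_mono) auto
  finally show ?thesis by (simp add: mult_ac)
qed

theorem proposition1:
  fixes \<omega> :: "(real^2) set" and m :: nat and c :: "nat \<Rightarrow> real \<Rightarrow> real^2"
    and H H' :: "real set"
    and T :: "real \<Rightarrow> (real^2) set set"
    and N :: "real \<Rightarrow> nat" and g :: "real \<Rightarrow> nat \<Rightarrow> real \<Rightarrow> real^2"
    and x :: "real \<Rightarrow> nat \<Rightarrow> real^2" and s :: real
  assumes "smooth_domain \<omega> m c" and "closure \<omega> \<subseteq> unit_square"
    and "regular_family H T unit_square" and "mesh_size H T"
    and "0 < s" and "s \<le> 1/2"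
    and "quasi_uniform_family (arclength m c) H' N g"
    and "\<And>h' i. h' \<in> H' \<Longrightarrow> i < N h' \<Longrightarrow> x h' i \<in> path_image (g h' i)"
  shows "\<exists>C>0. \<forall>h\<in>H. \<forall>h'\<in>H'.
           \<forall>\<phi>\<in>sobolev_dual (arclength m c) (1/2 - s). \<forall>v\<in>P1_space unit_square (T h).
             \<bar>\<phi> v - dirac_approx (N h') (g h') (x h') \<phi> v\<bar>
               \<le> C * sqrt (h' / h) * h' powr s
                   * dual_norm (arclength m c) (1/2 - s) \<phi> * H1_seminorm unit_square v"
proof -
  interpret boundary_curves m c
    using assms(1) unfolding smooth_domain_def by unfold_locales blast+
  obtain A where ah: "ahlfors_upper \<sigma> A" using ahlfors_arclength by blast
  interpret S: ahlfors_plane \<sigma> A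
    using ah by (rule ahlfors_plane.intro)
  obtain l L where l: "0 < l" and L: "0 < L" and lL: "\<forall>j<m. \<forall>t. l \<le> norm (c' j t) \<and> norm (c' j t) \<le> L"
    using speed_bounds by (elim exE conjE)
  obtain \<kappa> where \<kappa>: "0 < \<kappa>" and chord: "\<forall>j<m. \<forall>t. \<forall>y\<in>\<gamma>. dist (c j t) y < \<kappa> \<longrightarrow>
     (\<exists>u. y = c j u \<and> \<kappa> * \<bar>u - t\<bar> \<le> dist (c j t) y)"
    using chord_arc by (elim exE conjE)
  obtain b0 where b0: "0 < b0" and arcs: "\<And>h'. h' \<in> H' \<Longrightarrow> 0 < h'"
      "\<And>h'. h' \<in> H' \<Longrightarrow> arc_partition \<gamma> (N h') (g h')"
      "\<And>h' i. h' \<in> H' \<Longrightarrow> i < N h' \<Longrightarrow> measure \<sigma> (path_image (g h' i)) \<le> b0 * h'"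
  proof -
    from assms(7) obtain a0 b0 where "0 < a0 \<and> a0 < b0 \<and>
        (\<forall>h'\<in>H'. \<forall>i<N h'. a0 * h' \<le> measure \<sigma> (path_image (g h' i)) \<and> measure \<sigma> (path_image (g h' i)) \<le> b0 * h')"
      and "\<forall>h'\<in>H'. 0 < h' \<and> arc_partition (space \<sigma>) (N h') (g h')"
      unfolding quasi_uniform_family_def by (elim exE conjE) (rule that, auto)
    then show ?thesis by (intro that[of b0]) auto
  qed
  obtain \<rho> where tri: "\<And>h. h \<in> H \<Longrightarrow> triangulates (T h) unit_square"
      and \<rho>: "\<And>h K. h \<in> H \<Longrightarrow> K \<in> T h \<Longrightarrow> diameter K / inradius K \<le> \<rho>"
    using assms(3) unfolding regular_family_def by blast
  obtain \<theta> where h_pos: "\<And>h. h \<in> H \<Longrightarrow> 0 < h" and \<theta>: "0 < \<theta>" "\<And>h K. h \<in> H \<Longrightarrow> K \<in> T h \<Longrightarrow> \<theta> * h \<le> diameter K"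
    using assms(4) unfolding mesh_size_def by blast
  define r where "r = 1 / 2 - s"
  have r: "0 \<le> r" "r < 1 / 2" using assms(5,6) by (auto simp: r_def)
  have \<gamma>_sub: "\<gamma> \<subseteq> closure unit_square"
  proof -
    have "\<gamma> = frontier \<omega>" using assms(1) unfolding smooth_domain_def by blast
    also have "\<dots> \<subseteq> closure \<omega>" unfolding frontier_def by blast
    also have "\<dots> \<subseteq> unit_square" by (rule assms(2))
    also have "\<dots> \<subseteq> closure unit_square" by (rule closure_subset)
    finally show ?thesis .
  qed
  \<comment> \<open>All constants are fixed before \<open>h\<close>, \<open>h'\<close>,
    \<open>\<phi>\<close> and \<open>v\<close>: they depend only on the curves, on \<open>s\<close>
    and on the uniform bounds for the two families.\<close>
  define G where "G = S.gagliardo_const r (\<kappa> / L)"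
  define R where "R = L * b0 / l"
  define C1 where "C1 = (sqrt A * L powr r + sqrt \<bar>G\<bar>) * R powr (1 - r)"
  define C2 where "C2 = (1 / L + 1 / \<kappa>) * (L\<^sup>2 / l * (A * (4 * \<rho>\<^sup>2 / pi) / \<theta>))"
  have R: "0 < R" using L l b0 by (simp add: R_def)
  have C1: "0 \<le> C1" using S.A_pos by (simp add: C1_def)
  have C2: "0 \<le> C2" using S.A_pos L \<kappa> l \<theta>(1) by (simp add: C2_def)
  have main: "\<bar>\<phi> v - dirac_approx (N h') (g h') (x h') \<phi> v\<bar>
      \<le> (C1 * sqrt C2) * sqrt (h' / h) * h' powr s * dual_norm \<sigma> r \<phi> * H1_seminorm unit_square v"
    if h: "h \<in> H" and h': "h' \<in> H'" and \<phi>: "\<phi> \<in> sobolev_dual \<sigma> r" and v: "v \<in> P1_space unit_square (T h)"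
    for h h' \<phi> v
  proof -
    have hp: "0 < h" "0 < h'" using h_pos[OF h] arcs(1)[OF h'] .
    have part: "arc_partition \<gamma> (N h') (g h')" by (rule arcs(2)[OF h'])
    have "\<exists>j \<alpha> \<beta>. j < m \<and> \<alpha> \<le> \<beta> \<and> \<beta> \<le> \<alpha> + 1 \<and> path_image (g h' i) = c j ` {\<alpha>..\<beta>}"
      if i: "i < N h'" for i
    proof (rule arc_parametrisation)
      show "arc (g h' i)" using part i unfolding arc_partition_def by blast
      show "path_image (g h' i) \<subseteq> \<gamma>" using part i unfolding arc_partition_def by blast
    qed
    then obtain J \<alpha> \<beta> where J: "\<And>i. i < N h' \<Longrightarrow> J i < m \<and> \<alpha> i \<le> \<beta> i \<and> \<beta> i \<le> \<alpha> i + 1 \<and>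
        path_image (g h' i) = c (J i) ` {\<alpha> i..\<beta> i}"
      by metis
    \<comment> \<open>Parameter intervals have length at most \<open>b0 * h' / l\<close> by
      quasi-uniformity and at most 1 by periodicity. The minimum gives both
      \<open>D \<le> R * h'\<close> and, for coarse partitions, \<open>D \<le> L\<close>.\<close>
    define D where "D = L * min 1 (b0 * h' / l)"
    have D: "0 < D" "D \<le> L" "D \<le> R * h'"
      using L b0 l hp mult_left_mono[of "min 1 (b0 * h' / l)" "b0 * h' / l" L] by (auto simp: D_def R_def)
    have D_ge: "L * (\<beta> i - \<alpha> i) \<le> D" if i: "i < N h'" for i
    proof -
      have ab: "\<alpha> i \<le> \<beta> i" "\<beta> i \<le> \<alpha> i + 1" and Ji: "J i < m" using J[OF i] by auto
      have "ennreal l * emeasure lborel ({\<alpha> i..\<beta> i} \<inter> c (J i) -` UNIV) \<le> emeasure \<sigma> (c (J i) ` {\<alpha> i..\<beta> i} \<inter> UNIV)"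
        using lL Ji by (intro emeasure_arclength_ge l ab) auto
      then have "ennreal (l * (\<beta> i - \<alpha> i)) \<le> ennreal (measure \<sigma> (path_image (g h' i)))"
        using ab l J[OF i] by (simp add: ennreal_mult S.emeasure_eq_measure)
      then have "l * (\<beta> i - \<alpha> i) \<le> measure \<sigma> (path_image (g h' i))"
        by (subst (asm) ennreal_le_iff) auto
      also have "\<dots> \<le> b0 * h'" by (rule arcs(3)[OF h' i])
      finally have "\<beta> i - \<alpha> i \<le> b0 * h' / l" using l by (simp add: field_simps)
      then show ?thesis unfolding D_def using ab L by (intro mult_left_mono) auto
    qed
    interpret M: arc_mesh m c A "N h'" "g h'" L \<kappa> D J \<alpha> \<beta>
      by unfold_locales (use L lL \<kappa> chord part D J D_ge in auto)
    have tr: "triangulates (T h) unit_square" by (rule tri[OF h])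
    have fin: "finite (T h)" using tr unfolding triangulates_def triangulation_def by blast
    have UnT: "\<Union>(T h) = closure unit_square" using tr unfolding triangulates_def by blast
    have v_cont: "continuous_on \<gamma> v"
      using v \<gamma>_sub unfolding P1_space_def by (auto intro: continuous_on_subset)
    have "\<forall>K\<in>T h. \<exists>a b. \<forall>x\<in>K. v x = a \<bullet> x + b"
      using v unfolding P1_space_def by simp
    then obtain a b where vK: "\<And>K x. K \<in> T h \<Longrightarrow> x \<in> K \<Longrightarrow> v x = a K \<bullet> x + b K"
      by metis
    have "K \<in> sets borel" if "K \<in> T h" for K
      using tr that unfolding triangulates_def by (blast intro: borel_closed closed_simplex)
    from borel_disjoint_refinement[OF fin this] obtain P where
      "(\<forall>K\<in>T h. P K \<in> sets borel) \<and> (\<forall>K. P K \<subseteq> K) \<and> disjoint_family_on P (T h)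
       \<and> (\<Union>K\<in>T h. P K) = \<Union>(T h)" by (rule exE)
    then have P: "\<And>K. K \<in> T h \<Longrightarrow> P K \<in> sets borel" "\<And>K. P K \<subseteq> K" "disjoint_family_on P (T h)"
      and UnP: "(\<Union>K\<in>T h. P K) = \<Union>(T h)" by simp_all
    define \<epsilon> where "\<epsilon> i = L\<^sup>2 / l * (\<Sum>K\<in>T h. (norm (a K))\<^sup>2 * measure \<sigma> (path_image (g h' i) \<inter> P K))" for i
    have \<epsilon>_nonneg: "0 \<le> \<epsilon> i" for i
      unfolding \<epsilon>_def using l by (intro mult_nonneg_nonneg sum_nonneg) auto
    define E where "E = (1 / L + 1 / \<kappa>) * (\<Sum>i<N h'. \<epsilon> i)"
    have E_nonneg: "0 \<le> E" unfolding E_def using L \<kappa> \<epsilon>_nonneg by (intro mult_nonneg_nonneg sum_nonneg) auto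
    have v_meas: "v \<in> borel_measurable \<sigma>"
    proof -
      have "v \<in> borel_measurable (restrict_space borel \<gamma>)"
        using v_cont by (rule borel_measurable_continuous_on_restrict)
      then show ?thesis using measurable_cong_sets[OF sets_\<sigma> refl] by blast
    qed
    have v_diff: "(v (c (J i) u) - v (c (J i) t))\<^sup>2 \<le> \<bar>u - t\<bar> * \<epsilon> i"
      if i: "i < N h'" and tu: "t \<in> {\<alpha> i..\<beta> i}" "u \<in> {\<alpha> i..\<beta> i}" for i t u
    proof -
      have Ji: "J i < m" "\<alpha> i \<le> \<beta> i" "\<beta> i \<le> \<alpha> i + 1" "path_image (g h' i) = c (J i) ` {\<alpha> i..\<beta> i}"
        using J[OF i] by auto
      show ?thesis
        unfolding \<epsilon>_def Ji(4)
      proof (rule arc_square_diff_le[OF l _ _ S.finite_measure_axioms Ji(1-3) tu fin P(1) P(3) _ v_cont])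
        show "\<gamma> \<subseteq> (\<Union>K\<in>T h. P K)" using \<gamma>_sub UnT UnP by simp
        show "v x = a K \<bullet> x + b K" if "K \<in> T h" "x \<in> P K" for K x
          using vK[of K x] that P(2)[of K] by auto
      qed (use lL Ji in auto)
    qed
    have err: "\<bar>\<phi> v - dirac_approx (N h') (g h') (x h') \<phi> v\<bar> \<le> dual_norm \<sigma> r \<phi> * (sqrt (A * D\<^sup>2 * E)
      + (if r = 0 then 0 else sqrt (G * D powr (2 - 2 * r) * E)))"
      unfolding E_def G_def
      by (rule M.interpolation_error[OF v_meas r \<epsilon>_nonneg v_diff assms(8)[OF h'] \<phi>])
    have "E \<le> C2 / h * (H1_seminorm unit_square v)\<^sup>2"
    proof -
      \<comment> \<open>Exchanging the sums collects, for each triangle, the lengths contributed by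
        all arcs; they add up to at most the boundary length in \<open>P K\<close>.\<close>
      have "(\<Sum>i<N h'. \<epsilon> i) = L\<^sup>2 / l * (\<Sum>K\<in>T h. (norm (a K))\<^sup>2 * (\<Sum>i<N h'. measure \<sigma> (path_image (g h' i) \<inter> P K)))"
        unfolding \<epsilon>_def sum_distrib_left[symmetric]
        by (subst sum.swap) (simp add: sum_distrib_left)
      also have "\<dots> \<le> L\<^sup>2 / l * (\<Sum>K\<in>T h. (norm (a K))\<^sup>2 * measure \<sigma> (\<gamma> \<inter> P K))"
        using l P(1) by (intro mult_left_mono sum_mono M.sum_measure_arcs_le) auto
      also have "\<dots> \<le> L\<^sup>2 / l * (A * (4 * \<rho>\<^sup>2 / pi) / (\<theta> * h) * (H1_seminorm unit_square v)\<^sup>2)"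
        using l \<theta>(1) hp
        by (intro mult_left_mono sum_gradients_le[OF ah tr \<rho>[OF h] _ \<theta>(2)[OF h] P(1,2) vK]) auto
      finally have "E \<le> (1 / L + 1 / \<kappa>) * (L\<^sup>2 / l * (A * (4 * \<rho>\<^sup>2 / pi) / (\<theta> * h) * (H1_seminorm unit_square v)\<^sup>2))"
        unfolding E_def using L \<kappa> by (intro mult_left_mono) auto
      also have "\<dots> = C2 / h * (H1_seminorm unit_square v)\<^sup>2"
        by (simp add: C2_def)
      finally show ?thesis .
    qed
    then have "sqrt E \<le> sqrt (C2 / h * (H1_seminorm unit_square v)\<^sup>2)" by (rule real_sqrt_le_mono)
    also have "\<dots> = sqrt C2 / sqrt h * H1_seminorm unit_square v"
    proof -
      have "0 \<le> (LINT x:unit_square|lebesgue. (norm (grad v x))\<^sup>2)"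
        unfolding set_lebesgue_integral_def by (intro Bochner_Integration.integral_nonneg) auto
      then have "0 \<le> H1_seminorm unit_square v" by (simp add: H1_seminorm_def)
      then show ?thesis by (simp add: real_sqrt_mult real_sqrt_divide)
    qed
    finally have sqE: "sqrt E \<le> sqrt C2 / sqrt h * H1_seminorm unit_square v" .
    \<comment> \<open>Here \<open>1 - r = 1/2 + s\<close> separates the half power, which joins
      \<open>1 / sqrt h\<close>, from the rate \<open>s\<close>.\<close>
    have hs: "h' powr (1 - r) = sqrt h' * h' powr s"
      using hp(2) powr_half_sqrt[of h'] by (simp add: r_def powr_add)
    have "sqrt (A * D\<^sup>2 * E) + (if r = 0 then 0 else sqrt (G * D powr (2 - 2 * r) * E))
        \<le> C1 * (h' powr (1 - r) * sqrt E)"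
      unfolding C1_def G_def using D S.A_pos E_nonneg R hp r S.gagliardo_const_nonneg
      by (intro sobolev_bound_absorb) auto
    also have "\<dots> \<le> C1 * (h' powr (1 - r) * (sqrt C2 / sqrt h * H1_seminorm unit_square v))"
      using C1 sqE by (intro mult_left_mono) auto
    finally have "dual_norm \<sigma> r \<phi> * (sqrt (A * D\<^sup>2 * E) + (if r = 0 then 0 else sqrt (G * D powr (2 - 2 * r) * E)))
        \<le> dual_norm \<sigma> r \<phi> * (C1 * (h' powr (1 - r) * (sqrt C2 / sqrt h * H1_seminorm unit_square v)))"
      using S.dual_norm_bound(2)[OF \<phi>] by (rule mult_left_mono)
    also have "\<dots> = (C1 * sqrt C2) * sqrt (h' / h) * h' powr s * dual_norm \<sigma> r \<phi> * H1_seminorm unit_square v"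
      by (simp add: hs real_sqrt_divide)
    finally show ?thesis using err by linarith
  qed
  \<comment> \<open>Only nonnegativity of \<open>C1\<close> and \<open>C2\<close> is recorded;
    adding 1 yields the strictly positive constant.\<close>
  have "\<bar>\<phi> v - dirac_approx (N h') (g h') (x h') \<phi> v\<bar>
      \<le> (C1 * sqrt C2 + 1) * sqrt (h' / h) * h' powr s * dual_norm \<sigma> r \<phi> * H1_seminorm unit_square v"
    if h: "h \<in> H" and h': "h' \<in> H'" and \<phi>: "\<phi> \<in> sobolev_dual \<sigma> r" and v: "v \<in> P1_space unit_square (T h)"
    for h h' \<phi> v
  proof -
    have "0 \<le> (LINT x:unit_square|lebesgue. (norm (grad v x))\<^sup>2)"
      unfolding set_lebesgue_integral_def by (intro Bochner_Integration.integral_nonneg) auto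
    then have "0 \<le> H1_seminorm unit_square v" by (simp add: H1_seminorm_def)
    then have "(C1 * sqrt C2) * sqrt (h' / h) * h' powr s * dual_norm \<sigma> r \<phi> * H1_seminorm unit_square v
        \<le> (C1 * sqrt C2 + 1) * sqrt (h' / h) * h' powr s * dual_norm \<sigma> r \<phi> * H1_seminorm unit_square v"
      using h_pos[OF h] arcs(1)[OF h'] S.dual_norm_bound(2)[OF \<phi>] by (intro mult_right_mono) auto
    then show ?thesis using main[OF h h' \<phi> v] by linarith
  qed
  moreover have "0 < C1 * sqrt C2 + 1" using C1 C2 by (simp add: add_nonneg_pos)
  ultimately show ?thesis unfolding r_def by blast
qed

end
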